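(* Each of the permutation groups $A_4(6)$, $S_4(6d)$ and $S_4(6c)$ is of exponential type. That is, for each $L\in\{A_4(6),S_4(6d),S_4(6c)\}$ there exist constants $c>0$ and $\beta>1$ and an infinite family $\{(\Gamma_n,G_n)\}_{n\in\mathbb{N}}$ of locally-$L$ pairs, with $|\mathrm{V}(\Gamma_n)|$ unbounded, such that for every arc $(u,v)$ of $\Gamma_n$ we have $|(G_n)_{uv}|\ge c\,\beta^{|\mathrm{V}(\Gamma_n)|}$.
   Context: All graphs are finite, connected, simple and undirected. An arc of a graph $\Gamma$ is an ordered pair of adjacent vertices; $\mathrm{V}(\Gamma)$ denotes the vertex set. A graph $\Gamma$ is $G$-arc-transitive if $G\le\mathrm{Aut}(\Gamma)$ acts transitively on the arcs of $\Gamma$. For such $G$ and a vertex $v$, let $G_v^{\Gamma(v)}$ be the permutation group induced by the vertex-stabiliser $G_v$ on the neighbourhood $\Gamma(v)$ of $v$; it is transitive and independent of $v$ up to permutation isomorphism. If $L$ is a permutation group permutationally isomorphic to $G_v^{\Gamma(v)}$, the pair $(\Gamma,G)$ (with $\Gamma$ connected, finite and $G$-arc-transitive) is called locally-$L$. $G_{uv}$ denotes the stabiliser in $G$ of both $u$ and $v$. A transitive permutation group $L$ is of exponential type if there is an exponential function $g_L$ and an infinite family of locally-$L$ pairs $(\Gamma_n,G_n)$ with $|(G_n)_{uv}|\ge g_L(|\mathrm{V}(\Gamma_n)|)$ for arcs $(u,v)$ of $\Gamma_n$. The groups: $A_4(6)$ is $\mathrm{Alt}(4)$ acting on the right cosets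 of $\langle (1\,2)(3\,4)\rangle$; $S_4(6d)$ is $\mathrm{Sym}(4)$ acting on the cosets of $\langle (1\,2),(3\,4)\rangle$; $S_4(6c)$ is $\mathrm{Sym}(4)$ acting on the cosets of $\langle (1\,2\,3\,4)\rangle$ (all of degree $6$). *)

theory Defs
  imports Complex_Main "HOL-Algebra.Group_Action" "HOL-Algebra.Generated_Groups"
    "HOL-Algebra.Sym_Groups" "Graph_Theory.Digraph_Component"
begin

section \<open>Permutation groups\<close>

text \<open>A permutation group is a pair \<open>(\<Omega>, P)\<close> of a set and a subgroup of \<^term>\<open>BijGroup \<Omega>\<close>.\<close>

type_synonym 'a perm_group = "'a set \<times> ('a \<Rightarrow> 'a) set"

definition transitive_perm_group :: "'a perm_group \<Rightarrow> bool" where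
  "transitive_perm_group L \<longleftrightarrow>
     (case L of (\<Omega>, P) \<Rightarrow>
        subgroup P (BijGroup \<Omega>) \<and> (\<forall>x\<in>\<Omega>. \<forall>y\<in>\<Omega>. \<exists>g\<in>P. g x = y))"

definition perm_isomorphic :: "'a perm_group \<Rightarrow> 'b perm_group \<Rightarrow> bool" where
  "perm_isomorphic L M \<longleftrightarrow>
     (case L of (\<Omega>, P) \<Rightarrow> case M of (\<Delta>, Q) \<Rightarrow>
        \<exists>b \<psi>. bij_betw b \<Omega> \<Delta> \<and>
          \<psi> \<in> iso (BijGroup \<Omega>\<lparr>carrier := P\<rparr>) (BijGroup \<Delta>\<lparr>carrier := Q\<rparr>) \<and>
          (\<forall>g\<in>P. \<forall>x\<in>\<Omega>. b (g x) = \<psi> g (b x)))"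

text \<open>
  The permutation group induced by \<open>K\<close> on the right cosets of \<open>H\<close> by right multiplication.
  The map sending \<open>g\<close> to \<open>C \<mapsto> C #> g\<close> is an anti-homomorphism into \<^term>\<open>BijGroup (rcosets\<^bsub>K\<^esub> H)\<close>,
  whose multiplication composes from right to left, but its image is the same
  as that of the homomorphism \<open>g \<mapsto> (C \<mapsto> C #> inv g)\<close>.
\<close>

definition coset_perm_group :: "('a, 'b) monoid_scheme \<Rightarrow> 'a set \<Rightarrow> 'a set perm_group" where
  "coset_perm_group K H =
     (rcosets\<^bsub>K\<^esub> H, (\<lambda>g. \<lambda>C\<in>rcosets\<^bsub>K\<^esub> H. C #>\<^bsub>K\<^esub> g) ` carrier K)"

definition A4_6 :: "(nat \<Rightarrow> nat) set perm_group" where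
  "A4_6 = coset_perm_group (alt_group 4)
     (generate (alt_group 4) {cycle_of_list [1, 2] \<circ> cycle_of_list [3, 4]})"

definition S4_6d :: "(nat \<Rightarrow> nat) set perm_group" where
  "S4_6d = coset_perm_group (sym_group 4)
     (generate (sym_group 4) {cycle_of_list [1, 2], cycle_of_list [3, 4]})"

definition S4_6c :: "(nat \<Rightarrow> nat) set perm_group" where
  "S4_6c = coset_perm_group (sym_group 4)
     (generate (sym_group 4) {cycle_of_list [1, 2, 3, 4]})"

section \<open>Groups of automorphisms of graphs\<close>

text \<open>
  A finite simple undirected graph is a \<^const>\<open>pair_graph\<close>: a finite vertex set \<^const>\<open>pverts\<close> with
  an irreflexive symmetric relation \<^const>\<open>parcs\<close>, whose elements are exactly the arcs of the graph.
\<close>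

definition Aut :: "'v pair_pre_digraph \<Rightarrow> ('v \<Rightarrow> 'v) monoid" where
  "Aut \<Gamma> = BijGroup (pverts \<Gamma>)
     \<lparr>carrier := {f \<in> Bij (pverts \<Gamma>). \<forall>u\<in>pverts \<Gamma>. \<forall>v\<in>pverts \<Gamma>.
                    (u, v) \<in> parcs \<Gamma> \<longleftrightarrow> (f u, f v) \<in> parcs \<Gamma>}\<rparr>"

definition neighbourhood :: "'v pair_pre_digraph \<Rightarrow> 'v \<Rightarrow> 'v set" where
  "neighbourhood \<Gamma> v = {w. (v, w) \<in> parcs \<Gamma>}"

definition vertex_stabiliser :: "('v \<Rightarrow> 'v) set \<Rightarrow> 'v \<Rightarrow> ('v \<Rightarrow> 'v) set" where
  "vertex_stabiliser G v = {g \<in> G. g v = v}"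

definition arc_stabiliser :: "('v \<Rightarrow> 'v) set \<Rightarrow> 'v \<Rightarrow> 'v \<Rightarrow> ('v \<Rightarrow> 'v) set" where
  "arc_stabiliser G u v = {g \<in> G. g u = u \<and> g v = v}"

definition arc_transitive :: "'v pair_pre_digraph \<Rightarrow> ('v \<Rightarrow> 'v) set \<Rightarrow> bool" where
  "arc_transitive \<Gamma> G \<longleftrightarrow>
     subgroup G (Aut \<Gamma>) \<and>
     (\<forall>(u, v)\<in>parcs \<Gamma>. \<forall>(u', v')\<in>parcs \<Gamma>. \<exists>g\<in>G. g u = u' \<and> g v = v')"

definition local_action :: "'v pair_pre_digraph \<Rightarrow> ('v \<Rightarrow> 'v) set \<Rightarrow> 'v \<Rightarrow> 'v perm_group" where
  "local_action \<Gamma> G v =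
     (neighbourhood \<Gamma> v, (\<lambda>g. restrict g (neighbourhood \<Gamma> v)) ` vertex_stabiliser G v)"

definition locally_pair :: "'a perm_group \<Rightarrow> 'v pair_pre_digraph \<Rightarrow> ('v \<Rightarrow> 'v) set \<Rightarrow> bool" where
  "locally_pair L \<Gamma> G \<longleftrightarrow>
     pair_graph \<Gamma> \<and> Digraph_Component.connected (with_proj \<Gamma>) \<and> arc_transitive \<Gamma> G \<and>
     (\<forall>v\<in>pverts \<Gamma>. perm_isomorphic L (local_action \<Gamma> G v))"

text \<open>
  Vertices are natural numbers without loss of generality, as the graphs are finite.
  An exponential function is \<open>x \<mapsto> c * \<beta> ^ x\<close> with \<open>c > 0\<close> and \<open>\<beta> > 1\<close>.
\<close>

definition exponential_type :: "'a perm_group \<Rightarrow> bool" where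
  "exponential_type L \<longleftrightarrow>
     transitive_perm_group L \<and>
     (\<exists>(c::real) (\<beta>::real) (\<Gamma> :: nat \<Rightarrow> nat pair_pre_digraph) (G :: nat \<Rightarrow> (nat \<Rightarrow> nat) set).
        c > 0 \<and> \<beta> > 1 \<and>
        (\<forall>n. locally_pair L (\<Gamma> n) (G n)) \<and>
        (\<forall>N. \<exists>n. card (pverts (\<Gamma> n)) > N) \<and>
        (\<forall>n. \<forall>(u, v)\<in>parcs (\<Gamma> n).
           real (card (arc_stabiliser (G n) u v)) \<ge> c * \<beta> ^ card (pverts (\<Gamma> n))))"

end

theory Submission
  imports Defs "HOL-Library.Product_Plus" "HOL-Library.Countable"
begin

text \<open>
  Let \<open>\<Lambda>\<close> be a finite connected cubic graph with vertex set \<open>V\<close>, carrying a cyclic order of the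
  neighbours at each vertex, such that the automorphisms preserving these orders are transitive on
  arcs and some automorphism fixing a vertex reverses them all. Replace every vertex \<open>v\<close> by a pair of
  vertices and every edge by a complete bipartite graph on 2+2 vertices. A set \<open>X \<subseteq> V\<close> acts on this
  6-valent graph by swapping the pairs over \<open>X\<close>. If \<open>X\<close> lies in the eigenspace \<open>E\<close> for the eigenvalue 1
  of the adjacency matrix over the field with two elements, and if \<open>v \<notin> X\<close>, then \<open>X\<close> swaps an even
  number of the three pairs adjacent to \<open>v\<close>. So \<open>E\<close>, extended by the order-preserving automorphisms,
  is locally \<open>A\<^sub>4(6)\<close>; with all the automorphisms it is locally \<open>S\<^sub>4(6d)\<close>; and if an
  order-reversing automorphism has to be combined with an \<open>X\<close> in the other coset, where adjacency plus
  identity maps \<open>X\<close> to the all-one vector, it is locally \<open>S\<^sub>4(6c)\<close>. The arc stabilisers contain a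
  subgroup of \<open>E\<close> of index 4.

  It remains to find graphs \<open>\<Lambda>\<close> for which \<open>dim E\<close> is linear in \<open>|V|\<close>. Take 2T to be the group of 24
  Hurwitz units and \<open>\<omega>, \<omega>'\<close> elements of order 3 generating different subgroups. The edges joining
  \<open>(q\<langle>\<omega>\<rangle>, z)\<close> to \<open>(q\<langle>\<omega>'\<rangle>, z + q)\<close> for \<open>q\<close> in 2T define an abelian cover with group \<open>\<int>\<^sup>4\<close> of the
  Moebius-Kantor graph to which all its automorphisms lift. Its eigenspace has a nonzero element of
  finite support. On the quotient by \<open>m\<int>\<^sup>4\<close> this element can be translated in \<open>m\<^sup>4\<close> ways, and a positive
  proportion of the translates is linearly independent.
\<close>

section \<open>Permutation isomorphisms and coset actions\<close>

text \<open>The result is restricted to \<open>\<Delta>\<close> because elements of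
  \<open>BijGroup\<close> are extensional functions.\<close>

definition conj_map :: "'a set \<Rightarrow> 'b set \<Rightarrow> ('a \<Rightarrow> 'b) \<Rightarrow> ('a \<Rightarrow> 'a) \<Rightarrow> 'b \<Rightarrow> 'b" where
  "conj_map \<Omega> \<Delta> b g = (\<lambda>y\<in>\<Delta>. b (g (inv_into \<Omega> b y)))"

lemma conj_map_apply:
  assumes "bij_betw b \<Omega> \<Delta>" "x \<in> \<Omega>"
  shows "conj_map \<Omega> \<Delta> b g (b x) = b (g x)"
  using assms by (auto simp: conj_map_def bij_betw_def)

lemma conj_map_Bij:
  assumes b: "bij_betw b \<Omega> \<Delta>" and g: "g \<in> Bij \<Omega>"
  shows "conj_map \<Omega> \<Delta> b g \<in> Bij \<Delta>"
proof -
  have "bij_betw (inv_into \<Omega> b) \<Delta> \<Omega>" using b by (rule bij_betw_inv_into)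
  moreover have "bij_betw g \<Omega> \<Omega>" using g by (simp add: Bij_def)
  ultimately have "bij_betw (b \<circ> (g \<circ> inv_into \<Omega> b)) \<Delta> \<Delta>"
    using b by (intro bij_betw_trans[of _ _ \<Omega>])
  then have "bij_betw (conj_map \<Omega> \<Delta> b g) \<Delta> \<Delta>"
    by (rule bij_betw_cong[THEN iffD1, rotated]) (simp add: conj_map_def)
  then show ?thesis by (simp add: Bij_def conj_map_def)
qed

lemma extensional_eqI:
  assumes "f \<in> extensional A" "g \<in> extensional A" "\<And>x. x \<in> A \<Longrightarrow> f x = g x"
  shows "f = g"
  using assms by (meson extensionalityI)

text \<open>Conjugation by \<open>b\<close> is a group isomorphism onto its image and is compatible
  with \<open>b\<close> by construction. So a bijection and an image computation are all that has to
  be supplied later.\<close>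

lemma perm_isomorphic_conj:
  assumes b: "bij_betw b \<Omega> \<Delta>" and P: "P \<subseteq> Bij \<Omega>" and Q: "Q = conj_map \<Omega> \<Delta> b ` P"
  shows "perm_isomorphic (\<Omega>, P) (\<Delta>, Q)"
proof -
  let ?\<psi> = "conj_map \<Omega> \<Delta> b"
  have surj: "\<exists>x\<in>\<Omega>. y = b x" if "y \<in> \<Delta>" for y
    using b that by (auto simp: bij_betw_def)
  have mult: "?\<psi> (compose \<Omega> g f) = compose \<Delta> (?\<psi> g) (?\<psi> f)" if "g \<in> P" "f \<in> P" for g f
  proof (rule extensional_eqI)
    fix y assume "y \<in> \<Delta>"
    then obtain x where x: "x \<in> \<Omega>" "y = b x" using surj by blast
    then have "f x \<in> \<Omega>" using that P by (auto simp: Bij_def bij_betw_def)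
    then show "?\<psi> (compose \<Omega> g f) y = compose \<Delta> (?\<psi> g) (?\<psi> f) y"
      using x \<open>y \<in> \<Delta>\<close> b by (simp add: conj_map_apply compose_def)
  qed (simp_all add: conj_map_def compose_def)
  have "?\<psi> \<in> hom (BijGroup \<Omega>\<lparr>carrier := P\<rparr>) (BijGroup \<Delta>\<lparr>carrier := Q\<rparr>)"
  proof (rule homI)
    fix g f assume "g \<in> carrier (BijGroup \<Omega>\<lparr>carrier := P\<rparr>)" "f \<in> carrier (BijGroup \<Omega>\<lparr>carrier := P\<rparr>)"
    then have gf: "g \<in> P" "f \<in> P" by simp_all
    then have "g \<in> Bij \<Omega>" "f \<in> Bij \<Omega>" "?\<psi> g \<in> Bij \<Delta>" "?\<psi> f \<in> Bij \<Delta>"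
      using P b by (auto intro: conj_map_Bij)
    then show "?\<psi> (g \<otimes>\<^bsub>BijGroup \<Omega>\<lparr>carrier := P\<rparr>\<^esub> f)
        = ?\<psi> g \<otimes>\<^bsub>BijGroup \<Delta>\<lparr>carrier := Q\<rparr>\<^esub> ?\<psi> f"
      using mult[OF gf] by (simp add: BijGroup_def)
  qed (use Q in auto)
  moreover have "inj_on ?\<psi> P"
  proof (rule inj_onI)
    fix g f assume gf: "g \<in> P" "f \<in> P" and eq: "?\<psi> g = ?\<psi> f"
    show "g = f"
    proof (rule extensional_eqI)
      fix x assume x: "x \<in> \<Omega>"
      then have "b (g x) = b (f x)" using eq b by (metis conj_map_apply)
      moreover have "g x \<in> \<Omega>" "f x \<in> \<Omega>" using x gf P by (auto simp: Bij_def bij_betw_def)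
      ultimately show "g x = f x" using b by (auto simp: bij_betw_def inj_on_def)
    qed (use gf P in \<open>auto simp: Bij_def\<close>)
  qed
  ultimately have "?\<psi> \<in> iso (BijGroup \<Omega>\<lparr>carrier := P\<rparr>) (BijGroup \<Delta>\<lparr>carrier := Q\<rparr>)"
    using Q by (auto simp: iso_def bij_betw_def)
  then show ?thesis
    unfolding perm_isomorphic_def prod.case using b
    by (intro exI[of _ b] exI[of _ ?\<psi>]) (simp add: conj_map_apply)
qed

lemma perm_isomorphic_trans:
  assumes "perm_isomorphic L M" "perm_isomorphic M N"
  shows "perm_isomorphic L N"
proof -
  obtain \<Omega> P where L: "L = (\<Omega>, P)" by force
  obtain \<Delta> Q where M: "M = (\<Delta>, Q)" by force
  obtain \<Sigma> R where N: "N = (\<Sigma>, R)" by force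
  from assms(1) obtain b \<psi> where b: "bij_betw b \<Omega> \<Delta>"
    "\<psi> \<in> iso (BijGroup \<Omega>\<lparr>carrier := P\<rparr>) (BijGroup \<Delta>\<lparr>carrier := Q\<rparr>)"
    "\<And>g x. g \<in> P \<Longrightarrow> x \<in> \<Omega> \<Longrightarrow> b (g x) = \<psi> g (b x)"
    unfolding perm_isomorphic_def L M by auto
  from assms(2) obtain b' \<psi>' where b': "bij_betw b' \<Delta> \<Sigma>"
    "\<psi>' \<in> iso (BijGroup \<Delta>\<lparr>carrier := Q\<rparr>) (BijGroup \<Sigma>\<lparr>carrier := R\<rparr>)"
    "\<And>g x. g \<in> Q \<Longrightarrow> x \<in> \<Delta> \<Longrightarrow> b' (g x) = \<psi>' g (b' x)"
    unfolding perm_isomorphic_def N M by auto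
  have "\<psi> g \<in> Q" if "g \<in> P" for g using b(2) that by (auto simp: iso_def hom_def)
  moreover have "b x \<in> \<Delta>" if "x \<in> \<Omega>" for x using b(1) that by (auto simp: bij_betw_def)
  moreover have "\<psi>' \<circ> \<psi> \<in> iso (BijGroup \<Omega>\<lparr>carrier := P\<rparr>) (BijGroup \<Sigma>\<lparr>carrier := R\<rparr>)"
    using b(2) b'(2) by (rule iso_set_trans)
  moreover have "bij_betw (b' \<circ> b) \<Omega> \<Sigma>" using b(1) b'(1) by (rule bij_betw_trans)
  ultimately show ?thesis
    unfolding perm_isomorphic_def L N prod.case using b(3) b'(3)
    by (intro exI[of _ "b' \<circ> b"] exI[of _ "\<psi>' \<circ> \<psi>"]) simp
qed

section \<open>Coset actions and the orbit-stabiliser correspondence\<close>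

lemma (in group) inv_image_carrier: "m_inv G ` carrier G = carrier G"
proof
  show "carrier G \<subseteq> m_inv G ` carrier G"
  proof
    fix g assume "g \<in> carrier G"
    then have "g = inv (inv g)" "inv g \<in> carrier G" by simp_all
    then show "g \<in> m_inv G ` carrier G" by (rule image_eqI)
  qed
qed auto

text \<open>The subgroup property comes from the homomorphism \<open>?s\<close>, which multiplies by
  inverses; inversion permutes the carrier, so \<open>?s\<close> and \<open>?t\<close> have the same
  image.\<close>

lemma coset_perm_group_transitive:
  assumes K: "group K" and H: "subgroup H K"
  shows "transitive_perm_group (coset_perm_group K H)"
proof -
  interpret group K by fact
  interpret H: subgroup H K by fact
  let ?R = "rcosets\<^bsub>K\<^esub> H"
  let ?t = "\<lambda>g. \<lambda>C\<in>?R. C #>\<^bsub>K\<^esub> g"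
  have sub: "C \<subseteq> carrier K" if "C \<in> ?R" for C
    using that H.rcosets_carrier[OF K] by blast
  have mem: "C #>\<^bsub>K\<^esub> g \<in> ?R" if C: "C \<in> ?R" and g: "g \<in> carrier K" for C g
  proof -
    obtain k where k: "k \<in> carrier K" "C = H #>\<^bsub>K\<^esub> k" using C by (auto simp: RCOSETS_def)
    then have "C #>\<^bsub>K\<^esub> g = H #>\<^bsub>K\<^esub> (k \<otimes>\<^bsub>K\<^esub> g)" using g by (simp add: coset_mult_assoc H.subset)
    then show ?thesis using k g by (auto simp: RCOSETS_def)
  qed
  have cancel: "C #>\<^bsub>K\<^esub> g #>\<^bsub>K\<^esub> inv\<^bsub>K\<^esub> g = C" if "C \<in> ?R" "g \<in> carrier K" for C g
    using sub[OF that(1)] that by (simp add: coset_mult_assoc)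
  have cancel': "C #>\<^bsub>K\<^esub> inv\<^bsub>K\<^esub> g #>\<^bsub>K\<^esub> g = C" if "C \<in> ?R" "g \<in> carrier K" for C g
    using sub[OF that(1)] that by (simp add: coset_mult_assoc)
  have bij: "?t g \<in> Bij ?R" if "g \<in> carrier K" for g
    unfolding Bij_def using that mem cancel cancel'
    by (auto intro!: bij_betwI[of _ _ _ "\<lambda>C. C #>\<^bsub>K\<^esub> inv\<^bsub>K\<^esub> g"])
  let ?s = "\<lambda>g. ?t (inv\<^bsub>K\<^esub> g)"
  have "?s \<in> hom K (BijGroup ?R)"
  proof (rule homI)
    fix g k assume gk: "g \<in> carrier K" "k \<in> carrier K"
    have "?s (g \<otimes>\<^bsub>K\<^esub> k) = compose ?R (?s g) (?s k)"
      by (rule ext) (use gk mem sub in \<open>auto simp: compose_def coset_mult_assoc inv_mult_group\<close>)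
    then show "?s (g \<otimes>\<^bsub>K\<^esub> k) = ?s g \<otimes>\<^bsub>BijGroup ?R\<^esub> ?s k"
      using bij gk by (simp add: BijGroup_def)
  qed (use bij in \<open>simp add: BijGroup_def\<close>)
  then have "subgroup (?s ` carrier K) (BijGroup ?R)"
    by (intro group_hom.img_is_subgroup)
      (simp add: group_hom_def group_hom_axioms_def K group_BijGroup)
  moreover have "?s ` carrier K = ?t ` carrier K"
  proof -
    have "?s ` carrier K = ?t ` m_inv K ` carrier K" by (simp add: image_image)
    then show ?thesis by (simp only: inv_image_carrier)
  qed
  moreover have "\<exists>g\<in>carrier K. ?t g C = D" if CD: "C \<in> ?R" "D \<in> ?R" for C D
  proof -
    obtain k l where k: "k \<in> carrier K" "C = H #>\<^bsub>K\<^esub> k" and l: "l \<in> carrier K" "D = H #>\<^bsub>K\<^esub> l"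
      using CD by (auto simp: RCOSETS_def)
    have "k \<otimes>\<^bsub>K\<^esub> (inv\<^bsub>K\<^esub> k \<otimes>\<^bsub>K\<^esub> l) = l"
      using k(1) l(1) by (simp add: m_assoc[symmetric])
    then have "C #>\<^bsub>K\<^esub> (inv\<^bsub>K\<^esub> k \<otimes>\<^bsub>K\<^esub> l) = D"
      using k l H.subset by (simp add: coset_mult_assoc)
    then show ?thesis using CD(1) k(1) l(1)
      by (intro bexI[of _ "inv\<^bsub>K\<^esub> k \<otimes>\<^bsub>K\<^esub> l"]) auto
  qed
  ultimately show ?thesis
    unfolding transitive_perm_group_def coset_perm_group_def prod.case by simp
qed

text \<open>The orbit-stabiliser bijection is equivariant. The coset of \<open>g\<close> goes to
  \<open>\<phi>\<close> of the inverse of \<open>g\<close> applied to \<open>\<delta>\<close>: the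
  inverse is forced because the cosets are right cosets and \<open>\<phi>\<close> acts from the
  left.\<close>

lemma coset_perm_group_iso_action:
  assumes K: "group K" and \<phi>: "\<phi> \<in> hom K (BijGroup \<Delta>)" and \<delta>: "\<delta> \<in> \<Delta>"
    and trans: "\<And>y. y \<in> \<Delta> \<Longrightarrow> \<exists>g\<in>carrier K. \<phi> g \<delta> = y"
    and H: "H = {g \<in> carrier K. \<phi> g \<delta> = \<delta>}" and HK: "subgroup H K"
  shows "perm_isomorphic (coset_perm_group K H) (\<Delta>, \<phi> ` carrier K)"
proof -
  interpret group K by fact
  interpret H: subgroup H K by fact
  let ?R = "rcosets\<^bsub>K\<^esub> H"
  let ?t = "\<lambda>g. \<lambda>C\<in>?R. C #>\<^bsub>K\<^esub> g"
  have \<phi>_Bij: "\<phi> g \<in> Bij \<Delta>" if "g \<in> carrier K" for g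
    using \<phi> that by (auto simp: hom_def BijGroup_def)
  have \<phi>_mem: "\<phi> g y \<in> \<Delta>" if "g \<in> carrier K" "y \<in> \<Delta>" for g y
    using \<phi>_Bij[OF that(1)] that(2) by (auto simp: Bij_def bij_betw_def)
  have \<phi>_mult: "\<phi> (g \<otimes>\<^bsub>K\<^esub> k) y = \<phi> g (\<phi> k y)" if "g \<in> carrier K" "k \<in> carrier K" "y \<in> \<Delta>" for g k y
  proof -
    have "\<phi> (g \<otimes>\<^bsub>K\<^esub> k) = \<phi> g \<otimes>\<^bsub>BijGroup \<Delta>\<^esub> \<phi> k" using \<phi> that by (simp add: hom_def)
    then show ?thesis using \<phi>_Bij that by (simp add: BijGroup_def compose_def)
  qed
  have \<phi>_one: "\<phi> \<one>\<^bsub>K\<^esub> y = y" if "y \<in> \<Delta>" for y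
  proof -
    have "\<phi> \<one>\<^bsub>K\<^esub> = \<one>\<^bsub>BijGroup \<Delta>\<^esub>" using \<phi> K group_BijGroup by (rule hom_one)
    then show ?thesis using that by (simp add: BijGroup_def)
  qed
  define b where "b = (\<lambda>C. \<phi> (inv\<^bsub>K\<^esub> (SOME g. g \<in> C)) \<delta>)"
  have b: "b (H #>\<^bsub>K\<^esub> g) = \<phi> (inv\<^bsub>K\<^esub> g) \<delta>" if g: "g \<in> carrier K" for g
  proof -
    have "(SOME k. k \<in> H #>\<^bsub>K\<^esub> g) \<in> H #>\<^bsub>K\<^esub> g"
      using rcos_self[OF g HK] by (rule someI[where P = "\<lambda>k. k \<in> H #>\<^bsub>K\<^esub> g"])
    then obtain h where h: "h \<in> H" "(SOME k. k \<in> H #>\<^bsub>K\<^esub> g) = h \<otimes>\<^bsub>K\<^esub> g"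
      unfolding r_coset_def by blast
    have hK: "h \<in> carrier K" using h(1) by simp
    have "inv\<^bsub>K\<^esub> h \<in> H" using h(1) by simp
    then have "\<phi> (inv\<^bsub>K\<^esub> h) \<delta> = \<delta>" unfolding H by blast
    then have "\<phi> (inv\<^bsub>K\<^esub> (h \<otimes>\<^bsub>K\<^esub> g)) \<delta> = \<phi> (inv\<^bsub>K\<^esub> g) \<delta>"
      using hK g \<delta> by (simp add: inv_mult_group \<phi>_mult)
    then show ?thesis unfolding b_def h(2) .
  qed
  have inj: "H #>\<^bsub>K\<^esub> g = H #>\<^bsub>K\<^esub> k" if g: "g \<in> carrier K" and k: "k \<in> carrier K"
    and eq: "\<phi> (inv\<^bsub>K\<^esub> g) \<delta> = \<phi> (inv\<^bsub>K\<^esub> k) \<delta>" for g k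
  proof -
    have "\<phi> (g \<otimes>\<^bsub>K\<^esub> inv\<^bsub>K\<^esub> k) \<delta> = \<phi> g (\<phi> (inv\<^bsub>K\<^esub> g) \<delta>)"
      using g k \<delta> by (simp add: \<phi>_mult eq)
    also have "\<dots> = \<phi> (g \<otimes>\<^bsub>K\<^esub> inv\<^bsub>K\<^esub> g) \<delta>"
      using g \<delta> by (intro \<phi>_mult[symmetric]) auto
    also have "\<dots> = \<delta>" using g \<delta> by (simp add: \<phi>_one)
    finally have "g \<otimes>\<^bsub>K\<^esub> inv\<^bsub>K\<^esub> k \<in> H" unfolding H using g k by simp
    then have "H #>\<^bsub>K\<^esub> (g \<otimes>\<^bsub>K\<^esub> inv\<^bsub>K\<^esub> k) = H"
      using g k HK by (intro coset_join2) auto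
    then show ?thesis using g k H.subset by (rule coset_mult_inv1)
  qed
  have bij: "bij_betw b ?R \<Delta>"
  proof -
    have rep: "\<exists>g\<in>carrier K. C = H #>\<^bsub>K\<^esub> g" if "C \<in> ?R" for C
      using that by (simp add: RCOSETS_def)
    have "inj_on b ?R"
    proof (rule inj_onI)
      fix C D assume CD: "C \<in> ?R" "D \<in> ?R" and eq: "b C = b D"
      obtain g where g: "g \<in> carrier K" "C = H #>\<^bsub>K\<^esub> g" using rep[OF CD(1)] by blast
      obtain k where k: "k \<in> carrier K" "D = H #>\<^bsub>K\<^esub> k" using rep[OF CD(2)] by blast
      have "\<phi> (inv\<^bsub>K\<^esub> g) \<delta> = \<phi> (inv\<^bsub>K\<^esub> k) \<delta>"
        using eq unfolding g(2) k(2) b[OF g(1)] b[OF k(1)] .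
      then show "C = D" unfolding g(2) k(2) by (rule inj[OF g(1) k(1)])
    qed
    moreover have "b ` ?R \<subseteq> \<Delta>"
    proof
      fix y assume "y \<in> b ` ?R"
      then obtain C where C: "C \<in> ?R" "y = b C" by blast
      obtain g where g: "g \<in> carrier K" "C = H #>\<^bsub>K\<^esub> g" using rep[OF C(1)] by blast
      show "y \<in> \<Delta>" unfolding C(2) g(2) b[OF g(1)] using g(1) \<delta> by (simp add: \<phi>_mem)
    qed
    moreover have "y \<in> b ` ?R" if "y \<in> \<Delta>" for y
    proof -
      obtain g where g: "g \<in> carrier K" "\<phi> g \<delta> = y" using trans \<open>y \<in> \<Delta>\<close> by blast
      then have "b (H #>\<^bsub>K\<^esub> inv\<^bsub>K\<^esub> g) = y" using b[of "inv\<^bsub>K\<^esub> g"] by simp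
      moreover have "H #>\<^bsub>K\<^esub> inv\<^bsub>K\<^esub> g \<in> ?R"
        using g(1) H.subset by (intro rcosetsI) auto
      ultimately show ?thesis by blast
    qed
    ultimately show ?thesis by (auto simp: bij_betw_def)
  qed
  \<comment> \<open>Right multiplication by \<open>g\<close> corresponds to the inverse of
    \<open>g\<close> under \<open>\<phi>\<close>, so the two permutation groups agree as sets
    although the elements are matched through inversion.\<close>
  have conj: "conj_map ?R \<Delta> b (?t g) = \<phi> (inv\<^bsub>K\<^esub> g)" if g: "g \<in> carrier K" for g
  proof (rule extensional_eqI)
    fix y assume "y \<in> \<Delta>"
    then obtain C where C: "C \<in> ?R" "y = b C" using bij by (auto simp: bij_betw_def)
    then obtain k where k: "k \<in> carrier K" "C = H #>\<^bsub>K\<^esub> k" unfolding RCOSETS_def by blast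
    have "conj_map ?R \<Delta> b (?t g) y = b (C #>\<^bsub>K\<^esub> g)"
      unfolding C(2) using conj_map_apply[OF bij C(1), of "?t g"] C(1) by simp
    also have "C #>\<^bsub>K\<^esub> g = H #>\<^bsub>K\<^esub> (k \<otimes>\<^bsub>K\<^esub> g)" using k g H.subset by (simp add: coset_mult_assoc)
    also have "b \<dots> = \<phi> (inv\<^bsub>K\<^esub> g) (\<phi> (inv\<^bsub>K\<^esub> k) \<delta>)"
      using k(1) g \<delta> by (simp add: b inv_mult_group \<phi>_mult)
    also have "\<phi> (inv\<^bsub>K\<^esub> k) \<delta> = y" unfolding C(2) k(2) using k(1) by (simp add: b)
    finally show "conj_map ?R \<Delta> b (?t g) y = \<phi> (inv\<^bsub>K\<^esub> g) y" .
  qed (use \<phi>_Bij[of "inv\<^bsub>K\<^esub> g"] g in \<open>auto simp: conj_map_def Bij_def\<close>)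
  have "conj_map ?R \<Delta> b ` (?t ` carrier K) = \<phi> ` m_inv K ` carrier K"
    using conj by (simp add: image_image)
  also have "\<dots> = \<phi> ` carrier K" by (simp only: inv_image_carrier)
  finally have "\<phi> ` carrier K = conj_map ?R \<Delta> b ` (?t ` carrier K)" by simp
  moreover have "?t ` carrier K \<subseteq> Bij ?R"
  proof -
    have "subgroup (?t ` carrier K) (BijGroup ?R)"
      using coset_perm_group_transitive[OF K HK]
      by (simp add: transitive_perm_group_def coset_perm_group_def)
    then have "?t ` carrier K \<subseteq> carrier (BijGroup ?R)" by (rule subgroup.subset)
    then show ?thesis by (simp add: BijGroup_def)
  qed
  ultimately show ?thesis
    unfolding coset_perm_group_def using bij by (intro perm_isomorphic_conj)
qed

section \<open>A coordinate model of the three local groups\<close>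

text \<open>\<open>({..<3} \<times> UNIV, local_group rv tw)\<close> is a coordinate model of the three groups: the point \<open>(k, True)\<close>
  stands for the 2-subset \<open>{k + 1, 4}\<close> of \<open>{1, 2, 3, 4}\<close> and \<open>(k, False)\<close> for its complement.\<close>

text \<open>\<open>rv\<close> says whether odd permutations of the three blocks are allowed, and \<open>tw\<close> whether these swap
  an odd number of pairs.\<close>

definition turn :: "nat \<Rightarrow> bool \<Rightarrow> nat \<Rightarrow> nat" where
  "turn c \<sigma> k = (c + (if \<sigma> then 2 * k else k)) mod 3"

definition local_perm :: "nat \<Rightarrow> bool \<Rightarrow> (nat \<Rightarrow> bool) \<Rightarrow> nat \<times> bool \<Rightarrow> nat \<times> bool" where
  "local_perm c \<sigma> p = (\<lambda>(k, i)\<in>{..<3} \<times> UNIV. (turn c \<sigma> k, i \<noteq> p k))"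

definition local_group :: "bool \<Rightarrow> bool \<Rightarrow> (nat \<times> bool \<Rightarrow> nat \<times> bool) set" where
  "local_group rv tw = {local_perm c \<sigma> p |c \<sigma> p.
     c < 3 \<and> (\<sigma> \<longrightarrow> rv) \<and> ((p 0 \<noteq> (p 1 \<noteq> p 2)) = (tw \<and> \<sigma>))}"

definition pair_of :: "nat \<times> bool \<Rightarrow> nat set" where
  "pair_of = (\<lambda>(k, i). if i then {k + 1, 4} else {1, 2, 3} - {k + 1})"

text \<open>With \<open>tw\<close>, odd permutations are followed by complementation. This is a
  second action of Sym(4) on the 2-subsets, in which the stabiliser of a point is cyclic of order
  4.\<close>

definition twisted_image :: "bool \<Rightarrow> (nat \<Rightarrow> nat) \<Rightarrow> nat set \<Rightarrow> nat set" where
  "twisted_image tw g A = (if tw \<and> \<not> evenperm g then {1..4} - g ` A else g ` A)"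

text \<open>The Klein four-group, indexed by the image of 4: \<open>klein j\<close> exchanges
  \<open>j\<close> and 4, and \<open>klein 4\<close> is the identity.\<close>

definition klein :: "nat \<Rightarrow> nat \<Rightarrow> nat" where
  "klein j = (if j = 1 then transpose 1 4 \<circ> transpose 2 3
     else if j = 2 then transpose 2 4 \<circ> transpose 1 3
     else if j = 3 then transpose 3 4 \<circ> transpose 1 2 else id)"

text \<open>The stabiliser of 4 in Sym(4), parametrised so that \<open>sym3 c \<sigma>\<close> acts
  on 1, 2, 3 as \<open>turn c \<sigma>\<close> acts on 0, 1, 2.\<close>

definition sym3 :: "nat \<Rightarrow> bool \<Rightarrow> nat \<Rightarrow> nat" where
  "sym3 c \<sigma> = (if c = 0 then id else if c = 1 then transpose 1 2 \<circ> transpose 2 3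
     else transpose 1 3 \<circ> transpose 2 3) \<circ> (if \<sigma> then transpose 2 3 else id)"

section \<open>Sym(4) as the product of the Klein four-group and Sym(3)\<close>

lemma less3: "k < 3 \<longleftrightarrow> k = 0 \<or> k = 1 \<or> k = (2::nat)" by auto

lemma in_1_4: "k \<in> {1..4} \<longleftrightarrow> k = 1 \<or> k = 2 \<or> k = 3 \<or> k = (4::nat)" by auto

lemma set_1_4: "{1..4} = {1, 2, 3, 4::nat}" by auto

lemma klein_permutes: "klein j permutes {1..4}"
  by (auto simp: klein_def intro!: permutes_compose permutes_swap_id permutes_id)

lemma sym3_permutes: "sym3 c \<sigma> permutes {1..4}"
  by (auto simp: sym3_def intro!: permutes_compose permutes_swap_id permutes_id)

lemma permutation_klein: "permutation (klein j)"
  using klein_permutes permutation_permutes by (metis finite_atLeastAtMost)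

lemma permutation_sym3: "permutation (sym3 c \<sigma>)"
  using sym3_permutes permutation_permutes by (metis finite_atLeastAtMost)

lemma evenperm_klein: "evenperm (klein j)"
  by (auto simp: klein_def evenperm_comp permutation_swap_id evenperm_swap)

lemma evenperm_sym3: "evenperm (sym3 c \<sigma>) \<longleftrightarrow> \<not> \<sigma>"
  by (auto simp: sym3_def evenperm_comp permutation_swap_id evenperm_swap permutation_compose)

lemma evenperm_klein_sym3: "evenperm (klein j \<circ> sym3 c \<sigma>) \<longleftrightarrow> \<not> \<sigma>"
  by (simp add: evenperm_comp permutation_klein permutation_sym3 evenperm_klein evenperm_sym3)

lemma klein_sym3_permutes: "klein j \<circ> sym3 c \<sigma> permutes {1..4}"
  using sym3_permutes klein_permutes by (rule permutes_compose)

text \<open>With \<open>j = g 4\<close>, the involution \<open>klein j\<close> brings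
  \<open>g 4\<close> back to 4. The remaining factor \<open>q\<close> fixes 4 and is one of the six
  permutations of 1, 2, 3.\<close>

lemma sym4_eq_klein_sym3:
  assumes g: "g permutes {1..4}"
  obtains j c \<sigma> where "j \<in> {1..4}" "c < 3" "g = klein j \<circ> sym3 c \<sigma>"
proof -
  define j where "j = g 4"
  have j: "j \<in> {1..4}" unfolding j_def permutes_in_image[OF g] by simp
  define q where "q = klein j \<circ> g"
  have kk: "klein j \<circ> klein j = id"
    by (rule ext) (auto simp: klein_def transpose_def)
  have gq: "g = klein j \<circ> q" unfolding q_def using kk by (metis comp_assoc id_comp)
  have q: "q permutes {1..4}"
    unfolding q_def using g klein_permutes by (rule permutes_compose)
  have q4: "q 4 = 4" using j by (auto simp: q_def j_def[symmetric] klein_def in_1_4 transpose_def)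
  have inj: "q x = q y \<longleftrightarrow> x = y" for x y
    using permutes_inj[OF q] by (auto simp: inj_def)
  have q_in: "q x \<in> {1, 2, 3}" if "x \<in> {1, 2, 3}" for x
    using inj[of x 4] permutes_in_image[OF q, of x] q4 that unfolding in_1_4 by auto
  have q123: "q 1 \<in> {1, 2, 3}" "q 2 \<in> {1, 2, 3}" "q 3 \<in> {1, 2, 3}"
    by (intro q_in; simp)+
  have out: "q x = x" if "x \<notin> {1..4}" for x
    using q that by (simp add: permutes_not_in)
  have eqI: "q = sym3 c \<sigma>" if "q 1 = sym3 c \<sigma> 1" "q 2 = sym3 c \<sigma> 2" "q 3 = sym3 c \<sigma> 3" for c \<sigma>
  proof
    fix x
    have "sym3 c \<sigma> 4 = 4" by (auto simp: sym3_def transpose_def)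
    show "q x = sym3 c \<sigma> x"
    proof (cases "x \<in> {1..4}")
      case True
      then show ?thesis
        using that q4 \<open>sym3 c \<sigma> 4 = 4\<close> unfolding in_1_4 by (elim disjE) simp_all
    next
      case False
      then show ?thesis using out[of x] permutes_not_in[OF sym3_permutes, of x c \<sigma>] by simp
    qed
  qed
  have "\<exists>c<3. \<exists>\<sigma>. q = sym3 c \<sigma>"
  proof -
    have "q 1 \<noteq> q 2" "q 1 \<noteq> q 3" "q 2 \<noteq> q 3" using inj by simp_all
    then consider "q 1 = 1" "q 2 = 2" "q 3 = 3" | "q 1 = 1" "q 2 = 3" "q 3 = 2"
      | "q 1 = 2" "q 2 = 1" "q 3 = 3" | "q 1 = 2" "q 2 = 3" "q 3 = 1"
      | "q 1 = 3" "q 2 = 1" "q 3 = 2" | "q 1 = 3" "q 2 = 2" "q 3 = 1"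
      using q123 by auto
    then show ?thesis
    proof cases
      case 1 then show ?thesis
        by (intro exI[of _ 0] conjI exI[of _ False] eqI) (simp_all add: sym3_def transpose_def)
    next
      case 2 then show ?thesis
        by (intro exI[of _ 0] conjI exI[of _ True] eqI) (simp_all add: sym3_def transpose_def)
    next
      case 3 then show ?thesis
        by (intro exI[of _ 1] conjI exI[of _ True] eqI) (simp_all add: sym3_def transpose_def)
    next
      case 4 then show ?thesis
        by (intro exI[of _ 1] conjI exI[of _ False] eqI) (simp_all add: sym3_def transpose_def)
    next
      case 5 then show ?thesis
        by (intro exI[of _ 2] conjI exI[of _ False] eqI) (simp_all add: sym3_def transpose_def)
    next
      case 6 then show ?thesis
        by (intro exI[of _ 2] conjI exI[of _ True] eqI) (simp_all add: sym3_def transpose_def)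
    qed
  qed
  then show ?thesis using that j gq by blast
qed

section \<open>The action on 2-subsets in coordinates\<close>

lemma turn_less [simp]: "turn c \<sigma> k < 3"
  by (simp add: turn_def)

lemma pair_of_simps:
  "pair_of (0, True) = {1, 4}" "pair_of (0, False) = {2, 3}"
  "pair_of (1, True) = {2, 4}" "pair_of (1, False) = {1, 3}"
  "pair_of (2, True) = {3, 4}" "pair_of (2, False) = {1, 2}"
  by (auto simp: pair_of_def)

lemma sym3_4: "sym3 c \<sigma> 4 = 4"
  by (simp add: sym3_def transpose_def)

lemma sym3_add1:
  assumes "c < 3" "k < 3" shows "sym3 c \<sigma> (k + 1) = turn c \<sigma> k + 1"
  using assms unfolding less3
  by (cases \<sigma>; elim disjE) (simp_all add: sym3_def turn_def transpose_def)

lemma sym3_image_pair_of: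
  assumes "c < 3" "k < 3"
  shows "sym3 c \<sigma> ` pair_of (k, i) = pair_of (turn c \<sigma> k, i)"
proof (cases i)
  case True
  then show ?thesis unfolding pair_of_def by (simp add: sym3_4 sym3_add1[OF assms, simplified])
next
  case False
  have "{1, 2, 3} = {1..4} - {4::nat}" by auto
  moreover have "sym3 c \<sigma> ` ({1..4} - {4}) = {1..4} - {4}"
    unfolding image_set_diff[OF permutes_inj[OF sym3_permutes]] permutes_image[OF sym3_permutes]
    by (simp add: sym3_4)
  ultimately have "sym3 c \<sigma> ` {1, 2, 3} = {1, 2, 3}" by metis
  then have "sym3 c \<sigma> ` ({1, 2, 3} - {k + 1}) = {1, 2, 3} - {turn c \<sigma> k + 1}"
    unfolding image_set_diff[OF permutes_inj[OF sym3_permutes]]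
    by (simp add: sym3_add1[OF assms, simplified])
  then show ?thesis using False by (simp add: pair_of_def)
qed

lemma klein_simps:
  "klein 1 1 = 4" "klein 1 2 = 3" "klein 1 3 = 2" "klein 1 4 = 1"
  "klein 2 1 = 3" "klein 2 2 = 4" "klein 2 3 = 1" "klein 2 4 = 2"
  "klein 3 1 = 2" "klein 3 2 = 1" "klein 3 3 = 4" "klein 3 4 = 3"
  "klein 4 1 = 1" "klein 4 2 = 2" "klein 4 3 = 3" "klein 4 4 = 4"
  by (simp_all add: klein_def transpose_def)

text \<open>A double transposition preserves each splitting of the four points into two 2-subsets,
  and exchanges the two halves unless one of them is \<open>{j, 4}\<close>.\<close>

lemma klein_image_pair_of:
  assumes "j \<in> {1..4}" "k < 3"
  shows "klein j ` pair_of (k, i) = pair_of (k, i \<noteq> (j \<noteq> 4 \<and> j \<noteq> k + 1))"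
  using assms unfolding less3 in_1_4
  by (cases i; elim disjE)
    (simp_all add: klein_simps klein_simps[simplified] insert_commute pair_of_simps pair_of_simps[simplified])

lemma pair_of_klein_sym3:
  assumes "j \<in> {1..4}" "c < 3" "k < 3"
  shows "(klein j \<circ> sym3 c \<sigma>) ` pair_of (k, i)
    = pair_of (turn c \<sigma> k, i \<noteq> (j \<noteq> 4 \<and> j \<noteq> turn c \<sigma> k + 1))"
  unfolding image_comp[symmetric] sym3_image_pair_of[OF assms(2,3)]
  using assms(1) by (intro klein_image_pair_of) simp_all

lemma compl_pair_of: "k < 3 \<Longrightarrow> {1..4} - pair_of (k, i) = pair_of (k, \<not> i)"
  unfolding less3 set_1_4 by (cases i) (auto simp: pair_of_def)

text \<open>Three effects combine: the \<open>sym3\<close> factor moves the blocks, a nontrivial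
  Klein factor swaps all blocks but one, and the twist swaps all three.\<close>

lemma twisted_image_klein_sym3:
  assumes "j \<in> {1..4}" "c < 3" "k < 3"
  shows "twisted_image tw (klein j \<circ> sym3 c \<sigma>) (pair_of (k, i))
    = pair_of (turn c \<sigma> k, i \<noteq> ((j \<noteq> 4 \<and> j \<noteq> turn c \<sigma> k + 1) \<noteq> (tw \<and> \<sigma>)))"
proof -
  let ?B = "j \<noteq> 4 \<and> j \<noteq> turn c \<sigma> k + 1"
  have compl: "(if tw \<and> \<sigma> then {1..4} - pair_of (turn c \<sigma> k, b) else pair_of (turn c \<sigma> k, b))
      = pair_of (turn c \<sigma> k, b \<noteq> (tw \<and> \<sigma>))" for b
    by (cases b; cases tw; cases \<sigma>) (simp_all only: compl_pair_of[OF turn_less] if_True if_False simp_thms)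
  have "twisted_image tw (klein j \<circ> sym3 c \<sigma>) (pair_of (k, i))
      = (if tw \<and> \<sigma> then {1..4} - pair_of (turn c \<sigma> k, i \<noteq> ?B) else pair_of (turn c \<sigma> k, i \<noteq> ?B))"
    by (simp only: twisted_image_def evenperm_klein_sym3 pair_of_klein_sym3[OF assms] not_not)
  also have "\<dots> = pair_of (turn c \<sigma> k, (i \<noteq> ?B) \<noteq> (tw \<and> \<sigma>))"
    by (rule compl)
  also have "((i \<noteq> ?B) \<noteq> (tw \<and> \<sigma>)) = (i \<noteq> (?B \<noteq> (tw \<and> \<sigma>)))" by blast
  finally show ?thesis .
qed

lemma mem_pair_of:
  assumes "k < 3" "x \<in> {1..4}"
  shows "x \<in> pair_of (k, i) \<longleftrightarrow> (x = k + 1 \<or> x = 4) = i"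
  using assms by (cases i) (auto simp: pair_of_def)

lemma inj_on_pair_of: "inj_on pair_of ({..<3} \<times> UNIV)"
proof (rule inj_onI, clarify)
  fix k l :: nat and i j assume kl: "k < 3" "l < 3" and eq: "pair_of (k, i) = pair_of (l, j)"
  have "i = j" using mem_pair_of[of k 4 i] mem_pair_of[of l 4 j] kl eq by simp
  moreover have "k = l"
    using mem_pair_of[of k "k + 1" i] mem_pair_of[of l "k + 1" j] kl eq \<open>i = j\<close> by auto
  ultimately show "k = l \<and> i = j" by simp
qed

lemma turn_inj: "k < 3 \<Longrightarrow> l < 3 \<Longrightarrow> turn c \<sigma> k = turn c \<sigma> l \<Longrightarrow> k = l"
  unfolding turn_def by (cases \<sigma>; simp; presburger)

lemma local_groupI:
  assumes "c < 3" "\<sigma> \<longrightarrow> rv" "(p 0 \<noteq> (p 1 \<noteq> p 2)) = (tw \<and> \<sigma>)"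
  shows "local_perm c \<sigma> p \<in> local_group rv tw"
  unfolding local_group_def mem_Collect_eq
  by (intro exI[of _ c] exI[of _ \<sigma>] exI[of _ p] conjI refl assms)

lemma turn_surj:
  assumes "l < 3" shows "\<exists>k<3. turn c \<sigma> k = l"
proof -
  have "turn c \<sigma> ` {..<3} = {..<3}"
    by (rule endo_inj_surj) (auto intro: inj_onI turn_inj)
  then show ?thesis using assms by (metis imageE lessThan_iff)
qed

lemma local_perm_Bij: "local_perm c \<sigma> p \<in> Bij ({..<3} \<times> UNIV)"
proof -
  have "inj_on (local_perm c \<sigma> p) ({..<3} \<times> UNIV)"
    by (rule inj_onI) (auto simp: local_perm_def dest: turn_inj)
  moreover have "local_perm c \<sigma> p ` ({..<3} \<times> UNIV) \<subseteq> {..<3} \<times> UNIV"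
    by (auto simp: local_perm_def)
  moreover have "finite ({..<3::nat} \<times> (UNIV :: bool set))" by simp
  ultimately have "bij_betw (local_perm c \<sigma> p) ({..<3} \<times> UNIV) ({..<3} \<times> UNIV)"
    unfolding bij_betw_def using endo_inj_surj by blast
  then show ?thesis by (simp add: Bij_def local_perm_def)
qed

definition pair_action :: "bool \<Rightarrow> (nat \<Rightarrow> nat) \<Rightarrow> nat \<times> bool \<Rightarrow> nat \<times> bool" where
  "pair_action tw g = (\<lambda>x\<in>{..<3} \<times> UNIV. inv_into ({..<3} \<times> UNIV) pair_of (twisted_image tw g (pair_of x)))"

lemma pair_action_klein_sym3:
  assumes "j \<in> {1..4}" "c < 3"
  shows "pair_action tw (klein j \<circ> sym3 c \<sigma>)
    = local_perm c \<sigma> (\<lambda>k. (j \<noteq> 4 \<and> j \<noteq> turn c \<sigma> k + 1) \<noteq> (tw \<and> \<sigma>))"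
proof (rule extensional_eqI[of _ "{..<3} \<times> UNIV"])
  fix x :: "nat \<times> bool" assume "x \<in> {..<3} \<times> UNIV"
  then obtain k i where x: "x = (k, i)" "k < 3" by auto
  let ?y = "(turn c \<sigma> k, i \<noteq> ((j \<noteq> 4 \<and> j \<noteq> turn c \<sigma> k + 1) \<noteq> (tw \<and> \<sigma>)))"
  have y: "?y \<in> {..<3} \<times> UNIV" by simp
  have "pair_action tw (klein j \<circ> sym3 c \<sigma>) x = inv_into ({..<3} \<times> UNIV) pair_of
      (twisted_image tw (klein j \<circ> sym3 c \<sigma>) (pair_of (k, i)))"
    using x by (simp add: pair_action_def)
  also have "\<dots> = inv_into ({..<3} \<times> UNIV) pair_of (pair_of ?y)"
    unfolding twisted_image_klein_sym3[OF assms x(2)] ..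
  also have "\<dots> = ?y" using inj_on_pair_of y by (rule inv_into_f_f)
  finally show "pair_action tw (klein j \<circ> sym3 c \<sigma>) x
      = local_perm c \<sigma> (\<lambda>k. (j \<noteq> 4 \<and> j \<noteq> turn c \<sigma> k + 1) \<noteq> (tw \<and> \<sigma>)) x"
    using x(2) by (simp add: x(1) local_perm_def)
qed (simp_all add: pair_action_def local_perm_def)

lemma pair_action_Bij:
  assumes "g permutes {1..4}" shows "pair_action tw g \<in> Bij ({..<3} \<times> UNIV)"
proof -
  obtain j c \<sigma> where "j \<in> {1..4}" "c < 3" "g = klein j \<circ> sym3 c \<sigma>"
    using sym4_eq_klein_sym3[OF assms] .
  then show ?thesis by (simp only: pair_action_klein_sym3 local_perm_Bij)
qed

lemma pair_of_pair_action:
  assumes "g permutes {1..4}" "x \<in> {..<3} \<times> UNIV"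
  shows "pair_of (pair_action tw g x) = twisted_image tw g (pair_of x)"
proof -
  obtain j c \<sigma> where g: "j \<in> {1..4}" "c < 3" "g = klein j \<circ> sym3 c \<sigma>"
    using sym4_eq_klein_sym3[OF assms(1)] .
  obtain k i where x: "x = (k, i)" "k < 3" using assms(2) by auto
  have "twisted_image tw g (pair_of x) \<in> pair_of ` ({..<3} \<times> UNIV)"
    unfolding x(1) g(3) twisted_image_klein_sym3[OF g(1,2) x(2)] by (intro imageI) simp
  then show ?thesis
    using assms(2) by (simp add: pair_action_def f_inv_into_f)
qed

lemma pair_of_subset: "x \<in> {..<3} \<times> UNIV \<Longrightarrow> pair_of x \<subseteq> {1..4}"
  by (auto simp: pair_of_def split: if_splits)

text \<open>Complementation is an involution commuting with every permutation, and the sign is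
  multiplicative.\<close>

lemma twisted_image_comp:
  assumes "g permutes {1..4}" "h permutes {1..4}" "A \<subseteq> {1..4}"
  shows "twisted_image tw (g \<circ> h) A = twisted_image tw g (twisted_image tw h A)"
proof -
  have perm: "permutation g" "permutation h"
    using assms(1,2) permutation_permutes by (metis finite_atLeastAtMost)+
  have "h ` A \<subseteq> {1..4}" using assms(2,3) permutes_image by blast
  moreover have "g ` ({1..4} - B) = {1..4} - g ` B" for B
    using permutes_inj[OF assms(1)] permutes_image[OF assms(1)] by (metis image_set_diff)
  moreover have "{1..4} - ({1..4} - g ` h ` A) = g ` h ` A"
    using assms(1) permutes_image[OF assms(1)] calculation(1) by blast
  ultimately show ?thesis
    by (cases tw; cases "evenperm g"; cases "evenperm h")
      (simp_all only: twisted_image_def evenperm_comp[OF perm] image_comp[symmetric] simp_thms if_True if_False)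
qed

lemma pair_action_comp:
  assumes "g permutes {1..4}" "h permutes {1..4}"
  shows "pair_action tw (g \<circ> h) = compose ({..<3} \<times> UNIV) (pair_action tw g) (pair_action tw h)"
proof (rule extensional_eqI[of _ "{..<3} \<times> UNIV"])
  fix x :: "nat \<times> bool" assume x: "x \<in> {..<3} \<times> UNIV"
  have hx: "pair_action tw h x \<in> {..<3} \<times> UNIV"
    using pair_action_Bij[OF assms(2)] x by (metis Bij_imp_funcset funcset_mem)
  have "pair_action tw (g \<circ> h) x \<in> {..<3} \<times> UNIV"
    using pair_action_Bij[OF permutes_compose[OF assms(2,1)]] x by (metis Bij_imp_funcset funcset_mem)
  moreover have "pair_action tw g (pair_action tw h x) \<in> {..<3} \<times> UNIV"
    using pair_action_Bij[OF assms(1)] hx by (metis Bij_imp_funcset funcset_mem)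
  moreover have "pair_of (pair_action tw (g \<circ> h) x) = pair_of (pair_action tw g (pair_action tw h x))"
    using assms x hx
    by (simp only: pair_of_pair_action permutes_compose twisted_image_comp pair_of_subset)
  ultimately have "pair_action tw (g \<circ> h) x = pair_action tw g (pair_action tw h x)"
    using inj_on_pair_of by (meson inj_onD)
  then show "pair_action tw (g \<circ> h) x = compose ({..<3} \<times> UNIV) (pair_action tw g) (pair_action tw h) x"
    using x by (simp add: compose_def)
qed (simp_all add: pair_action_def compose_def)

text \<open>Identifies the coordinate model with Alt(4) or Sym(4) acting on 2-subsets, twisted or
  not. The parity condition of \<open>local_group\<close> is the only restriction on the
  swaps.\<close>

lemma pair_action_image:
  "pair_action tw ` {g. g permutes {1..4} \<and> (evenperm g \<or> rv)} = local_group rv tw"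
proof (intro equalityI subsetI)
  fix f assume "f \<in> pair_action tw ` {g. g permutes {1..4} \<and> (evenperm g \<or> rv)}"
  then obtain g where g: "g permutes {1..4}" "evenperm g \<or> rv" "f = pair_action tw g" by blast
  obtain j c \<sigma> where jc: "j \<in> {1..4}" "c < 3" "g = klein j \<circ> sym3 c \<sigma>"
    using sym4_eq_klein_sym3[OF g(1)] .
  let ?p = "\<lambda>k. (j \<noteq> 4 \<and> j \<noteq> turn c \<sigma> k + 1) \<noteq> (tw \<and> \<sigma>)"
  have f: "f = local_perm c \<sigma> ?p" unfolding g(3) jc(3) using jc(1,2) by (rule pair_action_klein_sym3)
  have rv: "\<sigma> \<longrightarrow> rv" using g(2) unfolding jc(3) evenperm_klein_sym3 by blast
  \<comment> \<open>The Klein factor swaps either no block or all but one, always an even number.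
    Adding the bit \<open>tw \<and> \<sigma>\<close> in all three places changes the parity by that
    bit, as three is odd.\<close>
  define B where "B = (\<lambda>k. j \<noteq> 4 \<and> j \<noteq> turn c \<sigma> k + 1)"
  have B: "\<not> (B 0 \<noteq> (B 1 \<noteq> B 2))"
  proof (cases "j = 4")
    case True
    then show ?thesis by (simp add: B_def)
  next
    case False
    then have "j - 1 < 3" using jc(1) by auto
    then obtain l where l: "l < 3" "turn c \<sigma> l = j - 1" using turn_surj by blast
    have "B k \<longleftrightarrow> k \<noteq> l" if "k < 3" for k
      using False jc(1) l turn_inj[OF that l(1), of c \<sigma>] by (auto simp: B_def)
    then have "B 0 \<longleftrightarrow> 0 \<noteq> l" "B 1 \<longleftrightarrow> 1 \<noteq> l" "B 2 \<longleftrightarrow> 2 \<noteq> l" by simp_all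
    then show ?thesis using l(1) unfolding less3 by auto
  qed
  then have "((B 0 \<noteq> (tw \<and> \<sigma>)) \<noteq> ((B 1 \<noteq> (tw \<and> \<sigma>)) \<noteq> (B 2 \<noteq> (tw \<and> \<sigma>)))) = (tw \<and> \<sigma>)"
    by argo
  then have "(?p 0 \<noteq> (?p 1 \<noteq> ?p 2)) = (tw \<and> \<sigma>)" unfolding B_def .
  then show "f \<in> local_group rv tw"
    unfolding f using jc(2) rv by (rule local_groupI[rotated 2])
next
  fix f assume "f \<in> local_group rv tw"
  then obtain c \<sigma> p where f: "f = local_perm c \<sigma> p" "c < 3" "\<sigma> \<longrightarrow> rv"
    and p: "(p 0 \<noteq> (p 1 \<noteq> p 2)) = (tw \<and> \<sigma>)"
    unfolding local_group_def by blast
  define t where "t = (tw \<and> \<sigma>)"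
  \<comment> \<open>By the parity condition an even number of the values of \<open>p\<close> differ
    from \<open>t\<close>. Unless there are none, exactly one value equals \<open>t\<close>, and
    \<open>l\<close> is its position; the Klein element is the one that leaves the image of block
    \<open>l\<close> alone.\<close>
  define l :: nat where "l = (if p 0 = t then 0 else if p 1 = t then 1 else 2)"
  define j where "j = (if p 0 = t \<and> p 1 = t \<and> p 2 = t then 4 else turn c \<sigma> l + 1)"
  have l: "l < 3" by (simp add: l_def)
  have tl: "turn c \<sigma> l < 3" by (rule turn_less)
  have j: "j \<in> {1..4}" unfolding j_def using less_imp_le[OF tl] by simp
  have "p k = ((j \<noteq> 4 \<and> j \<noteq> turn c \<sigma> k + 1) \<noteq> t)" if k: "k < 3" for k
  proof (cases "p 0 = t \<and> p 1 = t \<and> p 2 = t")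
    case True
    then show ?thesis using k unfolding less3 j_def by auto
  next
    case False
    have "turn c \<sigma> l = turn c \<sigma> k \<longleftrightarrow> l = k" using turn_inj[OF l k, of c \<sigma>] by blast
    moreover have "j = turn c \<sigma> l + 1" unfolding j_def using False by (simp only: if_False)
    moreover have "turn c \<sigma> l + 1 \<noteq> 4" using tl by linarith
    ultimately have "(j \<noteq> 4 \<and> j \<noteq> turn c \<sigma> k + 1) = (l \<noteq> k)" by simp
    moreover have "p k = ((l \<noteq> k) \<noteq> t)"
      using k False p unfolding t_def[symmetric] less3 l_def by (elim disjE) (simp_all, argo+)
    ultimately show ?thesis by blast
  qed
  then have "f = local_perm c \<sigma> (\<lambda>k. (j \<noteq> 4 \<and> j \<noteq> turn c \<sigma> k + 1) \<noteq> (tw \<and> \<sigma>))"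
    unfolding f(1) t_def by (auto simp: local_perm_def intro!: restrict_ext)
  also have "\<dots> = pair_action tw (klein j \<circ> sym3 c \<sigma>)"
    using j f(2) by (rule pair_action_klein_sym3[symmetric])
  finally have "f = pair_action tw (klein j \<circ> sym3 c \<sigma>)" .
  moreover have "klein j \<circ> sym3 c \<sigma> \<in> {g. g permutes {1..4} \<and> (evenperm g \<or> rv)}"
    using f(3) by (simp only: mem_Collect_eq klein_sym3_permutes evenperm_klein_sym3) blast
  ultimately show "f \<in> pair_action tw ` {g. g permutes {1..4} \<and> (evenperm g \<or> rv)}"
    by (rule image_eqI)
qed

text \<open>Common criterion for the three groups: the subgroup generated by \<open>S\<close> is
  shown to be the stabiliser of the point \<open>(l, False)\<close>. One inclusion is tested on the
  generators, the other is the explicit list in the assumption \<open>gen\<close>.\<close>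

lemma coset_perm_group_local_group:
  assumes K: "group K" "carrier K = {g. g permutes {1..4} \<and> (evenperm g \<or> rv)}" "monoid.mult K = (\<circ>)"
    and S: "S \<subseteq> carrier K" "\<And>g. g \<in> S \<Longrightarrow> twisted_image tw g (pair_of (l, False)) = pair_of (l, False)"
    and l: "l = 1 \<or> l = 2"
    and gen: "\<And>j c \<sigma>. j \<in> {1..4} \<Longrightarrow> c < 3 \<Longrightarrow> \<sigma> \<longrightarrow> rv \<Longrightarrow> turn c \<sigma> l = l \<Longrightarrow>
      (j \<noteq> 4 \<and> j \<noteq> l + 1) = (tw \<and> \<sigma>) \<Longrightarrow> klein j \<circ> sym3 c \<sigma> \<in> generate K S"
  shows "perm_isomorphic (coset_perm_group K (generate K S)) ({..<3} \<times> UNIV, local_group rv tw)"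
    and "transitive_perm_group (coset_perm_group K (generate K S))"
proof -
  interpret group K by fact
  let ?\<Delta> = "{..<3} \<times> UNIV :: (nat \<times> bool) set"
  have sub: "subgroup (generate K S) K" using S(1) by (rule generate_is_subgroup)
  then show "transitive_perm_group (coset_perm_group K (generate K S))"
    by (intro coset_perm_group_transitive K(1))
  have perm: "g permutes {1..4}" if "g \<in> carrier K" for g using that unfolding K(2) by blast
  have \<phi>: "pair_action tw \<in> hom K (BijGroup ?\<Delta>)"
  proof (rule homI)
    fix g h assume gh: "g \<in> carrier K" "h \<in> carrier K"
    show "pair_action tw (g \<otimes>\<^bsub>K\<^esub> h) = pair_action tw g \<otimes>\<^bsub>BijGroup ?\<Delta>\<^esub> pair_action tw h"
      unfolding K(3) pair_action_comp[OF perm[OF gh(1)] perm[OF gh(2)]]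
      using pair_action_Bij[OF perm[OF gh(1)]] pair_action_Bij[OF perm[OF gh(2)]]
      by (simp add: BijGroup_def)
  next
    fix g assume g: "g \<in> carrier K"
    show "pair_action tw g \<in> carrier (BijGroup ?\<Delta>)"
      using pair_action_Bij[OF perm[OF g]] by (simp add: BijGroup_def)
  qed
  have \<delta>: "(l, False) \<in> ?\<Delta>" using l by auto
  have trans: "\<exists>g\<in>carrier K. pair_action tw g (l, False) = y" if y_in: "y \<in> ?\<Delta>" for y
  proof -
    obtain k i where y: "y = (k, i)" "k < 3" using y_in by auto
    \<comment> \<open>A rotation carrying block \<open>l\<close> to block \<open>k\<close>; the 3
      guards against truncated subtraction. If a swap is wanted, blocks 1 and 2 are swapped together
      to keep the parity even, and \<open>l\<close> is one of them.\<close>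
    have "local_perm ((k + 3 - l) mod 3) False (\<lambda>k. i \<and> k \<noteq> 0) \<in> local_group rv tw"
      by (rule local_groupI) auto
    then obtain g where g: "g \<in> carrier K"
      "local_perm ((k + 3 - l) mod 3) False (\<lambda>k. i \<and> k \<noteq> 0) = pair_action tw g"
      unfolding pair_action_image[symmetric] K(2) by (rule imageE)
    have "turn ((k + 3 - l) mod 3) False l = k" using l y(2) unfolding less3 turn_def by auto
    then have "pair_action tw g (l, False) = y"
      using l unfolding g(2)[symmetric] y(1) by (auto simp: local_perm_def)
    then show ?thesis using g(1) by blast
  qed
  have ga: "group_action K ?\<Delta> (pair_action tw)"
    unfolding group_action_def group_hom_def group_hom_axioms_def
    using K(1) group_BijGroup \<phi> by blast
  have H: "generate K S = {g \<in> carrier K. pair_action tw g (l, False) = (l, False)}"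
  proof
    have "subgroup {g \<in> carrier K. pair_action tw g (l, False) = (l, False)} K"
      using group_action.stabilizer_subgroup[OF ga \<delta>] by (simp add: stabilizer_def)
    moreover have "pair_action tw g (l, False) = (l, False)" if g: "g \<in> S" for g
    proof -
      have gK: "g permutes {1..4}" using g S(1) perm by blast
      have eq: "pair_of (pair_action tw g (l, False)) = pair_of (l, False)"
        unfolding pair_of_pair_action[OF gK \<delta>] using g by (rule S(2))
      have mem: "pair_action tw g (l, False) \<in> ?\<Delta>"
        using Bij_imp_funcset[OF pair_action_Bij[OF gK]] \<delta> by (rule funcset_mem)
      show ?thesis using eq mem \<delta> by (rule inj_onD[OF inj_on_pair_of])
    qed
    ultimately show "generate K S \<subseteq> {g \<in> carrier K. pair_action tw g (l, False) = (l, False)}"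
      using S(1) by (intro generate_subgroup_incl) auto
  next
    show "{g \<in> carrier K. pair_action tw g (l, False) = (l, False)} \<subseteq> generate K S"
    proof
      fix g assume "g \<in> {g \<in> carrier K. pair_action tw g (l, False) = (l, False)}"
      then have g: "g permutes {1..4}" "evenperm g \<or> rv" "pair_action tw g (l, False) = (l, False)"
        unfolding K(2) by blast+
      obtain j c \<sigma> where jc: "j \<in> {1..4}" "c < 3" "g = klein j \<circ> sym3 c \<sigma>"
        using sym4_eq_klein_sym3[OF g(1)] .
      have rv: "\<sigma> \<longrightarrow> rv" using g(2) unfolding jc(3) evenperm_klein_sym3 by blast
      have "local_perm c \<sigma> (\<lambda>k. (j \<noteq> 4 \<and> j \<noteq> turn c \<sigma> k + 1) \<noteq> (tw \<and> \<sigma>)) (l, False) = (l, False)"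
        using g(3) unfolding jc(3) pair_action_klein_sym3[OF jc(1,2)] .
      then have te: "turn c \<sigma> l = l \<and> (j \<noteq> 4 \<and> j \<noteq> turn c \<sigma> l + 1) = (tw \<and> \<sigma>)"
        using \<delta> unfolding local_perm_def by (simp cong: conj_cong)
      then have t: "turn c \<sigma> l = l" by (rule conjunct1)
      have "(j \<noteq> 4 \<and> j \<noteq> l + 1) = (tw \<and> \<sigma>)" using te unfolding t by (rule conjunct2)
      then show "g \<in> generate K S" unfolding jc(3) using jc(1,2) rv t by (intro gen)
    qed
  qed
  show "perm_isomorphic (coset_perm_group K (generate K S)) (?\<Delta>, local_group rv tw)"
    using coset_perm_group_iso_action[OF K(1) \<phi> \<delta> trans H sub]
    unfolding K(2) pair_action_image .
qed

section \<open>The three point stabilisers\<close>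

lemma turn_fixes_2:
  assumes "turn c \<sigma> 2 = 2" "c < 3" shows "\<sigma> \<and> c = 1 \<or> \<not> \<sigma> \<and> c = 0"
  using assms unfolding less3 turn_def by (cases \<sigma>) auto

lemma turn_fixes_1:
  assumes "turn c \<sigma> 1 = 1" "c < 3" shows "\<sigma> \<and> c = 2 \<or> \<not> \<sigma> \<and> c = 0"
  using assms unfolding less3 turn_def by (cases \<sigma>) auto

lemma sym3_cases:
  "sym3 0 False = id" "sym3 1 True = transpose 1 2" "sym3 2 True = transpose 1 3"
  by (simp_all add: sym3_def comp_assoc)

lemma klein_cases:
  "klein 4 = id" "klein 3 = transpose 1 2 \<circ> transpose 3 4"
  "klein 2 = transpose 1 3 \<circ> transpose 2 4"
  by (auto simp: klein_def transpose_def fun_eq_iff)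

lemma permutes_4_eqI:
  fixes f g :: "nat \<Rightarrow> nat"
  assumes "f permutes {1..4}" "g permutes {1..4}"
    and "f 1 = g 1" "f 2 = g 2" "f 3 = g 3" "f 4 = g 4"
  shows "f = g"
proof
  fix x
  show "f x = g x"
  proof (cases "x \<in> {1..4}")
    case True
    then show ?thesis using assms(3-) unfolding in_1_4 by (elim disjE) simp_all
  next
    case False
    then show ?thesis using permutes_not_in[OF assms(1)] permutes_not_in[OF assms(2)] by simp
  qed
qed

lemma alt_group_is_group: "group (alt_group n)"
proof -
  have "subgroup {p. p permutes {1..n} \<and> evenperm p} (sym_group n)"
  proof (rule group.subgroupI[OF sym_group_is_group])
    show "{p. p permutes {1..n} \<and> evenperm p} \<noteq> {}"
      using permutes_id evenperm_id by blast
    fix p assume p: "p \<in> {p. p permutes {1..n} \<and> evenperm p}"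
    then have "p \<in> carrier (alt_group n)" by (simp add: alt_group_carrier)
    then have "inv' p \<in> carrier (alt_group n)" by (rule alt_group_inv_closed)
    then show "inv\<^bsub>sym_group n\<^esub> p \<in> {p. p permutes {1..n} \<and> evenperm p}"
      using p by (simp add: alt_group_carrier sym_group_carrier)
    fix q assume q: "q \<in> {p. p permutes {1..n} \<and> evenperm p}"
    have "permutation p" "permutation q"
      using p q permutation_permutes by blast+
    then show "p \<otimes>\<^bsub>sym_group n\<^esub> q \<in> {p. p permutes {1..n} \<and> evenperm p}"
      using p q by (simp add: sym_group_mult permutes_compose evenperm_comp)
  qed (auto simp: sym_group_carrier)
  then show ?thesis
    unfolding alt_group_def by (rule subgroup.subgroup_is_group[OF _ sym_group_is_group])
qed

text \<open>The given subgroup is the stabiliser of \<open>{1, 2}\<close>, the point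
  \<open>(2, False)\<close>, in Alt(4).\<close>

lemma A4_6_local_group:
  "perm_isomorphic A4_6 ({..<3} \<times> UNIV, local_group False False)"
  "transitive_perm_group A4_6"
proof -
  let ?g = "transpose 1 2 \<circ> transpose 3 (4::nat)"
  have g: "cycle_of_list [1, 2] \<circ> cycle_of_list [3, 4::nat] = ?g" by simp
  have even: "evenperm ?g" by (simp add: evenperm_comp permutation_swap_id evenperm_swap)
  have perm: "?g permutes {1..4}" by (auto intro!: permutes_compose permutes_swap_id)
  have fix2: "twisted_image False ?g (pair_of (2, False)) = pair_of (2, False)"
    by (simp add: twisted_image_def pair_of_simps transpose_def insert_commute)
  have gen: "klein j \<circ> sym3 c \<sigma> \<in> generate (alt_group 4) {?g}"
    if "j \<in> {1..4}" "c < 3" "\<sigma> \<longrightarrow> False" "turn c \<sigma> 2 = 2" "(j \<noteq> 4 \<and> j \<noteq> 2 + 1) = (False \<and> \<sigma>)" for j c \<sigma>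
  proof -
    have "c = 0" "\<not> \<sigma>" using turn_fixes_2[OF that(4,2)] that(3) by auto
    moreover have "j = 4 \<or> j = 3" using that(5) by auto
    moreover have "id \<in> generate (alt_group 4) {?g}"
      using generate.one[of "alt_group 4" "{?g}"] by (simp add: alt_group_one)
    moreover have "?g \<in> generate (alt_group 4) {?g}" by (rule generate.incl) simp
    ultimately show ?thesis by (auto simp: sym3_cases klein_cases)
  qed
  have "carrier (alt_group 4) = {g. g permutes {1..4} \<and> (evenperm g \<or> False)}"
    by (auto simp: alt_group_carrier)
  moreover have "{?g} \<subseteq> carrier (alt_group 4)"
    using even perm by (simp add: alt_group_carrier)
  ultimately show "perm_isomorphic A4_6 ({..<3} \<times> UNIV, local_group False False)"
    and "transitive_perm_group A4_6"
    unfolding A4_6_def g using coset_perm_group_local_group[OF alt_group_is_group _ alt_group_mult, of 4 False "{?g}" False 2]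
      fix2 gen by blast+
qed

text \<open>The given subgroup is the stabiliser of \<open>{1, 2}\<close> in Sym(4) for the ordinary
  action.\<close>

lemma S4_6d_local_group:
  "perm_isomorphic S4_6d ({..<3} \<times> UNIV, local_group True False)"
  "transitive_perm_group S4_6d"
proof -
  let ?s = "transpose 1 (2::nat)" let ?t = "transpose 3 (4::nat)"
  have g: "cycle_of_list [1, 2::nat] = ?s" "cycle_of_list [3, 4::nat] = ?t" by simp_all
  have perm: "?s permutes {1..4}" "?t permutes {1..4}" by (auto intro!: permutes_swap_id)
  have fix2: "twisted_image False h (pair_of (2, False)) = pair_of (2, False)" if "h \<in> {?s, ?t}" for h
    using that by (auto simp: twisted_image_def pair_of_simps transpose_def insert_commute)
  have gen: "klein j \<circ> sym3 c \<sigma> \<in> generate (sym_group 4) {?s, ?t}"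
    if "j \<in> {1..4}" "c < 3" "\<sigma> \<longrightarrow> True" "turn c \<sigma> 2 = 2" "(j \<noteq> 4 \<and> j \<noteq> 2 + 1) = (False \<and> \<sigma>)" for j c \<sigma>
  proof -
    have c: "\<sigma> \<and> c = 1 \<or> \<not> \<sigma> \<and> c = 0" using turn_fixes_2[OF that(4,2)] .
    have j: "j = 4 \<or> j = 3" using that(5) by auto
    have id: "id \<in> generate (sym_group 4) {?s, ?t}"
      using generate.one[of "sym_group 4" "{?s, ?t}"] by (simp add: sym_group_one)
    have s: "?s \<in> generate (sym_group 4) {?s, ?t}" and t: "?t \<in> generate (sym_group 4) {?s, ?t}"
      by (auto intro: generate.incl)
    then have st: "?s \<circ> ?t \<in> generate (sym_group 4) {?s, ?t}"
      using generate.eng[of ?s "sym_group 4" "{?s, ?t}" ?t] by (simp add: sym_group_mult)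
    have "?s \<circ> ?t \<circ> ?s = ?t" by (auto simp: transpose_def fun_eq_iff)
    then show ?thesis using c j id s t st by (auto simp: sym3_cases sym3_cases[unfolded One_nat_def] klein_cases)
  qed
  have "carrier (sym_group 4) = {g. g permutes {1..4} \<and> (evenperm g \<or> True)}"
    by (auto simp: sym_group_carrier)
  moreover have "{?s, ?t} \<subseteq> carrier (sym_group 4)"
    using perm by (simp add: sym_group_carrier)
  ultimately show "perm_isomorphic S4_6d ({..<3} \<times> UNIV, local_group True False)"
    and "transitive_perm_group S4_6d"
    unfolding S4_6d_def g using coset_perm_group_local_group[OF sym_group_is_group _ sym_group_mult, of 4 True "{?s, ?t}" False 2]
      fix2 gen by blast+
qed

text \<open>The 4-cycle is odd and exchanges \<open>{1, 3}\<close> with its complement, so it fixes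
  the point \<open>(1, False)\<close> in the twisted action; its powers form the whole
  stabiliser.\<close>

lemma S4_6c_local_group:
  "perm_isomorphic S4_6c ({..<3} \<times> UNIV, local_group True True)"
  "transitive_perm_group S4_6c"
proof -
  let ?q = "transpose 1 2 \<circ> (transpose 2 3 \<circ> transpose 3 (4::nat))"
  have g: "cycle_of_list [1, 2, 3, 4::nat] = ?q" by simp
  have odd: "\<not> evenperm ?q"
    by (simp add: evenperm_comp permutation_swap_id evenperm_swap permutation_compose)
  have perm: "?q permutes {1..4}" by (auto intro!: permutes_compose permutes_swap_id)
  have compl: "{1..4} - {2, 4} = {1, 3::nat}" by auto
  have "?q ` {1, 3} = {2, 4}" by (simp add: transpose_def insert_commute)
  then have fix1: "twisted_image True ?q (pair_of (1, False)) = pair_of (1, False)"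
    using odd compl by (simp only: twisted_image_def pair_of_simps) simp
  have gen: "klein j \<circ> sym3 c \<sigma> \<in> generate (sym_group 4) {?q}"
    if "j \<in> {1..4}" "c < 3" "\<sigma> \<longrightarrow> True" "turn c \<sigma> 1 = 1" "(j \<noteq> 4 \<and> j \<noteq> 1 + 1) = (True \<and> \<sigma>)" for j c \<sigma>
  proof -
    let ?G = "generate (sym_group 4) {?q}"
    have id: "id \<in> ?G"
      using generate.one[of "sym_group 4" "{?q}"] by (simp add: sym_group_one)
    have q: "?q \<in> ?G" by (rule generate.incl) simp
    have q2: "?q \<circ> ?q \<in> ?G"
      using generate.eng[OF q q] by (simp add: sym_group_mult)
    have q3: "?q \<circ> ?q \<circ> ?q \<in> ?G"
      using generate.eng[OF q2 q] by (simp add: sym_group_mult)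
    have e1: "transpose 1 3 \<circ> transpose 2 4 = ?q \<circ> ?q"
      by (rule permutes_4_eqI, (intro permutes_compose permutes_swap_id klein_permutes; simp),
          (intro permutes_compose permutes_swap_id; simp), simp_all add: klein_def transpose_def)
    have e2: "klein 1 \<circ> transpose 1 3 = ?q"
      by (rule permutes_4_eqI, (intro permutes_compose permutes_swap_id klein_permutes; simp),
          (intro permutes_compose permutes_swap_id; simp), simp_all add: klein_def transpose_def)
    have e3: "klein 3 \<circ> transpose 1 3 = ?q \<circ> ?q \<circ> ?q"
      by (rule permutes_4_eqI, (intro permutes_compose permutes_swap_id klein_permutes; simp),
          (intro permutes_compose permutes_swap_id; simp), simp_all add: klein_def transpose_def)
    from turn_fixes_1[OF that(4,2)] show ?thesis
    proof
      assume "\<sigma> \<and> c = 2"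
      then have \<sigma>: "\<sigma> = True" and c: "c = 2" and "j = 1 \<or> j = 3"
        using that(1,5) unfolding in_1_4 by auto
      from this(3) show ?thesis
      proof
        assume j: "j = 1"
        show ?thesis unfolding j \<sigma> c sym3_cases e2 by (rule q)
      next
        assume j: "j = 3"
        show ?thesis unfolding j \<sigma> c sym3_cases e3 by (rule q3)
      qed
    next
      assume "\<not> \<sigma> \<and> c = 0"
      then have \<sigma>: "\<sigma> = False" and c: "c = 0" and "j = 4 \<or> j = 2" using that(5) by auto
      from this(3) show ?thesis
      proof
        assume j: "j = 4"
        show ?thesis unfolding j \<sigma> c sym3_cases klein_cases comp_id by (rule id)
      next
        assume j: "j = 2"
        show ?thesis unfolding j \<sigma> c sym3_cases klein_cases comp_id e1 by (rule q2)
      qed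
    qed
  qed
  have "carrier (sym_group 4) = {g. g permutes {1..4} \<and> (evenperm g \<or> True)}"
    by (auto simp: sym_group_carrier)
  moreover have "{?q} \<subseteq> carrier (sym_group 4)"
    using perm by (simp add: sym_group_carrier)
  ultimately show "perm_isomorphic S4_6c ({..<3} \<times> UNIV, local_group True True)"
    and "transitive_perm_group S4_6c"
    unfolding S4_6c_def g using coset_perm_group_local_group[OF sym_group_is_group _ sym_group_mult, of 4 True "{?q}" True 1]
      fix1 gen by blast+
qed

section \<open>Cubic graphs with a rotation system\<close>

lemma turn_0 [simp]: "c < 3 \<Longrightarrow> turn c \<sigma> 0 = c"
  by (simp add: turn_def)

lemma add_double_mod_3: "(c + 2 * (x mod 3)) mod 3 = (c + 2 * x) mod (3::nat)"
proof -
  have "(c + 2 * (x mod 3)) mod 3 = (c + (2 * (x mod 3)) mod 3) mod 3"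
    by (rule mod_add_right_eq[symmetric])
  also have "(2 * (x mod 3)) mod 3 = (2 * x) mod 3" by (rule mod_mult_right_eq)
  also have "(c + (2 * x) mod 3) mod 3 = (c + 2 * x) mod 3" by (rule mod_add_right_eq)
  finally show ?thesis .
qed

text \<open>The composition law of affine maps; the signs multiply, which is exclusive or of the
  flags.\<close>

lemma turn_turn: "turn c \<sigma> (turn d \<tau> k) = turn (turn c \<sigma> d) (\<sigma> \<noteq> \<tau>) k"
proof -
  have 1: "(c + 2 * ((d + 2 * k) mod 3)) mod 3 = ((c + 2 * d) mod 3 + k) mod 3"
  proof -
    have "(c + 2 * ((d + 2 * k) mod 3)) mod 3 = (c + 2 * (d + 2 * k)) mod 3"
      by (rule add_double_mod_3)
    also have "c + 2 * (d + 2 * k) = c + 2 * d + k + 3 * k" by simp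
    also have "\<dots> mod 3 = (c + 2 * d + k) mod 3" by (rule mod_mult_self2)
    finally show ?thesis by (simp only: mod_simps)
  qed
  have 2: "(c + 2 * ((d + k) mod 3)) mod 3 = ((c + 2 * d) mod 3 + 2 * k) mod 3"
    by (simp only: add_double_mod_3 mod_simps distrib_left add.assoc)
  have 3: "(c + (d + l) mod 3) mod 3 = ((c + d) mod 3 + l) mod 3" for l
    by (simp only: mod_simps add.assoc)
  show ?thesis
    unfolding turn_def by (cases \<sigma>; cases \<tau>) (simp_all only: if_True if_False simp_thms 1 2 3)
qed

text \<open>A reflection is its own inverse; the inverse of the translation by \<open>c\<close> is
  the translation by \<open>-c\<close>, written \<open>2 * c\<close>.\<close>

lemma turn_left_inverse: "turn (if \<sigma> then c else 2 * c) \<sigma> (turn c \<sigma> k) = k mod 3"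
proof (cases \<sigma>)
  case True
  have "(c + 2 * ((c + 2 * k) mod 3)) mod 3 = (c + 2 * (c + 2 * k)) mod 3"
    by (rule add_double_mod_3)
  also have "c + 2 * (c + 2 * k) = k + 3 * (c + k)" by simp
  also have "\<dots> mod 3 = k mod 3" by (rule mod_mult_self2)
  finally show ?thesis using True by (simp add: turn_def)
next
  case False
  have "(2 * c + (c + k) mod 3) mod 3 = (2 * c + (c + k)) mod 3" by (simp only: mod_simps)
  also have "2 * c + (c + k) = k + 3 * c" by simp
  also have "\<dots> mod 3 = k mod 3" by (rule mod_mult_self2)
  finally show ?thesis using False by (simp add: turn_def)
qed

lemma turn_mod: "turn (c mod 3) \<sigma> k = turn c \<sigma> k"
  by (simp add: turn_def mod_simps)

lemma xor_turn:
  assumes "c < 3"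
  shows "(P (turn c \<sigma> 0) \<noteq> (P (turn c \<sigma> 1) \<noteq> P (turn c \<sigma> 2))) = (P 0 \<noteq> (P 1 \<noteq> P 2))"
  using assms unfolding less3 by (cases \<sigma>; elim disjE) (auto simp: turn_def numeral_2_eq_2)

text \<open>\<open>nb v 0, nb v 1, nb v 2\<close> are the neighbours of \<open>v\<close> in their cyclic order; \<open>\<sigma>\<close> says whether the
  automorphism reverses the cyclic orders.\<close>

definition map_aut :: "'a set \<Rightarrow> ('a \<Rightarrow> nat \<Rightarrow> 'a) \<Rightarrow> bool \<Rightarrow> ('a \<Rightarrow> 'a) \<Rightarrow> bool" where
  "map_aut V nb \<sigma> h \<longleftrightarrow> bij_betw h V V \<and> (\<forall>v\<in>V. \<exists>c<3. \<forall>k<3. h (nb v k) = nb (h v) (turn c \<sigma> k))"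

text \<open>The value at \<open>v\<close> of adjacency plus identity, applied to the indicator
  vector of \<open>X\<close> over the field with two elements.\<close>

definition defect :: "('a \<Rightarrow> nat \<Rightarrow> 'a) \<Rightarrow> 'a set \<Rightarrow> 'a \<Rightarrow> bool" where
  "defect nb X v \<longleftrightarrow> (v \<in> X) \<noteq> ((nb v 0 \<in> X) \<noteq> ((nb v 1 \<in> X) \<noteq> (nb v 2 \<in> X)))"

definition eigenspace :: "'a set \<Rightarrow> ('a \<Rightarrow> nat \<Rightarrow> 'a) \<Rightarrow> 'a set set" where
  "eigenspace V nb = {X. X \<subseteq> V \<and> (\<forall>v\<in>V. \<not> defect nb X v)}"

definition pullback :: "'a set \<Rightarrow> ('a \<Rightarrow> 'a) \<Rightarrow> 'a set \<Rightarrow> 'a set" where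
  "pullback V h X = {v \<in> V. h v \<in> X}"

lemma mem_sym_diff: "x \<in> sym_diff X Y \<longleftrightarrow> (x \<in> X) \<noteq> (x \<in> Y)"
  by blast

lemma defect_sym_diff: "defect nb (sym_diff X Y) v \<longleftrightarrow> defect nb X v \<noteq> defect nb Y v"
  unfolding defect_def mem_sym_diff by argo

text \<open>\<open>rotation\<close> and \<open>inversion\<close> give arc-transitivity by
  connectedness, \<open>reflection\<close> supplies the automorphisms with flag \<open>True\<close>,
  \<open>coloring\<close> a set in the coset that the twisted group needs, and
  \<open>eigenspace_large\<close> an eigenvector other than the zero and all-one vectors.\<close>

locale cubic_map =
  fixes V :: "'a set" and nb :: "'a \<Rightarrow> nat \<Rightarrow> 'a" and v0 :: 'a
  assumes finite_V: "finite V"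
    and base: "v0 \<in> V"
    and nb_in: "v \<in> V \<Longrightarrow> k < 3 \<Longrightarrow> nb v k \<in> V"
    and nb_inj: "v \<in> V \<Longrightarrow> k < 3 \<Longrightarrow> l < 3 \<Longrightarrow> nb v k = nb v l \<Longrightarrow> k = l"
    and nb_irrefl: "v \<in> V \<Longrightarrow> k < 3 \<Longrightarrow> nb v k \<noteq> v"
    and nb_sym: "v \<in> V \<Longrightarrow> k < 3 \<Longrightarrow> \<exists>l<3. nb (nb v k) l = v"
    and connected: "v \<in> V \<Longrightarrow> (\<lambda>u w. \<exists>k<3. w = nb u k)\<^sup>*\<^sup>* v0 v"
    and rotation: "\<exists>a. map_aut V nb False a \<and> a v0 = v0 \<and> a (nb v0 0) = nb v0 1"
    and inversion: "\<exists>b. map_aut V nb False b \<and> b v0 = nb v0 0"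
    and reflection: "\<exists>r. map_aut V nb True r \<and> r v0 = v0"
    and coloring: "\<exists>C\<subseteq>V. \<forall>v\<in>V. defect nb C v"
    and eigenspace_large: "card (eigenspace V nb) > 2"
begin

section \<open>Transitivity and local behaviour of the automorphisms\<close>

lemma map_aut_in: "map_aut V nb \<sigma> h \<Longrightarrow> v \<in> V \<Longrightarrow> h v \<in> V"
  by (auto simp: map_aut_def bij_betw_def)

lemma map_aut_turn:
  assumes "map_aut V nb \<sigma> h" "v \<in> V"
  shows "\<exists>c<3. \<forall>k<3. h (nb v k) = nb (h v) (turn c \<sigma> k)"
  using assms unfolding map_aut_def by blast

lemma map_aut_id: "map_aut V nb False id"
  unfolding map_aut_def by (auto intro!: exI[of _ 0] simp: turn_def)

lemma map_aut_comp:
  assumes g: "map_aut V nb \<sigma> g" and h: "map_aut V nb \<tau> h"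
  shows "map_aut V nb (\<sigma> \<noteq> \<tau>) (g \<circ> h)"
  unfolding map_aut_def
proof (intro conjI ballI)
  show "bij_betw (g \<circ> h) V V" using g h unfolding map_aut_def by (blast intro: bij_betw_trans)
  fix v assume v: "v \<in> V"
  obtain d where d: "d < 3" "\<And>k. k < 3 \<Longrightarrow> h (nb v k) = nb (h v) (turn d \<tau> k)"
    using map_aut_turn[OF h v] by blast
  obtain c where c: "c < 3" "\<And>k. k < 3 \<Longrightarrow> g (nb (h v) k) = nb (g (h v)) (turn c \<sigma> k)"
    using map_aut_turn[OF g map_aut_in[OF h v]] by blast
  show "\<exists>c<3. \<forall>k<3. (g \<circ> h) (nb v k) = nb ((g \<circ> h) v) (turn c (\<sigma> \<noteq> \<tau>) k)"
    by (intro exI[of _ "turn c \<sigma> d"] conjI allI impI) (simp_all add: d(2) c(2) turn_turn)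
qed

lemma map_aut_inv:
  assumes h: "map_aut V nb \<sigma> h"
  shows "map_aut V nb \<sigma> (inv_into V h)"
  unfolding map_aut_def
proof (intro conjI ballI)
  have bij: "bij_betw h V V" using h by (simp add: map_aut_def)
  then show "bij_betw (inv_into V h) V V" by (rule bij_betw_inv_into)
  fix v assume v: "v \<in> V"
  define u where "u = inv_into V h v"
  have u: "u \<in> V" "h u = v"
    unfolding u_def using bij v by (auto simp: bij_betw_def inv_into_into f_inv_into_f)
  obtain c where c: "c < 3" "\<And>k. k < 3 \<Longrightarrow> h (nb u k) = nb v (turn c \<sigma> k)"
    using map_aut_turn[OF h u(1)] unfolding u(2) by blast
  define d where "d = (if \<sigma> then c else 2 * c) mod 3"
  have "inv_into V h (nb v k) = nb u (turn d \<sigma> k)" if k: "k < 3" for k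
  proof -
    obtain l where l: "l < 3" "turn c \<sigma> l = k" using turn_surj[OF k] by blast
    have "turn d \<sigma> k = l" unfolding d_def turn_mod l(2)[symmetric] turn_left_inverse using l(1) by simp
    moreover have "inv_into V h (h (nb u l)) = nb u l"
      using bij nb_in[OF u(1) l(1)] by (simp add: bij_betw_def)
    ultimately show ?thesis using c(2)[OF l(1)] l(2) by simp
  qed
  then show "\<exists>c<3. \<forall>k<3. inv_into V h (nb v k) = nb (inv_into V h v) (turn c \<sigma> k)"
    unfolding u_def by (intro exI[of _ d]) (simp add: d_def)
qed

text \<open>The given automorphism must act on the neighbours of \<open>v0\<close> as the
  translation by 1, so its square reaches the third neighbour.\<close>

lemma rotation_base:
  assumes "k < 3"
  shows "\<exists>a. map_aut V nb False a \<and> a v0 = v0 \<and> a (nb v0 0) = nb v0 k"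
proof -
  obtain a where a: "map_aut V nb False a" "a v0 = v0" "a (nb v0 0) = nb v0 1" using rotation by blast
  obtain c where c: "c < 3" "\<And>k. k < 3 \<Longrightarrow> a (nb v0 k) = nb v0 (turn c False k)"
    using map_aut_turn[OF a(1) base] unfolding a(2) by blast
  have "nb v0 c = nb v0 1" using c(2)[of 0] c(1) a(3) by simp
  then have "c = 1" using nb_inj[OF base, of c 1] c(1) by simp
  then have "a (nb v0 1) = nb v0 2" using c(2)[of 1] by (simp add: turn_def numeral_2_eq_2)
  then have "(a \<circ> a) v0 = v0" "(a \<circ> a) (nb v0 0) = nb v0 2" using a by simp_all
  moreover have "map_aut V nb False (a \<circ> a)" using map_aut_comp[OF a(1) a(1)] by simp
  moreover have "id v0 = v0" "id (nb v0 0) = nb v0 0" by simp_all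
  ultimately show ?thesis using assms a map_aut_id unfolding less3 by metis
qed

text \<open>Induction along a path: if \<open>h\<close> takes \<open>v0\<close> to \<open>u\<close>,
  then first inverting, next rotating to the correct neighbour of \<open>v0\<close> and finally
  applying \<open>h\<close> reaches the next vertex.\<close>

lemma vertex_transitive_base:
  assumes "v \<in> V" shows "\<exists>h. map_aut V nb False h \<and> h v0 = v"
  using connected[OF assms]
proof (induction rule: rtranclp_induct)
  case base
  show ?case by (intro exI[of _ id] conjI map_aut_id) simp
next
  case (step u w)
  obtain h where h: "map_aut V nb False h" "h v0 = u" using step.IH by blast
  obtain k where k: "k < 3" "w = nb u k" using step.hyps by blast
  obtain c where c: "c < 3" "\<And>k. k < 3 \<Longrightarrow> h (nb v0 k) = nb u (turn c False k)"
    using map_aut_turn[OF h(1) base] unfolding h(2) by blast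
  obtain l where l: "l < 3" "turn c False l = k" using turn_surj[OF k(1)] by blast
  obtain a where a: "map_aut V nb False a" "a v0 = v0" "a (nb v0 0) = nb v0 l"
    using rotation_base[OF l(1)] by blast
  obtain b where b: "map_aut V nb False b" "b v0 = nb v0 0" using inversion by blast
  have "map_aut V nb False (h \<circ> (a \<circ> b))"
    using map_aut_comp[OF h(1) map_aut_comp[OF a(1) b(1)]] by simp
  moreover have "(h \<circ> (a \<circ> b)) v0 = w" using b(2) a(3) c(2)[OF l(1)] l(2) k(2) by simp
  ultimately show ?case by blast
qed

lemma arc_transitive_base:
  assumes v: "v \<in> V" and k: "k < 3"
  shows "\<exists>h. map_aut V nb False h \<and> h v0 = v \<and> h (nb v0 0) = nb v k"
proof -
  obtain h where h: "map_aut V nb False h" "h v0 = v" using vertex_transitive_base[OF v] by blast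
  obtain c where c: "c < 3" "\<And>k. k < 3 \<Longrightarrow> h (nb v0 k) = nb v (turn c False k)"
    using map_aut_turn[OF h(1) base] unfolding h(2) by blast
  obtain l where l: "l < 3" "turn c False l = k" using turn_surj[OF k] by blast
  obtain a where a: "map_aut V nb False a" "a v0 = v0" "a (nb v0 0) = nb v0 l"
    using rotation_base[OF l(1)] by blast
  have "map_aut V nb False (h \<circ> a)" using map_aut_comp[OF h(1) a(1)] by simp
  moreover have "(h \<circ> a) v0 = v" "(h \<circ> a) (nb v0 0) = nb v k"
    using a h(2) c(2)[OF l(1)] l(2) by simp_all
  ultimately show ?thesis by blast
qed

lemma map_aut_arc_transitive:
  assumes "v \<in> V" "k < 3" "w \<in> V" "l < 3"
  shows "\<exists>h. map_aut V nb False h \<and> h v = w \<and> h (nb v k) = nb w l"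
proof -
  obtain g where g: "map_aut V nb False g" "g v0 = v" "g (nb v0 0) = nb v k"
    using arc_transitive_base[OF assms(1,2)] by blast
  obtain h where h: "map_aut V nb False h" "h v0 = w" "h (nb v0 0) = nb w l"
    using arc_transitive_base[OF assms(3,4)] by blast
  have inj: "inj_on g V" using g(1) by (simp add: map_aut_def bij_betw_def)
  have "inv_into V g v = v0" "inv_into V g (nb v k) = nb v0 0"
    using inv_into_f_f[OF inj base] inv_into_f_f[OF inj nb_in[OF base, of 0]] g(2,3) by simp_all
  then have "(h \<circ> inv_into V g) v = w" "(h \<circ> inv_into V g) (nb v k) = nb w l" using h(2,3) by simp_all
  moreover have "map_aut V nb False (h \<circ> inv_into V g)"
    using map_aut_comp[OF h(1) map_aut_inv[OF g(1)]] by simp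
  ultimately show ?thesis by blast
qed

lemma map_aut_rotate:
  assumes v: "v \<in> V" and c: "c < 3"
  shows "\<exists>h. map_aut V nb False h \<and> h v = v \<and> (\<forall>k<3. h (nb v k) = nb v (turn c False k))"
proof -
  obtain h where h: "map_aut V nb False h" "h v = v" "h (nb v 0) = nb v c"
    using map_aut_arc_transitive[OF v _ v c, of 0] by auto
  obtain d where d: "d < 3" "\<And>k. k < 3 \<Longrightarrow> h (nb v k) = nb v (turn d False k)"
    using map_aut_turn[OF h(1) v] unfolding h(2) by blast
  have "nb v d = nb v c" using d(2)[of 0] d(1) h(3) by simp
  then have "d = c" using nb_inj[OF v d(1) c] by simp
  then show ?thesis using h(1,2) d(2) by blast
qed

text \<open>For \<open>\<sigma>\<close> true, the reflection at \<open>v0\<close> is conjugated to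
  \<open>v\<close>. It acts there with some offset \<open>d\<close>, which a rotation by
  \<open>e\<close> with \<open>d + e = c\<close> modulo 3 corrects.\<close>

lemma map_aut_local:
  assumes v: "v \<in> V" and c: "c < 3"
  shows "\<exists>h. map_aut V nb \<sigma> h \<and> h v = v \<and> (\<forall>k<3. h (nb v k) = nb v (turn c \<sigma> k))"
proof (cases \<sigma>)
  case False
  then show ?thesis using map_aut_rotate[OF assms] by simp
next
  case True
  obtain r where r: "map_aut V nb True r" "r v0 = v0" using reflection by blast
  obtain g where g: "map_aut V nb False g" "g v0 = v" using vertex_transitive_base[OF v] by blast
  have inj: "inj_on g V" using g(1) by (simp add: map_aut_def bij_betw_def)
  define s where "s = g \<circ> (r \<circ> inv_into V g)"
  have s: "map_aut V nb True s"
    unfolding s_def using map_aut_comp[OF g(1) map_aut_comp[OF r(1) map_aut_inv[OF g(1)]]] by simp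
  have sv: "s v = v" unfolding s_def using inv_into_f_f[OF inj base] g(2) r(2) by simp
  obtain d where d: "d < 3" "\<And>k. k < 3 \<Longrightarrow> s (nb v k) = nb v (turn d True k)"
    using map_aut_turn[OF s v] unfolding sv by blast
  obtain e where e: "e < 3" "turn d False e = c" using turn_surj[OF c] by blast
  obtain h where h: "map_aut V nb False h" "h v = v" "\<And>k. k < 3 \<Longrightarrow> h (nb v k) = nb v (turn e False k)"
    using map_aut_rotate[OF v e(1)] by blast
  have "turn e False d = c" using e(2) by (simp add: turn_def add.commute)
  then have "(h \<circ> s) (nb v k) = nb v (turn c True k)" if "k < 3" for k
    using that by (simp add: d(2) h(3) turn_turn)
  moreover have "map_aut V nb True (h \<circ> s)" using map_aut_comp[OF h(1) s] by simp
  moreover have "(h \<circ> s) v = v" using h(2) sv by simp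
  ultimately show ?thesis using True by metis
qed

section \<open>The eigenspace seen from a vertex and from an arc\<close>

lemma defect_pullback:
  assumes h: "map_aut V nb \<sigma> h" and v: "v \<in> V"
  shows "defect nb (pullback V h X) v \<longleftrightarrow> defect nb X (h v)"
proof -
  obtain c where c: "c < 3" "\<And>k. k < 3 \<Longrightarrow> h (nb v k) = nb (h v) (turn c \<sigma> k)"
    using map_aut_turn[OF h v] by blast
  have "nb v k \<in> pullback V h X \<longleftrightarrow> nb (h v) (turn c \<sigma> k) \<in> X" if "k < 3" for k
    using nb_in[OF v that] c(2)[OF that] by (simp add: pullback_def)
  moreover have "v \<in> pullback V h X \<longleftrightarrow> h v \<in> X" using v by (simp add: pullback_def)
  ultimately show ?thesis
    unfolding defect_def using xor_turn[OF c(1), of "\<lambda>k. nb (h v) k \<in> X" \<sigma>] by simp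
qed

lemma pullback_eigenspace:
  assumes "map_aut V nb \<sigma> h" "X \<in> eigenspace V nb"
  shows "pullback V h X \<in> eigenspace V nb"
  using assms map_aut_in[OF assms(1)] defect_pullback[OF assms(1)]
  by (auto simp: eigenspace_def pullback_def)

lemma sym_diff_eigenspace:
  assumes "X \<in> eigenspace V nb" "Y \<in> eigenspace V nb"
  shows "sym_diff X Y \<in> eigenspace V nb"
  using assms defect_sym_diff[of nb X Y] by (auto simp: eigenspace_def)

lemma empty_eigenspace: "{} \<in> eigenspace V nb"
  by (simp add: eigenspace_def defect_def)

text \<open>The valency is odd, so adjacency fixes the all-one vector.\<close>

lemma V_eigenspace: "V \<in> eigenspace V nb"
  using nb_in by (simp add: eigenspace_def defect_def)

text \<open>Some eigenvector is neither empty nor full. After possibly adding \<open>V\<close> it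
  avoids \<open>v0\<close>, and connectedness gives an arc entering it.\<close>

lemma ex_mixed_arc: "\<exists>X\<in>eigenspace V nb. \<exists>u\<in>V. \<exists>k<3. u \<notin> X \<and> nb u k \<in> X"
proof -
  have "\<not> eigenspace V nb \<subseteq> {{}, V}"
  proof
    assume "eigenspace V nb \<subseteq> {{}, V}"
    then have "card (eigenspace V nb) \<le> card {{}, V}" by (intro card_mono) auto
    also have "\<dots> \<le> 2" by (simp add: card_insert_if)
    finally show False using eigenspace_large by simp
  qed
  then obtain X where X: "X \<in> eigenspace V nb" "X \<noteq> {}" "X \<noteq> V" by blast
  then have XV: "X \<subseteq> V" by (simp add: eigenspace_def)
  define Y where "Y = (if v0 \<in> X then sym_diff X V else X)"
  have Y: "Y \<in> eigenspace V nb" "Y \<noteq> {}" "v0 \<notin> Y" "Y \<subseteq> V"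
    using X XV base sym_diff_eigenspace[OF X(1) V_eigenspace] by (auto simp: Y_def)
  show ?thesis
  proof (rule ccontr)
    assume no: "\<not> ?thesis"
    obtain y where y: "y \<in> Y" using Y(2) by blast
    then have "y \<in> V" using Y(4) by blast
    from connected[OF this] have "y \<in> V \<and> y \<notin> Y"
    proof (induction rule: rtranclp_induct)
      case base
      show ?case using Y(3) cubic_map.base[OF cubic_map_axioms] by simp
    next
      case (step u w)
      then obtain k where "k < 3" "w = nb u k" by blast
      then show ?case using step.IH no Y(1) nb_in by blast
    qed
    then show False using y by simp
  qed
qed

text \<open>At the tail \<open>u\<close> of a mixed arc the number of neighbours in \<open>X\<close>
  is even and positive, hence two. Arc-transitivity moves the remaining neighbour to any prescribed
  position.\<close>

lemma eigenspace_two_neighbours: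
  assumes v: "v \<in> V" and l: "l < 3"
  shows "\<exists>X\<in>eigenspace V nb. \<forall>k<3. nb v k \<in> X \<longleftrightarrow> k \<noteq> l"
proof -
  obtain X u k where X: "X \<in> eigenspace V nb" and u: "u \<in> V" "k < 3" "u \<notin> X" "nb u k \<in> X"
    using ex_mixed_arc by blast
  have "\<not> defect nb X u" using X u(1) by (simp add: eigenspace_def)
  then obtain m where m: "m < 3" "\<And>k. k < 3 \<Longrightarrow> nb u k \<in> X \<longleftrightarrow> k \<noteq> m"
    using u(2-4) unfolding defect_def less3 by (metis zero_neq_one one_neq_zero zero_neq_numeral)
  obtain h where h: "map_aut V nb False h" "h v = u" "h (nb v l) = nb u m"
    using map_aut_arc_transitive[OF v l u(1) m(1)] by blast
  obtain c where c: "c < 3" "\<And>k. k < 3 \<Longrightarrow> h (nb v k) = nb u (turn c False k)"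
    using map_aut_turn[OF h(1) v] unfolding h(2) by blast
  have cl: "turn c False l = m"
    using c(2)[OF l] h(3) nb_inj[OF u(1) turn_less m(1), of c False l] by simp
  have "nb v k \<in> pullback V h X \<longleftrightarrow> k \<noteq> l" if k: "k < 3" for k
  proof -
    have "nb v k \<in> pullback V h X \<longleftrightarrow> turn c False k \<noteq> m"
      using nb_in[OF v k] c(2)[OF k] m(2)[OF turn_less] by (simp add: pullback_def)
    then show ?thesis using cl turn_inj[OF k l, of c False] by auto
  qed
  then show ?thesis using pullback_eigenspace[OF h(1) X] by blast
qed

text \<open>Patterns of even weight are zero or have weight two; adding \<open>V\<close> complements
  them and yields the odd ones. So restriction to a neighbourhood is onto.\<close>

lemma eigenspace_local:
  assumes v: "v \<in> V"
  shows "\<exists>X\<in>eigenspace V nb. \<forall>k<3. nb v k \<in> X \<longleftrightarrow> p k"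
proof -
  have even: "\<exists>X\<in>eigenspace V nb. \<forall>k<3. nb v k \<in> X \<longleftrightarrow> q k" if q: "\<not> (q 0 \<noteq> (q 1 \<noteq> q 2))" for q
  proof (cases "q 0 \<or> q 1 \<or> q 2")
    case False
    then show ?thesis using empty_eigenspace unfolding less3 by (intro bexI[of _ "{}"]) auto
  next
    case True
    define l :: nat where "l = (if q 0 then if q 1 then 2 else 1 else 0)"
    have "l < 3" by (simp add: l_def)
    moreover have "k \<noteq> l \<longleftrightarrow> q k" if "k < 3" for k
      using that True q unfolding less3 l_def by (elim disjE) auto
    ultimately show ?thesis using eigenspace_two_neighbours[OF v] by metis
  qed
  show ?thesis
  proof (cases "p 0 \<noteq> (p 1 \<noteq> p 2)")
    case False
    then show ?thesis using even[of p] by simp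
  next
    case True
    then have "\<not> ((\<not> p 0) \<noteq> ((\<not> p 1) \<noteq> (\<not> p 2)))" by blast
    then obtain X where X: "X \<in> eigenspace V nb" "\<And>k. k < 3 \<Longrightarrow> nb v k \<in> X \<longleftrightarrow> \<not> p k"
      using even[of "\<lambda>k. \<not> p k"] by blast
    have "nb v k \<in> sym_diff X V \<longleftrightarrow> p k" if "k < 3" for k
      using X(2)[OF that] nb_in[OF v that] by simp
    then show ?thesis using sym_diff_eigenspace[OF X(1) V_eigenspace] by blast
  qed
qed

text \<open>The same surjectivity for the coset of sets with constant defect \<open>t\<close>: a
  coloring, or the empty set, is corrected by an eigenvector.\<close>

lemma defect_local:
  assumes v: "v \<in> V"
  shows "\<exists>X\<subseteq>V. (\<forall>u\<in>V. defect nb X u = t) \<and> (\<forall>k<3. nb v k \<in> X \<longleftrightarrow> p k)"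
proof -
  obtain C where C: "C \<subseteq> V" "\<And>u. u \<in> V \<Longrightarrow> defect nb C u = t"
  proof (cases t)
    case True
    then show ?thesis using coloring that by blast
  next
    case False
    then show ?thesis using that[of "{}"] by (simp add: defect_def)
  qed
  obtain X where X: "X \<in> eigenspace V nb" "\<And>k. k < 3 \<Longrightarrow> nb v k \<in> X \<longleftrightarrow> (nb v k \<in> C) \<noteq> p k"
    using eigenspace_local[OF v, of "\<lambda>k. (nb v k \<in> C) \<noteq> p k"] by blast
  have "sym_diff X C \<subseteq> V" using X(1) C(1) by (auto simp: eigenspace_def)
  moreover have "defect nb (sym_diff X C) u = t" if "u \<in> V" for u
    using X(1) C(2)[OF that] that by (simp add: defect_sym_diff eigenspace_def)
  moreover have "nb v k \<in> sym_diff X C \<longleftrightarrow> p k" if "k < 3" for k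
    using X(2)[OF that] unfolding mem_sym_diff by blast
  ultimately show ?thesis by blast
qed

lemma eigenspace_arc:
  assumes v: "v \<in> V" and k: "k < 3"
  shows "\<exists>X\<in>eigenspace V nb. (v \<in> X) = s \<and> (nb v k \<in> X) = t"
proof -
  \<comment> \<open>Membership of \<open>v\<close> is the parity of the pattern on its neighbours.
    One further neighbour, the one after position \<open>k\<close>, is used to adjust this parity to
    \<open>s\<close>.\<close>
  let ?p = "\<lambda>l. if l = k then t else l = (k + 1) mod 3 \<and> s \<noteq> t"
  obtain X where X: "X \<in> eigenspace V nb" "\<And>l. l < 3 \<Longrightarrow> nb v l \<in> X \<longleftrightarrow> ?p l"
    using eigenspace_local[OF v, of ?p] by blast
  have "\<not> defect nb X v" using X(1) v by (simp add: eigenspace_def)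
  then have "(v \<in> X) = (?p 0 \<noteq> (?p 1 \<noteq> ?p 2))"
    unfolding defect_def using X(2)[of 0] X(2)[of 1] X(2)[of 2] by simp
  also have "\<dots> = s" using k unfolding less3 by (cases s; cases t; elim disjE) simp_all
  finally show ?thesis using X(1) X(2)[OF k] by auto
qed

end

section \<open>The doubled graph\<close>

lemma Aut_subgroup: "subgroup (carrier (Aut \<Gamma>)) (BijGroup (pverts \<Gamma>))"
proof (rule group.subgroupI[OF group_BijGroup])
  show "carrier (Aut \<Gamma>) \<subseteq> carrier (BijGroup (pverts \<Gamma>))"
    by (auto simp: Aut_def BijGroup_def)
  have "(\<lambda>x\<in>pverts \<Gamma>. x) \<in> carrier (Aut \<Gamma>)" by (simp add: Aut_def id_Bij)
  then show "carrier (Aut \<Gamma>) \<noteq> {}" by blast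
next
  fix f assume "f \<in> carrier (Aut \<Gamma>)"
  then have f: "f \<in> Bij (pverts \<Gamma>)"
    and arc: "\<And>u v. u \<in> pverts \<Gamma> \<Longrightarrow> v \<in> pverts \<Gamma> \<Longrightarrow> (u, v) \<in> parcs \<Gamma> \<longleftrightarrow> (f u, f v) \<in> parcs \<Gamma>"
    by (simp_all add: Aut_def)
  have surj: "f ` pverts \<Gamma> = pverts \<Gamma>" using f by (simp add: Bij_def bij_betw_def)
  have "(u, v) \<in> parcs \<Gamma> \<longleftrightarrow> (inv_into (pverts \<Gamma>) f u, inv_into (pverts \<Gamma>) f v) \<in> parcs \<Gamma>"
    if "u \<in> pverts \<Gamma>" "v \<in> pverts \<Gamma>" for u v
    using arc[of "inv_into (pverts \<Gamma>) f u" "inv_into (pverts \<Gamma>) f v"] that surj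
    by (simp add: f_inv_into_f inv_into_into)
  then show "inv\<^bsub>BijGroup (pverts \<Gamma>)\<^esub> f \<in> carrier (Aut \<Gamma>)"
    using restrict_inv_into_Bij[OF f] by (simp add: inv_BijGroup[OF f] Aut_def)
next
  fix f g assume "f \<in> carrier (Aut \<Gamma>)" "g \<in> carrier (Aut \<Gamma>)"
  then have fg: "f \<in> Bij (pverts \<Gamma>)" "g \<in> Bij (pverts \<Gamma>)"
    and arc: "\<And>u v. u \<in> pverts \<Gamma> \<Longrightarrow> v \<in> pverts \<Gamma> \<Longrightarrow> (u, v) \<in> parcs \<Gamma> \<longleftrightarrow> (f u, f v) \<in> parcs \<Gamma>"
      "\<And>u v. u \<in> pverts \<Gamma> \<Longrightarrow> v \<in> pverts \<Gamma> \<Longrightarrow> (u, v) \<in> parcs \<Gamma> \<longleftrightarrow> (g u, g v) \<in> parcs \<Gamma>"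
    by (simp_all add: Aut_def)
  have "g u \<in> pverts \<Gamma>" if "u \<in> pverts \<Gamma>" for u
    using Bij_imp_funcset[OF fg(2)] that by (rule funcset_mem)
  then have "(u, v) \<in> parcs \<Gamma> \<longleftrightarrow> (f (g u), f (g v)) \<in> parcs \<Gamma>"
    if "u \<in> pverts \<Gamma>" "v \<in> pverts \<Gamma>" for u v
    using arc(1)[of "g u" "g v"] arc(2)[OF that] that by simp
  then have "compose (pverts \<Gamma>) f g \<in> carrier (Aut \<Gamma>)"
    using compose_Bij[OF fg] by (simp add: Aut_def compose_def)
  then show "f \<otimes>\<^bsub>BijGroup (pverts \<Gamma>)\<^esub> g \<in> carrier (Aut \<Gamma>)"
    using fg by (simp add: BijGroup_def)
qed

lemma group_Aut: "group (Aut \<Gamma>)"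
proof -
  have "Aut \<Gamma> = BijGroup (pverts \<Gamma>)\<lparr>carrier := carrier (Aut \<Gamma>)\<rparr>" by (simp add: Aut_def)
  then show ?thesis
    using subgroup.subgroup_is_group[OF Aut_subgroup[of \<Gamma>] group_BijGroup] by simp
qed

lemma mult_Aut:
  assumes "f \<in> carrier (Aut \<Gamma>)" "g \<in> carrier (Aut \<Gamma>)"
  shows "f \<otimes>\<^bsub>Aut \<Gamma>\<^esub> g = compose (pverts \<Gamma>) f g"
  using assms by (simp add: Aut_def BijGroup_def)

lemma one_Aut: "\<one>\<^bsub>Aut \<Gamma>\<^esub> = (\<lambda>x\<in>pverts \<Gamma>. x)"
  by (simp add: Aut_def BijGroup_def)

text \<open>The vertex \<open>v\<close> of the cubic graph is doubled to the vertices \<open>2 * v\<close> and \<open>2 * v + 1\<close>.\<close>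

definition doubled_graph :: "nat set \<Rightarrow> (nat \<Rightarrow> nat \<Rightarrow> nat) \<Rightarrow> nat pair_pre_digraph" where
  "doubled_graph V nb = \<lparr>pverts = {x. x div 2 \<in> V},
     parcs = {(x, y). x div 2 \<in> V \<and> (\<exists>k<3. y div 2 = nb (x div 2) k)}\<rparr>"

text \<open>Membership in \<open>X\<close> is read at the source vertex, before \<open>h\<close>
  moves it; this decides the form of the composition law.\<close>

definition lift_map :: "nat set \<Rightarrow> (nat \<Rightarrow> nat) \<Rightarrow> nat set \<Rightarrow> nat \<Rightarrow> nat" where
  "lift_map V h X = (\<lambda>x\<in>{x. x div 2 \<in> V}. 2 * h (x div 2) + of_bool (odd x \<noteq> (x div 2 \<in> X)))"

text \<open>The swap sets belong to the eigenspace, or to the coset of constant defect 1 when the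
  automorphism reverses orientation and \<open>tw\<close> holds.\<close>

definition lift_group :: "nat set \<Rightarrow> (nat \<Rightarrow> nat \<Rightarrow> nat) \<Rightarrow> bool \<Rightarrow> bool \<Rightarrow> (nat \<Rightarrow> nat) set" where
  "lift_group V nb rv tw = {lift_map V h X |h X \<sigma>. map_aut V nb \<sigma> h \<and> (\<sigma> \<longrightarrow> rv) \<and>
     X \<subseteq> V \<and> (\<forall>v\<in>V. defect nb X v = (tw \<and> \<sigma>))}"

lemma pverts_doubled [simp]: "pverts (doubled_graph V nb) = {x. x div 2 \<in> V}"
  by (simp add: doubled_graph_def)

section \<open>Vertices of the doubled graph as a base vertex with a parity bit\<close>

lemma parcs_doubled: "(x, y) \<in> parcs (doubled_graph V nb) \<longleftrightarrow>
    x div 2 \<in> V \<and> (\<exists>k<3. y div 2 = nb (x div 2) k)"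
  by (simp add: doubled_graph_def)

lemma double_of_bool_div [simp]: "(2 * n + of_bool b) div 2 = (n::nat)"
  by (cases b) simp_all

lemma double_of_bool_odd [simp]: "odd (2 * n + of_bool b :: nat) \<longleftrightarrow> b"
  by (cases b) simp_all

lemma double_div_odd: "2 * (x div 2) + of_bool (odd x) = (x::nat)"
  by (cases "odd x") (auto elim: oddE evenE)

lemma lift_map_apply:
  "x div 2 \<in> V \<Longrightarrow> lift_map V h X x = 2 * h (x div 2) + of_bool (odd x \<noteq> (x div 2 \<in> X))"
  by (simp add: lift_map_def)

lemma lift_map_div: "x div 2 \<in> V \<Longrightarrow> lift_map V h X x div 2 = h (x div 2)"
  by (simp only: lift_map_apply double_of_bool_div)

lemma lift_map_odd: "x div 2 \<in> V \<Longrightarrow> odd (lift_map V h X x) \<longleftrightarrow> odd x \<noteq> (x div 2 \<in> X)"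
  by (simp only: lift_map_apply double_of_bool_odd)

lemma nat_half_eqI: "x div 2 = y div 2 \<Longrightarrow> odd x = odd y \<Longrightarrow> x = (y::nat)"
proof -
  assume "x div 2 = y div 2" "odd x = odd y"
  then have "2 * (x div 2) + of_bool (odd x) = 2 * (y div 2) + of_bool (odd y)" by (simp only:)
  then show "x = y" unfolding double_div_odd .
qed

lemma finite_halves: "finite V \<Longrightarrow> finite {x::nat. x div 2 \<in> V}"
proof -
  assume "finite V"
  moreover have "{x. x div 2 \<in> V} = (\<lambda>(v, b). 2 * v + of_bool b) ` (V \<times> UNIV)"
  proof (intro equalityI subsetI)
    fix x assume "x \<in> {x. x div 2 \<in> V}"
    then show "x \<in> (\<lambda>(v, b). 2 * v + of_bool b) ` (V \<times> UNIV)"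
      by (intro image_eqI[of _ _ "(x div 2, odd x)"]) (simp_all only: double_div_odd prod.case mem_Times_iff, auto)
  qed auto
  ultimately show ?thesis by simp
qed

lemma card_halves: "finite V \<Longrightarrow> card {x::nat. x div 2 \<in> V} = 2 * card V"
proof -
  assume "finite V"
  have "bij_betw (\<lambda>x. (x div 2, odd x)) {x. x div 2 \<in> V} (V \<times> UNIV)"
    unfolding bij_betw_def
  proof
    show "inj_on (\<lambda>x. (x div 2, odd x)) {x::nat. x div 2 \<in> V}"
      by (rule inj_onI) (auto intro: nat_half_eqI)
    show "(\<lambda>x. (x div 2, odd x)) ` {x::nat. x div 2 \<in> V} = V \<times> UNIV"
    proof (intro equalityI subsetI)
      fix p :: "nat \<times> bool" assume "p \<in> V \<times> UNIV"
      then have "fst p \<in> V" by (simp only: mem_Times_iff)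
      then show "p \<in> (\<lambda>x. (x div 2, odd x)) ` {x. x div 2 \<in> V}"
        by (intro image_eqI[of _ _ "2 * fst p + of_bool (snd p)"])
          (simp_all only: double_of_bool_div double_of_bool_odd prod.collapse mem_Collect_eq)
    qed auto
  qed
  then have "card {x. x div 2 \<in> V} = card (V \<times> (UNIV :: bool set))" by (rule bij_betw_same_card)
  then show ?thesis by (simp add: card_cartesian_product)
qed

locale nat_cubic_map = cubic_map V nb v0 for V :: "nat set" and nb and v0
begin

abbreviation \<Gamma> where "\<Gamma> \<equiv> doubled_graph V nb"

section \<open>The lifted group and its transitivity on arcs\<close>

lemma lift_map_Bij:
  assumes h: "map_aut V nb \<sigma> h" shows "lift_map V h X \<in> Bij {x. x div 2 \<in> V}"
proof -
  have inj: "inj_on h V" using h by (simp add: map_aut_def bij_betw_def)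
  have "inj_on (lift_map V h X) {x. x div 2 \<in> V}"
  proof (rule inj_onI)
    fix x y assume "x \<in> {x. x div 2 \<in> V}" "y \<in> {x. x div 2 \<in> V}"
      and eq: "lift_map V h X x = lift_map V h X y"
    then have x: "x div 2 \<in> V" and y: "y div 2 \<in> V" by simp_all
    have "h (x div 2) = h (y div 2)"
      using lift_map_div[OF x, of h X] lift_map_div[OF y, of h X] eq by simp
    then have xy: "x div 2 = y div 2" using inj x y by (simp add: inj_on_def)
    have "odd x = odd y"
      using lift_map_odd[OF x, of h X] lift_map_odd[OF y, of h X] unfolding eq xy by argo
    with xy show "x = y" by (rule nat_half_eqI)
  qed
  moreover have "lift_map V h X ` {x. x div 2 \<in> V} \<subseteq> {x. x div 2 \<in> V}"
    using map_aut_in[OF h] by (auto simp only: lift_map_div mem_Collect_eq)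
  ultimately have "bij_betw (lift_map V h X) {x. x div 2 \<in> V} {x. x div 2 \<in> V}"
    unfolding bij_betw_def using endo_inj_surj[OF finite_halves[OF finite_V]] by blast
  then show ?thesis by (simp add: Bij_def lift_map_def)
qed

lemma map_aut_arc:
  assumes h: "map_aut V nb \<sigma> h" and v: "v \<in> V" "w \<in> V"
  shows "(\<exists>k<3. w = nb v k) \<longleftrightarrow> (\<exists>k<3. h w = nb (h v) k)"
proof -
  obtain c where c: "c < 3" "\<And>k. k < 3 \<Longrightarrow> h (nb v k) = nb (h v) (turn c \<sigma> k)"
    using map_aut_turn[OF h v(1)] by blast
  have inj: "inj_on h V" using h by (simp add: map_aut_def bij_betw_def)
  show ?thesis
  proof
    assume "\<exists>k<3. w = nb v k"
    then show "\<exists>k<3. h w = nb (h v) k" using c(2) turn_less by blast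
  next
    assume "\<exists>k<3. h w = nb (h v) k"
    then obtain k where k: "k < 3" "h w = nb (h v) k" by blast
    obtain l where l: "l < 3" "turn c \<sigma> l = k" using turn_surj[OF k(1)] by blast
    have "h w = h (nb v l)" using k(2) c(2)[OF l(1)] l(2) by simp
    then have "w = nb v l" using inj_onD[OF inj] v(2) nb_in[OF v(1) l(1)] by blast
    then show "\<exists>k<3. w = nb v k" using l(1) by blast
  qed
qed

lemma lift_map_Aut:
  assumes h: "map_aut V nb \<sigma> h" shows "lift_map V h X \<in> carrier (Aut \<Gamma>)"
proof -
  have "(x, y) \<in> parcs \<Gamma> \<longleftrightarrow> (lift_map V h X x, lift_map V h X y) \<in> parcs \<Gamma>"
    if "x div 2 \<in> V" "y div 2 \<in> V" for x y
    using map_aut_arc[OF h that] map_aut_in[OF h that(1)] that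
    by (simp only: parcs_doubled lift_map_div)
  then show ?thesis using lift_map_Bij[OF h] by (simp add: Aut_def)
qed

text \<open>The multiplication of a semidirect product: a pair is swapped by the composite when
  exactly one of the two factors swaps it, and the second factor acts after
  \<open>h\<close>.\<close>

lemma lift_map_compose:
  assumes g: "map_aut V nb \<sigma> g" and h: "map_aut V nb \<tau> h"
  shows "compose {x. x div 2 \<in> V} (lift_map V g Y) (lift_map V h X)
    = lift_map V (g \<circ> h) (sym_diff X (pullback V h Y))"
proof (rule extensional_eqI[of _ "{x. x div 2 \<in> V}"])
  fix x assume "x \<in> {x. x div 2 \<in> V}"
  then have x: "x div 2 \<in> V" by simp
  have hx: "lift_map V h X x div 2 \<in> V" using map_aut_in[OF h x] lift_map_div[OF x] by simp
  have "lift_map V g Y (lift_map V h X x) = lift_map V (g \<circ> h) (sym_diff X (pullback V h Y)) x"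
  proof (rule nat_half_eqI)
    show "lift_map V g Y (lift_map V h X x) div 2 = lift_map V (g \<circ> h) (sym_diff X (pullback V h Y)) x div 2"
      unfolding lift_map_div[OF hx] lift_map_div[OF x] by simp
    have "x div 2 \<in> pullback V h Y \<longleftrightarrow> h (x div 2) \<in> Y" using x by (simp add: pullback_def)
    then show "odd (lift_map V g Y (lift_map V h X x)) = odd (lift_map V (g \<circ> h) (sym_diff X (pullback V h Y)) x)"
      unfolding lift_map_odd[OF hx] lift_map_odd[OF x] lift_map_div[OF x] mem_sym_diff by argo
  qed
  then show "compose {x. x div 2 \<in> V} (lift_map V g Y) (lift_map V h X) x
    = lift_map V (g \<circ> h) (sym_diff X (pullback V h Y)) x" using x by (simp add: compose_def)
qed (simp_all add: compose_def lift_map_def)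

lemma lift_groupI:
  assumes "map_aut V nb \<sigma> h" "\<sigma> \<longrightarrow> rv" "X \<subseteq> V" "\<And>v. v \<in> V \<Longrightarrow> defect nb X v = (tw \<and> \<sigma>)"
  shows "lift_map V h X \<in> lift_group V nb rv tw"
  unfolding lift_group_def mem_Collect_eq
  by (intro exI[of _ h] exI[of _ X] exI[of _ \<sigma>] conjI refl ballI assms)

lemma lift_groupE:
  assumes "g \<in> lift_group V nb rv tw"
  obtains h X \<sigma> where "g = lift_map V h X" "map_aut V nb \<sigma> h" "\<sigma> \<longrightarrow> rv" "X \<subseteq> V"
    "\<forall>v\<in>V. defect nb X v = (tw \<and> \<sigma>)"
  using assms unfolding lift_group_def by blast

lemma lift_map_one: "lift_map V id {} = \<one>\<^bsub>Aut \<Gamma>\<^esub>"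
proof (rule extensional_eqI[of _ "{x. x div 2 \<in> V}"])
  fix x assume "x \<in> {x. x div 2 \<in> V}"
  then have x: "x div 2 \<in> V" by simp
  have "lift_map V id {} x = x"
    by (rule nat_half_eqI) (simp_all only: lift_map_div[OF x] lift_map_odd[OF x] id_apply empty_iff simp_thms)
  then show "lift_map V id {} x = \<one>\<^bsub>Aut \<Gamma>\<^esub> x" using x by (simp add: one_Aut)
qed (simp_all add: lift_map_def one_Aut)

lemma lift_map_cong:
  assumes "\<And>v. v \<in> V \<Longrightarrow> g v = h v" "\<And>v. v \<in> V \<Longrightarrow> v \<in> X \<longleftrightarrow> v \<in> Y"
  shows "lift_map V g X = lift_map V h Y"
  unfolding lift_map_def using assms by (intro restrict_ext) simp

text \<open>Defects add under symmetric difference and are carried along by pullbacks, while the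
  flags add under composition. Hence the relation between defect and flag is closed under products
  and inverses.\<close>

lemma lift_group_subgroup: "subgroup (lift_group V nb rv tw) (Aut \<Gamma>)"
proof (rule group.subgroupI[OF group_Aut])
  show "lift_group V nb rv tw \<subseteq> carrier (Aut \<Gamma>)"
    by (auto elim!: lift_groupE intro: lift_map_Aut)
  have "lift_map V id {} \<in> lift_group V nb rv tw"
    by (rule lift_groupI[OF map_aut_id]) (simp_all add: defect_def)
  then show "lift_group V nb rv tw \<noteq> {}" by blast
next
  fix f g assume "f \<in> lift_group V nb rv tw" "g \<in> lift_group V nb rv tw"
  then obtain h X \<sigma> k Y \<tau> where f: "f = lift_map V h X" "map_aut V nb \<sigma> h" "\<sigma> \<longrightarrow> rv" "X \<subseteq> V"
    "\<forall>v\<in>V. defect nb X v = (tw \<and> \<sigma>)" and g: "g = lift_map V k Y" "map_aut V nb \<tau> k" "\<tau> \<longrightarrow> rv" "Y \<subseteq> V"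
    "\<forall>v\<in>V. defect nb Y v = (tw \<and> \<tau>)" by (elim lift_groupE)
  have "f \<otimes>\<^bsub>Aut \<Gamma>\<^esub> g = compose {x. x div 2 \<in> V} f g"
    using mult_Aut[of f \<Gamma> g] lift_map_Aut[OF f(2)] lift_map_Aut[OF g(2)] f(1) g(1) by simp
  also have "\<dots> = lift_map V (h \<circ> k) (sym_diff Y (pullback V k X))"
    unfolding f(1) g(1) using f(2) g(2) by (rule lift_map_compose)
  also have "\<dots> \<in> lift_group V nb rv tw"
  proof (rule lift_groupI[OF map_aut_comp[OF f(2) g(2)]])
    show "(\<sigma> \<noteq> \<tau>) \<longrightarrow> rv" using f(3) g(3) by blast
    show "sym_diff Y (pullback V k X) \<subseteq> V" using g(4) by (auto simp: pullback_def)
    fix v assume v: "v \<in> V"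
    show "defect nb (sym_diff Y (pullback V k X)) v = (tw \<and> (\<sigma> \<noteq> \<tau>))"
      unfolding defect_sym_diff defect_pullback[OF g(2) v]
      using f(5) g(5) v map_aut_in[OF g(2) v] by auto
  qed
  finally show "f \<otimes>\<^bsub>Aut \<Gamma>\<^esub> g \<in> lift_group V nb rv tw" .
next
  fix f assume "f \<in> lift_group V nb rv tw"
  then obtain h X \<sigma> where f: "f = lift_map V h X" "map_aut V nb \<sigma> h" "\<sigma> \<longrightarrow> rv" "X \<subseteq> V"
    "\<forall>v\<in>V. defect nb X v = (tw \<and> \<sigma>)" by (elim lift_groupE)
  let ?k = "inv_into V h"
  have k: "map_aut V nb \<sigma> ?k" using f(2) by (rule map_aut_inv)
  have bij: "bij_betw h V V" using f(2) by (simp add: map_aut_def)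
  have kh: "?k (h v) = v" if "v \<in> V" for v using bij that by (simp add: bij_betw_def)
  \<comment> \<open>The candidate inverse swaps the image of \<open>X\<close> under
    \<open>h\<close>, written as a pullback along the inverse map so that the composition law
    applies and the swaps cancel.\<close>
  have "lift_map V ?k (pullback V ?k X) \<otimes>\<^bsub>Aut \<Gamma>\<^esub> f = compose {x. x div 2 \<in> V} (lift_map V ?k (pullback V ?k X)) f"
    using mult_Aut[OF lift_map_Aut[OF k] lift_map_Aut[OF f(2)]] f(1) by simp
  also have "\<dots> = lift_map V (?k \<circ> h) (sym_diff X (pullback V h (pullback V ?k X)))"
    unfolding f(1) using k f(2) by (rule lift_map_compose)
  also have "\<dots> = lift_map V id {}"
    using kh map_aut_in[OF f(2)] by (intro lift_map_cong) (simp_all add: pullback_def)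
  finally have "lift_map V ?k (pullback V ?k X) \<otimes>\<^bsub>Aut \<Gamma>\<^esub> f = \<one>\<^bsub>Aut \<Gamma>\<^esub>" by (simp add: lift_map_one)
  then have "inv\<^bsub>Aut \<Gamma>\<^esub> f = lift_map V ?k (pullback V ?k X)"
    using lift_map_Aut[OF k] lift_map_Aut[OF f(2)] f(1) by (intro group.inv_equality[OF group_Aut]) simp_all
  moreover have "lift_map V ?k (pullback V ?k X) \<in> lift_group V nb rv tw"
  proof (rule lift_groupI[OF k f(3)])
    show "pullback V ?k X \<subseteq> V" by (auto simp: pullback_def)
    fix v assume v: "v \<in> V"
    show "defect nb (pullback V ?k X) v = (tw \<and> \<sigma>)"
      unfolding defect_pullback[OF k v] using f(5) map_aut_in[OF k v] by blast
  qed
  ultimately show "inv\<^bsub>Aut \<Gamma>\<^esub> f \<in> lift_group V nb rv tw" by simp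
qed

text \<open>An automorphism below matches the base vertices; an eigenvector with prescribed values
  at both ends of the arc then matches the two parity bits independently.\<close>

lemma lift_group_arc_transitive: "arc_transitive \<Gamma> (lift_group V nb rv tw)"
  unfolding arc_transitive_def
proof (intro conjI lift_group_subgroup ballI, clarify)
  fix x y x' y' assume "(x, y) \<in> parcs \<Gamma>" "(x', y') \<in> parcs \<Gamma>"
  then obtain k l where x: "x div 2 \<in> V" "k < 3" "y div 2 = nb (x div 2) k"
    and x': "x' div 2 \<in> V" "l < 3" "y' div 2 = nb (x' div 2) l"
    unfolding parcs_doubled by blast
  obtain h where h: "map_aut V nb False h" "h (x div 2) = x' div 2" "h (y div 2) = y' div 2"
    using map_aut_arc_transitive[OF x(1,2) x'(1,2)] x(3) x'(3) by auto
  obtain X where X: "X \<in> eigenspace V nb" "(x div 2 \<in> X) = (odd x \<noteq> odd x')" "(y div 2 \<in> X) = (odd y \<noteq> odd y')"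
    using eigenspace_arc[OF x(1,2), of "odd x \<noteq> odd x'" "odd y \<noteq> odd y'"] x(3) by auto
  have y: "y div 2 \<in> V" using nb_in[OF x(1,2)] x(3) by simp
  have "lift_map V h X \<in> lift_group V nb rv tw"
    using X(1) by (intro lift_groupI[OF h(1)]) (simp_all add: eigenspace_def)
  moreover have "lift_map V h X x = x'"
    by (rule nat_half_eqI) (use h(2) X(2) lift_map_div[OF x(1)] lift_map_odd[OF x(1)] in auto)
  moreover have "lift_map V h X y = y'"
    by (rule nat_half_eqI) (use h(3) X(3) lift_map_div[OF y] lift_map_odd[OF y] in auto)
  ultimately show "\<exists>g\<in>lift_group V nb rv tw. g x = x' \<and> g y = y'" by blast
qed

section \<open>Connectedness, local action and arc stabilisers of the doubled graph\<close>

lemma pair_graph_doubled: "pair_graph \<Gamma>"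
proof
  fix e assume "e \<in> parcs \<Gamma>"
  then obtain x y where e: "e = (x, y)" "(x, y) \<in> parcs \<Gamma>" by (cases e) auto
  then obtain k where k: "x div 2 \<in> V" "k < 3" "y div 2 = nb (x div 2) k" unfolding parcs_doubled by blast
  show "fst e \<in> pverts \<Gamma>" using e k by simp
  show "snd e \<in> pverts \<Gamma>" using e k nb_in by simp
  show "fst e \<noteq> snd e" using e k nb_irrefl[OF k(1,2)] by auto
next
  show "finite (pverts \<Gamma>)" using finite_halves[OF finite_V] by simp
  have "parcs \<Gamma> \<subseteq> pverts \<Gamma> \<times> pverts \<Gamma>"
  proof clarify
    fix x y assume "(x, y) \<in> parcs \<Gamma>"
    then obtain k where "x div 2 \<in> V" "k < 3" "y div 2 = nb (x div 2) k" unfolding parcs_doubled by blast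
    then show "x \<in> pverts \<Gamma> \<and> y \<in> pverts \<Gamma>" using nb_in by simp
  qed
  then show "finite (parcs \<Gamma>)" using finite_halves[OF finite_V] by (auto intro: finite_subset)
next
  have "sym (parcs \<Gamma>)"
  proof (rule symI)
    fix x y assume "(x, y) \<in> parcs \<Gamma>"
    then obtain k where "x div 2 \<in> V" "k < 3" "y div 2 = nb (x div 2) k" unfolding parcs_doubled by blast
    then show "(y, x) \<in> parcs \<Gamma>" using nb_in nb_sym unfolding parcs_doubled by metis
  qed
  then show "symmetric (with_proj \<Gamma>)" by (simp add: symmetric_def)
qed

text \<open>Lifting a path reaches some vertex over every base vertex. Both vertices over a base
  vertex are adjacent to whichever vertex was reached over a neighbour, so both are reached.\<close>

lemma doubled_connected: "Digraph_Component.connected (with_proj \<Gamma>)"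
proof -
  interpret pair_graph \<Gamma> by (rule pair_graph_doubled)
  have wf: "wf_digraph (with_proj \<Gamma>)" by unfold_locales
  have arc: "x \<rightarrow>\<^bsub>with_proj \<Gamma>\<^esub> y" if "x div 2 \<in> V" "k < 3" "y div 2 = nb (x div 2) k" for x y k
    using that by (auto simp: parcs_doubled)
  have from_base: "\<exists>x. x div 2 = v \<and> (2 * v0) \<rightarrow>\<^sup>*\<^bsub>with_proj \<Gamma>\<^esub> x" if "v \<in> V" for v
    using connected[OF that]
  proof (induction rule: rtranclp_induct)
    case base
    have "2 * v0 \<in> verts (with_proj \<Gamma>)" using cubic_map.base[OF cubic_map_axioms] by simp
    then have "(2 * v0) \<rightarrow>\<^sup>*\<^bsub>with_proj \<Gamma>\<^esub> (2 * v0)" unfolding reachable_def by (rule rtrancl_on_refl)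
    then show ?case by (intro exI[of _ "2 * v0"]) simp
  next
    case (step u w)
    then obtain x k where x: "x div 2 = u" "(2 * v0) \<rightarrow>\<^sup>*\<^bsub>with_proj \<Gamma>\<^esub> x" and k: "k < 3" "w = nb u k" by blast
    have "x \<in> verts (with_proj \<Gamma>)" using x(2) by (rule reachable_in_vertsE)
    then have "x \<rightarrow>\<^bsub>with_proj \<Gamma>\<^esub> (2 * w)" using x(1) k by (intro arc[of _ k]) simp_all
    with x(2) have "(2 * v0) \<rightarrow>\<^sup>*\<^bsub>with_proj \<Gamma>\<^esub> (2 * w)" by (rule wf_digraph.reachable_adj_trans[OF wf])
    then show ?case by (intro exI[of _ "2 * w"]) simp
  qed
  have reach: "(2 * v0) \<rightarrow>\<^sup>*\<^bsub>with_proj \<Gamma>\<^esub> y" if y: "y div 2 \<in> V" for y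
  proof -
    have z: "nb (y div 2) 0 \<in> V" using nb_in[OF y] by simp
    obtain x where x: "x div 2 = nb (y div 2) 0" "(2 * v0) \<rightarrow>\<^sup>*\<^bsub>with_proj \<Gamma>\<^esub> x" using from_base[OF z] by blast
    obtain l where "l < 3" "nb (nb (y div 2) 0) l = y div 2" using nb_sym[OF y, of 0] by auto
    then have "x \<rightarrow>\<^bsub>with_proj \<Gamma>\<^esub> y" using x(1) z by (intro arc[of _ l]) simp_all
    with x(2) show ?thesis by (rule wf_digraph.reachable_adj_trans[OF wf])
  qed
  have sym: "symmetric (with_proj \<Gamma>)" by (rule pair_sym_arcs)
  have "x \<rightarrow>\<^sup>*\<^bsub>with_proj \<Gamma>\<^esub> y" if "x div 2 \<in> V" "y div 2 \<in> V" for x y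
    using symmetric_reachable[OF sym reach[OF that(1)]] reach[OF that(2)] by (rule wf_digraph.reachable_trans[OF wf])
  then show ?thesis
    unfolding Digraph_Component.connected_def strongly_connected_def
    using wf_digraph.reachable_mk_symmetric_eq[OF wf sym] base by (auto intro: exI[of _ "2 * v0"])
qed

text \<open>Fixing \<open>x\<close> means that \<open>h\<close> fixes \<open>v\<close> and
  \<open>v\<close> lies outside \<open>X\<close>. The defect at \<open>v\<close> is then the parity
  of the number of swapped pairs around \<open>v\<close>, which is the condition in
  \<open>local_group\<close>; \<open>map_aut_local\<close> and \<open>defect_local\<close> realise
  every admissible choice.\<close>

lemma doubled_local_action:
  assumes x: "x div 2 \<in> V"
  shows "perm_isomorphic ({..<3} \<times> UNIV, local_group rv tw) (local_action \<Gamma> (lift_group V nb rv tw) x)"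
proof -
  define v where "v = x div 2"
  have v: "v \<in> V" using x by (simp add: v_def)
  let ?\<Delta> = "{..<3} \<times> UNIV :: (nat \<times> bool) set"
  define N where "N = neighbourhood \<Gamma> x"
  define b where "b = (\<lambda>(k, i). 2 * nb v k + of_bool i :: nat)"
  have N: "y \<in> N \<longleftrightarrow> (\<exists>k<3. y div 2 = nb v k)" for y
    using v by (simp add: N_def neighbourhood_def parcs_doubled v_def)
  have b: "b (k, i) div 2 = nb v k" "odd (b (k, i)) = i" for k i
    unfolding b_def prod.case by (rule double_of_bool_div, rule double_of_bool_odd)
  have bij: "bij_betw b ?\<Delta> N"
    unfolding bij_betw_def
  proof
    show "inj_on b ?\<Delta>"
    proof (rule inj_onI, clarify)
      fix k l i j assume kl: "k < (3::nat)" "l < (3::nat)" and eq: "b (k, i) = b (l, j)"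
      have "nb v k = nb v l" using b(1)[of k i] b(1)[of l j] eq by simp
      moreover have "i = j" using b(2)[of k i] b(2)[of l j] eq by simp
      ultimately show "k = l \<and> i = j" using nb_inj[OF v kl] by simp
    qed
    show "b ` ?\<Delta> = N"
    proof (intro equalityI subsetI)
      fix y assume "y \<in> b ` ?\<Delta>"
      then show "y \<in> N" using N b(1) by auto
    next
      fix y assume "y \<in> N"
      then obtain k where k: "k < 3" "y div 2 = nb v k" using N by blast
      have "y = b (k, odd y)" by (rule nat_half_eqI) (use b k in auto)
      then show "y \<in> b ` ?\<Delta>" using k(1) by blast
    qed
  qed
  have conj: "restrict (lift_map V h X) N = conj_map ?\<Delta> N b (local_perm c \<sigma> (\<lambda>k. nb v k \<in> X))"
    if h: "\<And>k. k < 3 \<Longrightarrow> h (nb v k) = nb v (turn c \<sigma> k)" for h X c \<sigma>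
  proof (rule extensional_eqI[of _ N])
    fix y assume y: "y \<in> N"
    then obtain k i where ki: "k < 3" "y = b (k, i)" using bij by (auto simp: bij_betw_def)
    have yb: "y div 2 = nb v k" "odd y = i" using ki(2) b by simp_all
    have yV: "y div 2 \<in> V" unfolding yb(1) using v ki(1) by (rule nb_in)
    have "conj_map ?\<Delta> N b (local_perm c \<sigma> (\<lambda>k. nb v k \<in> X)) y = b (turn c \<sigma> k, i \<noteq> (nb v k \<in> X))"
      unfolding ki(2) using conj_map_apply[OF bij, of "(k, i)"] ki(1) by (simp add: local_perm_def)
    moreover have "lift_map V h X y = b (turn c \<sigma> k, i \<noteq> (nb v k \<in> X))"
      by (rule nat_half_eqI)
        (simp_all only: lift_map_div[OF yV] lift_map_odd[OF yV] b yb h[OF ki(1)])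
    ultimately show "restrict (lift_map V h X) N y
        = conj_map ?\<Delta> N b (local_perm c \<sigma> (\<lambda>k. nb v k \<in> X)) y" using y by simp
  qed (simp_all add: conj_map_def)
  have "(\<lambda>g. restrict g N) ` vertex_stabiliser (lift_group V nb rv tw) x
      = conj_map ?\<Delta> N b ` local_group rv tw"
  proof (intro equalityI subsetI)
    fix f assume "f \<in> (\<lambda>g. restrict g N) ` vertex_stabiliser (lift_group V nb rv tw) x"
    then obtain g where g: "g \<in> lift_group V nb rv tw" "g x = x" "f = restrict g N"
      by (auto simp: vertex_stabiliser_def)
    obtain h X \<sigma> where h: "g = lift_map V h X" "map_aut V nb \<sigma> h" "\<sigma> \<longrightarrow> rv" "X \<subseteq> V"
      "\<forall>v\<in>V. defect nb X v = (tw \<and> \<sigma>)" using g(1) by (rule lift_groupE)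
    have hv: "h v = v" using lift_map_div[OF x, of h X] g(2) h(1) by (simp add: v_def)
    have vX: "v \<notin> X" using lift_map_odd[OF x, of h X] g(2) h(1) by (auto simp: v_def)
    obtain c where c: "c < 3" "\<And>k. k < 3 \<Longrightarrow> h (nb v k) = nb v (turn c \<sigma> k)"
      using map_aut_turn[OF h(2) v] unfolding hv by blast
    have "f = conj_map ?\<Delta> N b (local_perm c \<sigma> (\<lambda>k. nb v k \<in> X))"
      unfolding g(3) h(1) by (rule conj) (rule c(2))
    moreover have "local_perm c \<sigma> (\<lambda>k. nb v k \<in> X) \<in> local_group rv tw"
    proof (rule local_groupI[OF c(1) h(3)])
      have "defect nb X v = (tw \<and> \<sigma>)" using h(5) v by blast
      then show "((nb v 0 \<in> X) \<noteq> ((nb v 1 \<in> X) \<noteq> (nb v 2 \<in> X))) = (tw \<and> \<sigma>)"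
        using vX unfolding defect_def by argo
    qed
    ultimately show "f \<in> conj_map ?\<Delta> N b ` local_group rv tw" by (rule image_eqI)
  next
    fix f assume "f \<in> conj_map ?\<Delta> N b ` local_group rv tw"
    then obtain q where q: "f = conj_map ?\<Delta> N b q" "q \<in> local_group rv tw" by (rule imageE)
    obtain c \<sigma> p where p: "q = local_perm c \<sigma> p" "c < 3" "\<sigma> \<longrightarrow> rv" "(p 0 \<noteq> (p 1 \<noteq> p 2)) = (tw \<and> \<sigma>)"
      using q(2) unfolding local_group_def mem_Collect_eq by (elim exE conjE)
    obtain h where h: "map_aut V nb \<sigma> h" "h v = v" "\<And>k. k < 3 \<Longrightarrow> h (nb v k) = nb v (turn c \<sigma> k)"
      using map_aut_local[OF v p(2)] by blast
    obtain X where X: "X \<subseteq> V" "\<And>u. u \<in> V \<Longrightarrow> defect nb X u = (tw \<and> \<sigma>)"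
      "\<And>k. k < 3 \<Longrightarrow> nb v k \<in> X \<longleftrightarrow> p k"
      using defect_local[OF v, of "tw \<and> \<sigma>" p] by blast
    \<comment> \<open>The defect at \<open>v\<close> equals the parity of the pattern
      \<open>p\<close>, which leaves no contribution from \<open>v\<close> itself.\<close>
    have vX: "v \<notin> X"
      using X(2)[OF v] p(4) X(3)[of 0] X(3)[of 1] X(3)[of 2] unfolding defect_def by auto
    have "q = local_perm c \<sigma> (\<lambda>k. nb v k \<in> X)"
      unfolding p(1) local_perm_def using X(3) by (intro restrict_ext) auto
    then have "f = restrict (lift_map V h X) N"
      unfolding q(1) using conj[of h c \<sigma> X, OF h(3)] by simp
    moreover have "lift_map V h X \<in> lift_group V nb rv tw"
      using h(1) p(3) X(1,2) by (rule lift_groupI)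
    moreover have "lift_map V h X x = x"
      by (rule nat_half_eqI)
        (use lift_map_div[OF x, of h X] lift_map_odd[OF x, of h X] h(2) vX in \<open>auto simp: v_def\<close>)
    ultimately show "f \<in> (\<lambda>g. restrict g N) ` vertex_stabiliser (lift_group V nb rv tw) x"
      unfolding vertex_stabiliser_def by blast
  qed
  moreover have "local_group rv tw \<subseteq> Bij ?\<Delta>"
    unfolding local_group_def using local_perm_Bij by blast
  ultimately show ?thesis
    unfolding local_action_def N_def[symmetric] using bij by (intro perm_isomorphic_conj) simp_all
qed

lemma doubled_locally_pair:
  assumes "perm_isomorphic L ({..<3} \<times> UNIV, local_group rv tw)"
  shows "locally_pair L \<Gamma> (lift_group V nb rv tw)"
  unfolding locally_pair_def
  using pair_graph_doubled doubled_connected lift_group_arc_transitive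
    perm_isomorphic_trans[OF assms doubled_local_action] by simp

text \<open>The eigenvectors vanishing at both ends of an arc have index at most 4 in the
  eigenspace, and they act faithfully by swaps fixing the arc.\<close>

lemma card_eigenspace_le:
  assumes "(x, y) \<in> parcs \<Gamma>"
  shows "card (eigenspace V nb) \<le> 4 * card (arc_stabiliser (lift_group V nb rv tw) x y)"
proof -
  obtain k where x: "x div 2 \<in> V" and k: "k < 3" "y div 2 = nb (x div 2) k"
    using assms unfolding parcs_doubled by blast
  have y: "y div 2 \<in> V" using nb_in[OF x k(1)] k(2) by simp
  define E where "E = {X \<in> eigenspace V nb. x div 2 \<notin> X \<and> y div 2 \<notin> X}"
  have finE: "finite (eigenspace V nb)"
    using finite_V by (auto simp: eigenspace_def intro: finite_subset[of _ "Pow V"])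
  have "\<forall>s t. \<exists>X\<in>eigenspace V nb. (x div 2 \<in> X) = s \<and> (y div 2 \<in> X) = t"
    using eigenspace_arc[OF x k(1)] k(2) by simp
  then obtain Z where Z: "\<And>s t. Z s t \<in> eigenspace V nb" "\<And>s t. (x div 2 \<in> Z s t) = s"
    "\<And>s t. (y div 2 \<in> Z s t) = t" by metis
  \<comment> \<open>\<open>Z s t\<close> represents the class with values \<open>s\<close> and
    \<open>t\<close> at the two ends; adding it moves \<open>X\<close> into \<open>E\<close>, and
    the two recorded bits allow \<open>X\<close> to be recovered.\<close>
  define \<phi> where "\<phi> = (\<lambda>X. (sym_diff X (Z (x div 2 \<in> X) (y div 2 \<in> X)), x div 2 \<in> X, y div 2 \<in> X))"
  have "inj_on \<phi> (eigenspace V nb)"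
  proof (rule inj_onI)
    fix X Y assume eq: "\<phi> X = \<phi> Y"
    have s: "(x div 2 \<in> X) = (x div 2 \<in> Y)" and t: "(y div 2 \<in> X) = (y div 2 \<in> Y)"
      using eq unfolding \<phi>_def prod.inject by blast+
    have "sym_diff X (Z (x div 2 \<in> X) (y div 2 \<in> X)) = sym_diff Y (Z (x div 2 \<in> Y) (y div 2 \<in> Y))"
      using eq unfolding \<phi>_def prod.inject by (rule conjunct1)
    then show "X = Y" unfolding s t by blast
  qed
  moreover have "\<phi> ` eigenspace V nb \<subseteq> E \<times> UNIV \<times> UNIV"
  proof (rule image_subsetI)
    fix X assume X: "X \<in> eigenspace V nb"
    have "sym_diff X (Z (x div 2 \<in> X) (y div 2 \<in> X)) \<in> E"
      unfolding E_def mem_Collect_eq mem_sym_diff Z(2,3) using sym_diff_eigenspace[OF X Z(1)] by simp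
    then show "\<phi> X \<in> E \<times> UNIV \<times> UNIV" unfolding \<phi>_def by simp
  qed
  ultimately have "card (eigenspace V nb) \<le> card (E \<times> (UNIV :: bool set) \<times> (UNIV :: bool set))"
    using finE by (intro card_inj_on_le) (auto simp: E_def)
  also have "\<dots> = 4 * card E"
    by (simp only: card_cartesian_product card_UNIV_bool)
  also have "card E \<le> card (arc_stabiliser (lift_group V nb rv tw) x y)"
  proof (rule card_inj_on_le)
    show "inj_on (lift_map V id) E"
    proof (rule inj_onI)
      fix X Y assume XY: "X \<in> E" "Y \<in> E" and eq: "lift_map V id X = lift_map V id Y"
      have "v \<in> X \<longleftrightarrow> v \<in> Y" if v: "v \<in> V" for v
        using lift_map_odd[of "2 * v" V id X] lift_map_odd[of "2 * v" V id Y] v eq by simp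
      moreover have "X \<subseteq> V" "Y \<subseteq> V" using XY by (simp_all add: E_def eigenspace_def)
      ultimately show "X = Y" by blast
    qed
    show "lift_map V id ` E \<subseteq> arc_stabiliser (lift_group V nb rv tw) x y"
    proof
      fix g assume "g \<in> lift_map V id ` E"
      then obtain X where X: "X \<in> E" "g = lift_map V id X" by blast
      have "g \<in> lift_group V nb rv tw"
        unfolding X(2) using X(1) by (intro lift_groupI[OF map_aut_id]) (simp_all add: E_def eigenspace_def)
      moreover have "g x = x" unfolding X(2)
        by (rule nat_half_eqI) (use X(1) in \<open>simp_all add: lift_map_div[OF x] lift_map_odd[OF x] E_def\<close>)
      moreover have "g y = y" unfolding X(2)
        by (rule nat_half_eqI) (use X(1) in \<open>simp_all add: lift_map_div[OF y] lift_map_odd[OF y] E_def\<close>)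
      ultimately show "g \<in> arc_stabiliser (lift_group V nb rv tw) x y"
        by (simp add: arc_stabiliser_def)
    qed
    have "arc_stabiliser (lift_group V nb rv tw) x y \<subseteq> {x. x div 2 \<in> V} \<rightarrow>\<^sub>E {x. x div 2 \<in> V}"
    proof
      fix g assume "g \<in> arc_stabiliser (lift_group V nb rv tw) x y"
      then have "g \<in> Bij {x. x div 2 \<in> V}"
        by (auto simp: arc_stabiliser_def elim!: lift_groupE intro: lift_map_Bij)
      then show "g \<in> {x. x div 2 \<in> V} \<rightarrow>\<^sub>E {x. x div 2 \<in> V}"
        using Bij_imp_funcset Bij_imp_extensional by (metis IntI PiE_def)
    qed
    then show "finite (arc_stabiliser (lift_group V nb rv tw) x y)"
      using finite_halves[OF finite_V] by (auto intro: finite_subset finite_PiE)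
  qed
  finally show ?thesis by simp
qed

end

section \<open>Abelian covers of the Moebius-Kantor graph\<close>

type_synonym vec = "int \<times> int \<times> int \<times> int"

text \<open>The vertices of the Moebius-Kantor graph are numbered in breadth-first order, the coordinates over
  each of them are shifted so that the edges of the spanning tree have voltage 0, and the basis of the
  lattice generated by the voltages of the closed walks is chosen among the remaining edges.\<close>

definition mk_nb :: "nat list list" where
  "mk_nb = [[1, 2, 3], [0, 4, 5], [6, 0, 7], [0, 8, 9], [10, 11, 1], [12, 13, 1], [2, 14, 13], [2, 10, 12],
    [14, 3, 10], [13, 3, 11], [4, 7, 8], [15, 9, 4], [5, 7, 15], [9, 5, 6], [8, 15, 6], [11, 12, 14]]"

definition mk_voltage :: "vec list list" where
  "mk_voltage = [[(0, 0, 0, 0), (0, 0, 0, 0), (0, 0, 0, 0)], [(0, 0, 0, 0), (0, 0, 0, 0), (0, 0, 0, 0)],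
    [(0, 0, 0, 0), (0, 0, 0, 0), (0, 0, 0, 0)], [(0, 0, 0, 0), (0, 0, 0, 0), (0, 0, 0, 0)],
    [(0, 0, 0, 0), (0, 0, 0, 0), (0, 0, 0, 0)], [(0, 0, 0, 0), (0, 0, 0, 0), (0, 0, 0, 0)],
    [(0, 0, 0, 0), (0, 0, 0, 0), (1, 0, 0, 0)], [(0, 0, 0, 0), (0, 1, 0, 0), (0, 0, -1, 1)],
    [(0, 0, 1, 0), (0, 0, 0, 0), (1, 0, 1, 0)], [(1, -1, 0, 1), (0, 0, 0, 0), (0, 0, 0, 1)],
    [(0, 0, 0, 0), (0, -1, 0, 0), (-1, 0, -1, 0)], [(0, 0, 0, 0), (0, 0, 0, -1), (0, 0, 0, 0)],
    [(0, 0, 0, 0), (0, 0, 1, -1), (0, 0, 1, 0)], [(-1, 1, 0, -1), (0, 0, 0, 0), (-1, 0, 0, 0)],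
    [(0, 0, -1, 0), (0, 0, 0, 0), (0, 0, 0, 0)], [(0, 0, 0, 0), (0, 0, -1, 0), (0, 0, 0, 0)]]"

text \<open>The eigenvector of finite support, found by linear algebra in a ball of the cover:
  \<open>mk_kernel ! t\<close> lists the points of the support over the vertex \<open>t\<close>.\<close>

definition mk_kernel :: "vec list list" where
  "mk_kernel = [[(0, 0, 0, 0), (0, 1, 1, -1), (-1, 1, 0, 0), (-1, 0, -1, 1)],
    [(0, 0, 0, 0), (0, 1, 0, -1), (-1, 1, -1, 0), (-1, 0, -1, 1)],
    [(0, 0, 0, 0), (-1, 0, -1, 0), (0, 1, 1, -1), (-1, 1, 0, -1)],
    [(0, 0, 0, 0), (-1, 0, -1, 0), (-1, 1, 0, -1), (0, 1, 0, -1), (-1, 1, -1, 0), (-1, 1, 0, 0)],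
    [(0, 0, 0, 0), (0, 1, 0, 0), (0, 0, 0, 1), (0, 1, 1, -1), (-1, 1, 0, 0), (-1, 1, -1, 0)],
    [(0, 0, 0, 0), (0, 1, 0, 0), (0, 0, 0, 1), (0, 1, 0, -1)],
    [(0, 0, 0, 0), (-1, 0, 0, 0), (0, 0, 1, 0), (-1, 1, 0, 0), (-1, 0, -1, 1), (-1, 1, 0, -1)],
    [(0, 0, 0, 0), (-1, 0, 0, 0), (0, 0, 1, 0), (-1, 0, -1, 0)],
    [(-1, 0, -1, 0), (-1, 1, -1, 0), (-1, 0, -1, 1), (-1, 1, -1, -1)],
    [(-1, 1, 0, -1), (0, 1, 0, -1), (0, 1, 1, -1), (-1, 1, -1, -1)],
    [(0, 1, 0, 0), (0, 1, 1, -1), (0, 1, 1, 0), (0, 1, 0, -1)],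
    [(-1, 1, 0, 0), (0, 0, 0, 1), (0, 1, 1, 0), (-1, 0, -1, 1)],
    [(0, 0, 0, 0), (0, 0, -1, 1), (0, 0, -1, 0), (-1, 1, -1, 0), (-1, 0, -1, 1), (0, 1, 0, 0)],
    [(0, 0, 0, 0), (0, 0, -1, 1), (0, 0, 0, 1), (0, 0, -1, 0)],
    [(-1, 1, 0, 0), (0, 0, 1, 0), (-1, 0, 0, 1), (0, 1, 1, -1)],
    [(0, 0, 0, 0), (-1, 1, 0, 0), (-1, 0, -1, 1), (0, 1, 1, -1)]]"

text \<open>Vectors modulo \<open>m\<close> are represented by their canonical integer
  representatives in \<open>box m\<close>, so the fixed integral data serve every modulus.\<close>

definition red :: "int \<Rightarrow> vec \<Rightarrow> vec" where
  "red m = (\<lambda>(a, b, c, d). (a mod m, b mod m, c mod m, d mod m))"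

definition box :: "int \<Rightarrow> vec set" where
  "box m = {0..<m} \<times> {0..<m} \<times> {0..<m} \<times> {0..<m}"

definition cover_verts :: "int \<Rightarrow> (nat \<times> vec) set" where
  "cover_verts m = {..<16} \<times> box m"

text \<open>The derived graph of the voltage assignment, with voltages read modulo
  \<open>m\<close>.\<close>

definition cover_nb :: "int \<Rightarrow> nat \<times> vec \<Rightarrow> nat \<Rightarrow> nat \<times> vec" where
  "cover_nb m = (\<lambda>(t, z) k. (mk_nb ! t ! k, red m (z + mk_voltage ! t ! k)))"

fun scale :: "int \<Rightarrow> vec \<Rightarrow> vec" where
  "scale x (a, b, c, d) = (x * a, x * b, x * c, x * d)"

text \<open>\<open>L\<close> lists the images of the four unit vectors.\<close>

fun lin :: "vec list \<Rightarrow> vec \<Rightarrow> vec" where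
  "lin L (a, b, c, d) = scale a (L ! 0) + scale b (L ! 1) + scale c (L ! 2) + scale d (L ! 3)"

definition cover_map :: "int \<Rightarrow> nat list \<Rightarrow> vec list \<Rightarrow> vec list \<Rightarrow> nat \<times> vec \<Rightarrow> nat \<times> vec" where
  "cover_map m \<pi> L s = (\<lambda>(t, z). (\<pi> ! t, red m (lin L z + s ! t)))"

text \<open>The lifting criterion for automorphisms of a voltage graph: \<open>L\<close> carries the
  voltages of arcs to those of their images up to the coboundary of \<open>s\<close>. It is an
  integral condition independent of \<open>m\<close>; ranging over sets of lists makes it
  executable.\<close>

definition cover_aut_check :: "bool \<Rightarrow> nat list \<Rightarrow> vec list \<Rightarrow> vec list \<Rightarrow> bool" where
  "cover_aut_check \<sigma> \<pi> L s \<longleftrightarrow> length \<pi> = 16 \<and> distinct \<pi> \<and> list_all (\<lambda>t. t < 16) \<pi> \<and>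
     (\<forall>t\<in>set [0..<16]. \<exists>c\<in>set [0..<3]. \<forall>k\<in>set [0..<3].
        \<pi> ! (mk_nb ! t ! k) = mk_nb ! (\<pi> ! t) ! turn c \<sigma> k \<and>
        lin L (mk_voltage ! t ! k) + s ! (mk_nb ! t ! k) = s ! t + mk_voltage ! (\<pi> ! t) ! turn c \<sigma> k)"

section \<open>Arithmetic modulo \<open>m\<close> and lifting of automorphisms\<close>

lemma red_in_box: "m > 0 \<Longrightarrow> red m z \<in> box m"
  by (cases z) (simp add: red_def box_def)

lemma red_box: "z \<in> box m \<Longrightarrow> red m z = z"
  by (cases z) (auto simp: red_def box_def)

lemma red_red [simp]: "red m (red m z) = red m z"
  by (cases z) (simp add: red_def)

lemma red_add_cong: "red m x = red m x' \<Longrightarrow> red m y = red m y' \<Longrightarrow> red m (x + y) = red m (x' + y')"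
  by (cases x; cases x'; cases y; cases y') (simp add: red_def, intro conjI mod_add_cong; simp)

lemma red_diff_cong: "red m x = red m x' \<Longrightarrow> red m y = red m y' \<Longrightarrow> red m (x - y) = red m (x' - y')"
  by (cases x; cases x'; cases y; cases y') (simp add: red_def, intro conjI mod_diff_cong; simp)

lemma red_scale_cong: "x mod m = x' mod m \<Longrightarrow> red m (scale x y) = red m (scale x' y)"
  by (cases y) (simp add: red_def, intro conjI mod_mult_cong; simp)

lemma red_lin_cong: "red m z = red m z' \<Longrightarrow> red m (lin L z) = red m (lin L z')"
  by (cases z; cases z') (simp only: lin.simps red_def prod.case prod.inject,
      fold red_def, intro red_add_cong red_scale_cong; simp)

lemma scale_add: "scale (x + y) z = scale x z + scale y z"
  by (cases z) (simp add: algebra_simps)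

lemma lin_add: "lin L (x + y) = lin L x + lin L y"
  by (cases x; cases y) (simp add: scale_add algebra_simps)

lemma finite_box: "finite (box m)"
  by (simp add: box_def)

lemma card_box: "m \<ge> 0 \<Longrightarrow> card (box m) = nat m ^ 4"
  by (simp add: box_def card_cartesian_product numeral_eq_Suc)

text \<open>The base graph is simple and cubic, and opposite arcs carry opposite voltages, which
  makes the covers undirected.\<close>

lemma mk_nb_checks:
  "\<forall>t\<in>set [0..<16]. length (mk_nb ! t) = 3 \<and> distinct (mk_nb ! t) \<and> (\<forall>u\<in>set (mk_nb ! t). u < 16 \<and> u \<noteq> t)"
  "\<forall>t\<in>set [0..<16]. \<forall>k\<in>set [0..<3]. \<exists>l\<in>set [0..<3].
     mk_nb ! (mk_nb ! t ! k) ! l = t \<and> mk_voltage ! t ! k + mk_voltage ! (mk_nb ! t ! k) ! l = (0, 0, 0, 0)"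
  by code_simp+

lemma mk_nb_less: "t < 16 \<Longrightarrow> k < 3 \<Longrightarrow> mk_nb ! t ! k < 16"
  using mk_nb_checks(1) by (simp add: nth_mem)

text \<open>The coboundary condition makes the affine map commute with stepping to neighbours. Its
  linear part has an integral left inverse, so it stays injective modulo every \<open>m\<close>, and
  finiteness gives bijectivity.\<close>

lemma map_aut_cover_map:
  assumes m: "m > 0" and chk: "cover_aut_check \<sigma> \<pi> L s" and inv: "\<And>z. lin L' (lin L z) = z"
  shows "map_aut (cover_verts m) (cover_nb m) \<sigma> (cover_map m \<pi> L s)"
  unfolding map_aut_def
proof (intro conjI ballI)
  let ?h = "cover_map m \<pi> L s"
  have less: "\<pi> ! t < 16" if "t < 16" for t
    using chk that by (auto simp: cover_aut_check_def list_all_length)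
  have "inj_on ?h (cover_verts m)"
  proof (rule inj_onI)
    fix x y assume x: "x \<in> cover_verts m" and y: "y \<in> cover_verts m" and eq: "?h x = ?h y"
    obtain t z where tz: "x = (t, z)" "t < 16" "z \<in> box m" using x by (auto simp: cover_verts_def)
    obtain u w where uw: "y = (u, w)" "u < 16" "w \<in> box m" using y by (auto simp: cover_verts_def)
    have "\<pi> ! t = \<pi> ! u" using eq unfolding tz uw cover_map_def by simp
    then have tu: "t = u" using chk tz(2) uw(2) by (simp add: cover_aut_check_def nth_eq_iff_index_eq)
    have "red m (lin L z + s ! t) = red m (lin L w + s ! t)" using eq unfolding tz uw cover_map_def tu by simp
    then have "red m (lin L z + s ! t - s ! t) = red m (lin L w + s ! t - s ! t)"
      by (rule red_diff_cong) (rule refl)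
    then have "red m (lin L z) = red m (lin L w)" by simp
    then have "red m (lin L' (lin L z)) = red m (lin L' (lin L w))" by (rule red_lin_cong)
    then have "z = w" using tz(3) uw(3) by (simp add: inv red_box)
    then show "x = y" using tu tz(1) uw(1) by simp
  qed
  moreover have "?h ` cover_verts m \<subseteq> cover_verts m"
  proof (rule image_subsetI)
    fix x assume "x \<in> cover_verts m"
    then have "fst x < 16" by (auto simp: cover_verts_def)
    then show "?h x \<in> cover_verts m"
      using less[of "fst x"] red_in_box[OF m] by (simp add: cover_verts_def cover_map_def split_beta)
  qed
  moreover have "finite (cover_verts m)" by (simp add: cover_verts_def finite_box)
  ultimately show "bij_betw ?h (cover_verts m) (cover_verts m)"
    unfolding bij_betw_def using endo_inj_surj by blast
  fix v assume "v \<in> cover_verts m"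
  then obtain t z where v: "v = (t, z)" "t < 16" by (auto simp: cover_verts_def)
  have "t \<in> set [0..<16]" using v(2) by simp
  then obtain c where c: "c < 3" and ck: "\<And>k. k < 3 \<Longrightarrow> \<pi> ! (mk_nb ! t ! k) = mk_nb ! (\<pi> ! t) ! turn c \<sigma> k \<and>
      lin L (mk_voltage ! t ! k) + s ! (mk_nb ! t ! k) = s ! t + mk_voltage ! (\<pi> ! t) ! turn c \<sigma> k"
    using chk unfolding cover_aut_check_def by (metis atLeastLessThan_iff set_upt zero_le)
  have "?h (cover_nb m v k) = cover_nb m (?h v) (turn c \<sigma> k)" if k: "k < 3" for k
  proof -
    have "red m (lin L (red m (z + mk_voltage ! t ! k)) + s ! (mk_nb ! t ! k))
        = red m (lin L (z + mk_voltage ! t ! k) + s ! (mk_nb ! t ! k))"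
      by (intro red_add_cong red_lin_cong) simp_all
    also have "lin L (z + mk_voltage ! t ! k) + s ! (mk_nb ! t ! k)
        = (lin L z + s ! t) + mk_voltage ! (\<pi> ! t) ! turn c \<sigma> k"
      using ck[OF k] by (simp only: lin_add add.assoc)
    also have "red m \<dots> = red m (red m (lin L z + s ! t) + mk_voltage ! (\<pi> ! t) ! turn c \<sigma> k)"
      by (intro red_add_cong) simp_all
    finally show ?thesis using ck[OF k] by (simp add: v(1) cover_nb_def cover_map_def)
  qed
  then show "\<exists>c<3. \<forall>k<3. ?h (cover_nb m v k) = cover_nb m (?h v) (turn c \<sigma> k)" using c by blast
qed

text \<open>Lifts of three automorphisms of the base graph: a rotation of order 3 about vertex 0, an
  involution exchanging 0 and 1, whose lift has zero shift, and a reflection fixing 0 and 1.\<close>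

definition "rot_perm = [0, 2, 3, 1, 7, 6, 9, 8, 4, 5, 10, 12, 14, 13, 11, 15]"
definition "rot_mat = ([(0, -1, 0, 1), (1, -1, 1, 0), (0, 0, 0, -1), (0, 0, 1, -1)] :: vec list)"
definition "rot_shift = ([(0, 0, 0, 0), (0, 0, 0, 0), (0, 0, 0, 0), (0, 0, 0, 0), (0, 0, 0, 0), (0, 0, 0, 0), (0, 0, 0, 0), (0, 0, 0, 0),
    (0, 0, 0, 0), (0, 0, 0, 0), (0, 1, 0, 0), (0, 0, -1, 1), (0, 0, 0, 0), (1, 0, 0, 0), (0, 0, 0, 1), (0, 0, 0, 1)] :: vec list)"
definition "inv_perm = [1, 0, 4, 5, 2, 3, 11, 10, 12, 13, 7, 6, 8, 9, 15, 14]"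
definition "inv_mat = ([(0, 0, 0, -1), (0, -1, 0, 0), (0, 0, 1, 0), (-1, 0, 0, 0)] :: vec list)"
definition "refl_perm = [0, 1, 3, 2, 5, 4, 8, 9, 6, 7, 13, 12, 11, 10, 14, 15]"
definition "refl_mat = ([(1, 0, 1, 0), (1, -1, 0, 1), (0, 0, -1, 0), (0, 0, -1, 1)] :: vec list)"
definition "refl_shift = ([(0, 0, 0, 0), (0, 0, 0, 0), (0, 0, 0, 0), (0, 0, 0, 0), (0, 0, 0, 0), (0, 0, 0, 0), (0, 0, 0, 0), (0, 0, 0, 0),
    (0, 0, 0, 0), (0, 0, 0, 0), (0, 0, 0, 0), (0, 0, 0, 0), (0, 0, 0, 0), (0, 0, 0, 0), (0, 0, 1, 0), (0, 0, 1, 0)] :: vec list)"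

lemma cover_aut_checks:
  "cover_aut_check False rot_perm rot_mat rot_shift"
  "cover_aut_check False inv_perm inv_mat (replicate 16 (0, 0, 0, 0))"
  "cover_aut_check True refl_perm refl_mat refl_shift"
  by code_simp+

text \<open>The inversion and reflection matrices are involutions; the rotation has the integral
  inverse given explicitly.\<close>

lemma lin_inverses:
  "lin [(-1, 1, 0, -1), (-1, 0, -1, 0), (0, 0, -1, 1), (0, 0, -1, 0)] (lin rot_mat z) = z"
  "lin inv_mat (lin inv_mat z) = z"
  "lin refl_mat (lin refl_mat z) = z"
  by (cases z, simp add: rot_mat_def inv_mat_def refl_mat_def)+

section \<open>Walks in the integral cover and connectedness\<close>

fun walk :: "nat list \<Rightarrow> nat \<Rightarrow> vec \<Rightarrow> nat \<times> vec" where
  "walk [] t z = (t, z)"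
| "walk (k # ks) t z = walk ks (mk_nb ! t ! k) (z + mk_voltage ! t ! k)"

abbreviation cover_step :: "int \<Rightarrow> nat \<times> vec \<Rightarrow> nat \<times> vec \<Rightarrow> bool" where
  "cover_step m \<equiv> \<lambda>u w. \<exists>k<3. w = cover_nb m u k"

lemma walk_add: "walk ks t (z + w) = (fst (walk ks t z), snd (walk ks t z) + w)"
  by (induction ks arbitrary: t z) (simp_all add: add.assoc add.commute[of w], simp add: add.assoc[symmetric])

lemma walk_reach:
  assumes "list_all (\<lambda>k. k < 3) ks"
  shows "(cover_step m)\<^sup>*\<^sup>* (t, red m z) (fst (walk ks t z), red m (snd (walk ks t z)))"
  using assms
proof (induction ks arbitrary: t z)
  case (Cons k ks)
  have "red m (red m z + mk_voltage ! t ! k) = red m (z + mk_voltage ! t ! k)"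
    by (intro red_add_cong) simp_all
  then have "cover_step m (t, red m z) (mk_nb ! t ! k, red m (z + mk_voltage ! t ! k))"
    using Cons.prems by (intro exI[of _ k]) (simp add: cover_nb_def)
  then show ?case using Cons.IH[of "mk_nb ! t ! k" "z + mk_voltage ! t ! k"] Cons.prems
    by (simp add: converse_rtranclp_into_rtranclp)
qed simp

lemma walk_reach_from:
  assumes "list_all (\<lambda>k. k < 3) ks" "walk ks t 0 = (u, w)"
  shows "(cover_step m)\<^sup>*\<^sup>* (t, red m z) (u, red m (z + w))"
  using walk_reach[OF assms(1), of m t z] walk_add[of ks t 0 z] assms(2) by (simp add: add.commute)

text \<open>Closed walks at vertex 0 whose net voltages are the four unit vectors: the voltages of
  closed walks generate the whole lattice.\<close>

lemma walk_loops:
  "walk [1, 0, 2, 1, 2, 0] 0 0 = (0, 1, 0, 0, 0)"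
  "walk [1, 2, 1, 0, 2, 0] 0 0 = (0, 0, 1, 0, 0)"
  "walk [2, 1, 0, 2, 0, 1] 0 0 = (0, 0, 0, 1, 0)"
  "walk [2, 2, 2, 2, 2, 0] 0 0 = (0, 0, 0, 0, 1)"
  by code_simp+

text \<open>Every base vertex is reached from 0 along a path of net voltage zero.\<close>

lemma walk_paths:
  "\<forall>t\<in>set [0..<16]. \<exists>ks\<in>set [[], [0], [1], [2], [0, 1], [0, 2], [1, 0], [1, 2],
    [2, 1], [2, 2], [0, 1, 0], [0, 1, 1], [0, 2, 0], [0, 2, 1], [1, 0, 1], [0, 1, 1, 0]].
    list_all (\<lambda>k. k < 3) ks \<and> walk ks 0 0 = (t, 0)"
  by code_simp

lemma loop_reach:
  assumes "list_all (\<lambda>k. k < 3) ks" "walk ks 0 0 = (0, e)"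
  shows "(cover_step m)\<^sup>*\<^sup>* (0, red m z) (0, red m (z + scale (int n) e))"
proof (induction n)
  case 0
  have "scale 0 e = 0" by (cases e) (simp add: zero_prod_def)
  then show ?case by simp
next
  case (Suc n)
  have "scale (int (Suc n)) e = scale (int n) e + e" by (cases e) (simp add: algebra_simps)
  then show ?case
    using Suc walk_reach_from[OF assms, of m "z + scale (int n) e"] by (simp add: add.assoc)
qed

text \<open>Running round the four loops as often as the coordinates demand reaches the right vector
  over 0; a path of voltage zero then changes the base vertex.\<close>

lemma cover_connected:
  assumes m: "m > 0" and v: "v \<in> cover_verts m"
  shows "(cover_step m)\<^sup>*\<^sup>* (0, 0) v"
proof -
  obtain t a b c d where v: "v = (t, a, b, c, d)" "t < 16" "a \<ge> 0" "b \<ge> 0" "c \<ge> 0" "d \<ge> 0"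
    and z: "(a, b, c, d) \<in> box m"
    using v by (auto simp: cover_verts_def box_def)
  let ?r = "(cover_step m)\<^sup>*\<^sup>*"
  have r0: "red m 0 = 0" by (simp add: red_def zero_prod_def)
  let ?a = "scale (int (nat a)) (1, 0, 0, 0)" and ?b = "scale (int (nat b)) (0, 1, 0, 0)"
    and ?c = "scale (int (nat c)) (0, 0, 1, 0)" and ?d = "scale (int (nat d)) (0, 0, 0, 1)"
  have s1: "?r (0, red m 0) (0, red m (0 + ?a))" by (rule loop_reach[OF _ walk_loops(1)]) simp
  have s2: "?r (0, red m (0 + ?a)) (0, red m (0 + ?a + ?b))" by (rule loop_reach[OF _ walk_loops(2)]) simp
  have s3: "?r (0, red m (0 + ?a + ?b)) (0, red m (0 + ?a + ?b + ?c))"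
    by (rule loop_reach[OF _ walk_loops(3)]) simp
  have s4: "?r (0, red m (0 + ?a + ?b + ?c)) (0, red m (0 + ?a + ?b + ?c + ?d))"
    by (rule loop_reach[OF _ walk_loops(4)]) simp
  have "?r (0, red m 0) (0, red m (0 + ?a + ?b + ?c + ?d))"
    by (rule rtranclp_trans[OF rtranclp_trans[OF rtranclp_trans[OF s1 s2] s3] s4])
  moreover have "0 + ?a + ?b + ?c + ?d = (a, b, c, d)"
    using v(3-) by (simp add: zero_prod_def)
  ultimately have "?r (0, 0) (0, red m (a, b, c, d))" unfolding r0 by (simp only:)
  moreover have "?r (0, red m (a, b, c, d)) (t, red m ((a, b, c, d) + 0))"
  proof -
    obtain ks where "list_all (\<lambda>k. k < 3) ks" "walk ks 0 0 = (t, 0)"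
      using walk_paths v(2) by (metis atLeastLessThan_iff set_upt zero_le)
    then show ?thesis by (rule walk_reach_from)
  qed
  ultimately show ?thesis unfolding v(1) using red_box[OF z] by (simp add: rtranclp_trans)
qed

section \<open>Eigenvectors obtained from one of finite support\<close>

fun xor_list :: "('b \<Rightarrow> bool) \<Rightarrow> 'b list \<Rightarrow> bool" where
  "xor_list p [] = False"
| "xor_list p (x # xs) = (p x \<noteq> xor_list p xs)"

text \<open>An executable test that every element has even multiplicity, so that any parity sum over
  the list vanishes.\<close>

function cancels :: "'b list \<Rightarrow> bool" where
  "cancels [] = True"
| "cancels (x # xs) = (x \<in> set xs \<and> cancels (remove1 x xs))"
  by pat_completeness auto
termination by (relation "measure length") (auto simp: length_remove1 le_imp_less_Suc)

lemma xor_list_append: "xor_list p (xs @ ys) = (xor_list p xs \<noteq> xor_list p ys)"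
  by (induction xs) auto

lemma xor_list_map: "xor_list p (map f xs) = xor_list (\<lambda>x. p (f x)) xs"
  by (induction xs) auto

lemma xor_list_remove1: "x \<in> set xs \<Longrightarrow> xor_list p xs = (p x \<noteq> xor_list p (remove1 x xs))"
  by (induction xs) auto

lemma xor_list_cancels: "cancels xs \<Longrightarrow> \<not> xor_list p xs"
proof (induction xs rule: cancels.induct)
  case (2 x xs)
  then show ?case using xor_list_remove1[of x xs p] by simp
qed simp

text \<open>The eigenvector equation in the integral cover: the support over \<open>t\<close> and
  those over its neighbours, shifted back by the voltages, cancel in pairs.\<close>

lemma kernel_check:
  "\<forall>t\<in>set [0..<16]. cancels (mk_kernel ! t @ map (\<lambda>s. s - mk_voltage ! t ! 0) (mk_kernel ! (mk_nb ! t ! 0))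
     @ map (\<lambda>s. s - mk_voltage ! t ! 1) (mk_kernel ! (mk_nb ! t ! 1))
     @ map (\<lambda>s. s - mk_voltage ! t ! 2) (mk_kernel ! (mk_nb ! t ! 2)))"
  by code_simp

text \<open>The sum modulo 2 of the translates of the kernel element by the vectors in
  \<open>Y\<close>. Counting along the list keeps multiplicities, so points of the support that
  coincide modulo \<open>m\<close> are handled correctly.\<close>

definition convolve :: "int \<Rightarrow> vec set \<Rightarrow> (nat \<times> vec) set" where
  "convolve m Y = {(t, z). (t, z) \<in> cover_verts m \<and> xor_list (\<lambda>s. red m (z - s) \<in> Y) (mk_kernel ! t)}"

text \<open>After the shift by the voltage, the four parity sums at \<open>v\<close> and its
  neighbours run over the list that cancels by \<open>kernel_check\<close>, whatever
  \<open>Y\<close> is.\<close>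

lemma convolve_eigenspace:
  assumes m: "m > 0"
  shows "convolve m Y \<in> eigenspace (cover_verts m) (cover_nb m)"
proof -
  have "\<not> defect (cover_nb m) (convolve m Y) v" if v_in: "v \<in> cover_verts m" for v
  proof -
    obtain t z where v: "v = (t, z)" "t < 16" "z \<in> box m" using v_in by (auto simp: cover_verts_def)
    have nbk: "cover_nb m v k \<in> convolve m Y
        \<longleftrightarrow> xor_list (\<lambda>s. red m (z - s) \<in> Y) (map (\<lambda>s. s - mk_voltage ! t ! k) (mk_kernel ! (mk_nb ! t ! k)))"
      if k: "k < 3" for k
    proof -
      have "red m (red m (z + mk_voltage ! t ! k) - s) = red m (z - (s - mk_voltage ! t ! k))" for s
      proof -
        have "red m (red m (z + mk_voltage ! t ! k) - s) = red m (z + mk_voltage ! t ! k - s)"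
          by (intro red_diff_cong) simp_all
        then show ?thesis by (simp add: algebra_simps)
      qed
      then show ?thesis
        using mk_nb_less[OF v(2) k] red_in_box[OF m]
        by (simp add: v(1) convolve_def cover_nb_def cover_verts_def xor_list_map)
    qed
    have "v \<in> convolve m Y \<longleftrightarrow> xor_list (\<lambda>s. red m (z - s) \<in> Y) (mk_kernel ! t)"
      using v_in v(1) by (simp add: convolve_def)
    moreover have "\<not> xor_list (\<lambda>s. red m (z - s) \<in> Y) (mk_kernel ! t @ map (\<lambda>s. s - mk_voltage ! t ! 0) (mk_kernel ! (mk_nb ! t ! 0))
     @ map (\<lambda>s. s - mk_voltage ! t ! 1) (mk_kernel ! (mk_nb ! t ! 1))
     @ map (\<lambda>s. s - mk_voltage ! t ! 2) (mk_kernel ! (mk_nb ! t ! 2)))"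
      using kernel_check v(2) by (intro xor_list_cancels) (metis atLeastLessThan_iff set_upt zero_le)
    ultimately show ?thesis
      unfolding defect_def xor_list_append using nbk[of 0] nbk[of 1] nbk[of 2] by simp
  qed
  moreover have "convolve m Y \<subseteq> cover_verts m" by (auto simp: convolve_def)
  ultimately show ?thesis by (simp add: eigenspace_def)
qed

text \<open>For even \<open>m\<close> these are one sixteenth of all translations, and their
  translates of the kernel element can be told apart in the fibre over 0.\<close>

definition even_box :: "int \<Rightarrow> vec set" where
  "even_box m = {(a, b, c, d) \<in> box m. even a \<and> even b \<and> even c \<and> even d}"

text \<open>The four points of the support over the vertex 0 are pairwise distinct modulo 2.\<close>

lemma convolve_even_box:
  assumes m: "m > 0" "even m" and Y: "Y \<subseteq> even_box m" and z: "z \<in> even_box m"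
  shows "(0, z) \<in> convolve m Y \<longleftrightarrow> z \<in> Y"
proof -
  obtain a b c d where abcd: "z = (a, b, c, d)" "even a" "even b" "even c" "even d" and zb: "z \<in> box m"
    using z by (auto simp: even_box_def)
  \<comment> \<open>Parities survive reduction since \<open>m\<close> is even; hence every support
    point other than the origin moves \<open>z\<close> out of the even box.\<close>
  have par: "even (x mod m) \<longleftrightarrow> even x" for x using m(2) by (simp add: dvd_mod_iff)
  have odd: "red m (z - (p, q, r, s)) \<notin> Y" if "odd p \<or> odd q \<or> odd r \<or> odd s" for p q r s
  proof
    assume "red m (z - (p, q, r, s)) \<in> Y"
    then have "red m (z - (p, q, r, s)) \<in> even_box m" using Y by blast
    then show False using that abcd(2-) by (auto simp: abcd(1) even_box_def red_def par)
  qed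
  have "red m (z - (0, 0, 0, 0)) = z" using red_box[OF zb] by (simp add: abcd(1))
  moreover have "mk_kernel ! 0 = [(0, 0, 0, 0), (0, 1, 1, -1), (-1, 1, 0, 0), (-1, 0, -1, 1)]"
    by (simp add: mk_kernel_def)
  ultimately show ?thesis
    using zb odd[of 0 1 1 "-1"] odd[of "-1" 1 0 0] odd[of "-1" 0 "-1" 1]
    by (simp add: convolve_def cover_verts_def)
qed

lemma card_even_box: "card (even_box (2 * int n)) = n ^ 4"
proof -
  let ?d = "\<lambda>(a, b, c, d). (2 * a, 2 * b, 2 * c, 2 * d :: int)"
  have "even_box (2 * int n) = ?d ` box (int n)"
  proof (intro equalityI subsetI)
    fix z assume "z \<in> even_box (2 * int n)"
    then obtain a b c d where z: "z = (2 * a, 2 * b, 2 * c, 2 * d)" "z \<in> box (2 * int n)"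
      by (auto simp: even_box_def elim!: evenE)
    then have "(a, b, c, d) \<in> box (int n)" by (auto simp: box_def)
    then show "z \<in> ?d ` box (int n)" using z(1) by (intro image_eqI[of _ _ "(a, b, c, d)"]) simp_all
  qed (auto simp: even_box_def box_def)
  moreover have "inj_on ?d (box (int n))" by (auto intro!: inj_onI)
  ultimately show ?thesis by (simp add: card_image card_box)
qed

text \<open>\<open>Y\<close> can be read off from \<open>convolve\<close> at the even vectors over
  vertex 0, so the subsets of an even box with \<open>n ^ 4\<close> elements give distinct
  eigenvectors.\<close>

lemma card_eigenspace_cover:
  assumes "n > 0"
  shows "2 ^ (n ^ 4) \<le> card (eigenspace (cover_verts (2 * int n)) (cover_nb (2 * int n)))"
proof -
  let ?m = "2 * int n"
  have m: "?m > 0" "even ?m" using assms by simp_all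
  have fin: "finite (even_box ?m)"
    by (rule finite_subset[OF _ finite_box[of ?m]]) (auto simp: even_box_def)
  have "inj_on (convolve ?m) (Pow (even_box ?m))"
  proof (rule inj_onI)
    fix Y Z assume YZ: "Y \<in> Pow (even_box ?m)" "Z \<in> Pow (even_box ?m)" and eq: "convolve ?m Y = convolve ?m Z"
    have "z \<in> Y \<longleftrightarrow> z \<in> Z" if "z \<in> even_box ?m" for z
      using convolve_even_box[OF m _ that, of Y] convolve_even_box[OF m _ that, of Z] YZ eq by simp
    then show "Y = Z" using YZ by blast
  qed
  moreover have "finite (eigenspace (cover_verts ?m) (cover_nb ?m))"
    by (rule finite_subset[of _ "Pow (cover_verts ?m)"])
      (auto simp: eigenspace_def cover_verts_def finite_box)
  ultimately have "card (Pow (even_box ?m)) \<le> card (eigenspace (cover_verts ?m) (cover_nb ?m))"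
    using convolve_eigenspace[OF m(1)] by (intro card_inj_on_le[of "convolve ?m"]) auto
  then show ?thesis using fin by (simp add: card_Pow card_even_box)
qed

text \<open>A set with defect at every vertex of the base graph; its full preimage has the same
  property in each cover.\<close>

lemma coloring_check:
  "\<forall>t\<in>set [0..<16]. (t \<in> set [0, 4, 5, 6, 7, 8, 9, 15]) \<noteq> ((mk_nb ! t ! 0 \<in> set [0, 4, 5, 6, 7, 8, 9, 15]) \<noteq>
     ((mk_nb ! t ! 1 \<in> set [0, 4, 5, 6, 7, 8, 9, 15]) \<noteq> (mk_nb ! t ! 2 \<in> set [0, 4, 5, 6, 7, 8, 9, 15])))"
  by code_simp

lemma cover_cubic_map:
  assumes n: "n \<ge> 2"
  shows "cubic_map (cover_verts (2 * int n)) (cover_nb (2 * int n)) (0, 0)"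
proof -
  let ?m = "2 * int n"
  have m: "?m > 0" using n by simp
  have z0: "red ?m 0 = 0" "(0::vec) \<in> box ?m" using m by (simp_all add: red_def box_def zero_prod_def)
  have nb0: "cover_nb ?m (0, 0) 0 = (1, 0)" "cover_nb ?m (0, 0) 1 = (2, 0)"
    using m by (simp_all add: cover_nb_def mk_nb_def mk_voltage_def red_def zero_prod_def)
  show ?thesis
  proof
    show "finite (cover_verts ?m)" by (simp add: cover_verts_def finite_box)
    show "(0, 0) \<in> cover_verts ?m" using z0 by (simp add: cover_verts_def)
  next
    fix v k assume "v \<in> cover_verts ?m" and k: "k < (3::nat)"
    then obtain t z where v: "v = (t, z)" "t < 16" "z \<in> box ?m" by (auto simp: cover_verts_def)
    have t: "length (mk_nb ! t) = 3" "distinct (mk_nb ! t)" "\<And>u. u \<in> set (mk_nb ! t) \<Longrightarrow> u < 16 \<and> u \<noteq> t"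
      using mk_nb_checks(1) v(2) by simp_all
    show "cover_nb ?m v k \<in> cover_verts ?m"
      using mk_nb_less[OF v(2) k] red_in_box[OF m] by (simp add: v(1) cover_nb_def cover_verts_def)
    show "cover_nb ?m v k \<noteq> v"
      using t(3)[of "mk_nb ! t ! k"] t(1) k by (simp add: v(1) cover_nb_def)
    show "k = l" if "l < 3" "cover_nb ?m v k = cover_nb ?m v l" for l
      using that t(1,2) k by (simp add: v(1) cover_nb_def nth_eq_iff_index_eq)
    obtain l where l: "l < 3" "mk_nb ! (mk_nb ! t ! k) ! l = t"
      "mk_voltage ! t ! k + mk_voltage ! (mk_nb ! t ! k) ! l = (0, 0, 0, 0)"
      using mk_nb_checks(2) v(2) k by (metis atLeastLessThan_iff set_upt zero_le)
    have "red ?m (red ?m (z + mk_voltage ! t ! k) + mk_voltage ! (mk_nb ! t ! k) ! l)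
        = red ?m (z + mk_voltage ! t ! k + mk_voltage ! (mk_nb ! t ! k) ! l)"
      by (intro red_add_cong) simp_all
    also have "\<dots> = z" using l(3) red_box[OF v(3)] by (simp add: add.assoc zero_prod_def[symmetric])
    finally show "\<exists>l<3. cover_nb ?m (cover_nb ?m v k) l = v"
      using l(1,2) by (intro exI[of _ l]) (simp add: v(1) cover_nb_def)
  next
    fix v assume "v \<in> cover_verts ?m"
    then show "(cover_step ?m)\<^sup>*\<^sup>* (0, 0) v" by (rule cover_connected[OF m])
  next
    have "cover_map ?m rot_perm rot_mat rot_shift (0, 0) = (0, 0)"
      "cover_map ?m rot_perm rot_mat rot_shift (1, 0) = (2, 0)"
      using m by (simp_all add: cover_map_def rot_perm_def rot_mat_def rot_shift_def red_def zero_prod_def)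
    then show "\<exists>a. map_aut (cover_verts ?m) (cover_nb ?m) False a \<and> a (0, 0) = (0, 0)
        \<and> a (cover_nb ?m (0, 0) 0) = cover_nb ?m (0, 0) 1"
      using map_aut_cover_map[OF m cover_aut_checks(1) lin_inverses(1)] nb0 by metis
    have "cover_map ?m inv_perm inv_mat (replicate 16 (0, 0, 0, 0)) (0, 0) = (1, 0)"
      using m by (simp add: cover_map_def inv_perm_def inv_mat_def red_def zero_prod_def)
    then show "\<exists>b. map_aut (cover_verts ?m) (cover_nb ?m) False b \<and> b (0, 0) = cover_nb ?m (0, 0) 0"
      using map_aut_cover_map[OF m cover_aut_checks(2) lin_inverses(2)] nb0 by metis
    have "cover_map ?m refl_perm refl_mat refl_shift (0, 0) = (0, 0)"
      using m by (simp add: cover_map_def refl_perm_def refl_mat_def refl_shift_def red_def zero_prod_def)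
    then show "\<exists>r. map_aut (cover_verts ?m) (cover_nb ?m) True r \<and> r (0, 0) = (0, 0)"
      using map_aut_cover_map[OF m cover_aut_checks(3) lin_inverses(3)] by metis
  next
    let ?C = "{(t, z) \<in> cover_verts ?m. t \<in> set [0, 4, 5, 6, 7, 8, 9, 15]}"
    have "defect (cover_nb ?m) ?C v" if v_in: "v \<in> cover_verts ?m" for v
    proof -
      obtain t z where v: "v = (t, z)" "t < 16" using v_in by (auto simp: cover_verts_def)
      have "cover_nb ?m v k \<in> ?C \<longleftrightarrow> mk_nb ! t ! k \<in> set [0, 4, 5, 6, 7, 8, 9, 15]" if "k < 3" for k
        using mk_nb_less[OF v(2) that] red_in_box[OF m] by (simp add: v(1) cover_nb_def cover_verts_def)
      moreover have "v \<in> ?C \<longleftrightarrow> t \<in> set [0, 4, 5, 6, 7, 8, 9, 15]" using v_in v(1) by simp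
      moreover have "(t \<in> set [0, 4, 5, 6, 7, 8, 9, 15]) \<noteq> ((mk_nb ! t ! 0 \<in> set [0, 4, 5, 6, 7, 8, 9, 15]) \<noteq>
          ((mk_nb ! t ! 1 \<in> set [0, 4, 5, 6, 7, 8, 9, 15]) \<noteq> (mk_nb ! t ! 2 \<in> set [0, 4, 5, 6, 7, 8, 9, 15])))"
        using coloring_check v(2) by (metis atLeastLessThan_iff set_upt zero_le)
      ultimately show ?thesis unfolding defect_def by simp
    qed
    moreover have "?C \<subseteq> cover_verts ?m" by blast
    ultimately show "\<exists>C\<subseteq>cover_verts ?m. \<forall>v\<in>cover_verts ?m. defect (cover_nb ?m) C v" by blast
  next
    \<comment> \<open>The bound \<open>2 ^ (n ^ 4)\<close> must exceed 2, which is where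
      \<open>n \<ge> 2\<close> enters; for \<open>n = 1\<close> it would equal 2.\<close>
    have "(2::nat) < 2 ^ (2 ^ 4)" by simp
    also have "\<dots> \<le> 2 ^ (n ^ 4)" using n by (intro power_increasing power_mono) simp_all
    also have "\<dots> \<le> card (eigenspace (cover_verts ?m) (cover_nb ?m))"
      using n by (intro card_eigenspace_cover) simp
    finally show "2 < card (eigenspace (cover_verts ?m) (cover_nb ?m))" .
  qed
qed

section \<open>The infinite family\<close>

lemma cubic_map_to_nat:
  fixes V :: "'a::countable set" and nb :: "'a \<Rightarrow> nat \<Rightarrow> 'a"
  defines "nb' \<equiv> \<lambda>n k. to_nat (nb (from_nat n) k)"
  assumes "cubic_map V nb v0"
  shows "cubic_map (to_nat ` V) nb' (to_nat v0)"
    and "card (eigenspace (to_nat ` V) nb') = card (eigenspace V nb)"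
proof -
  interpret cubic_map V nb v0 by fact
  have nb'[simp]: "nb' (to_nat v) k = to_nat (nb v k)" for v k by (simp add: nb'_def)
  have mem: "to_nat v \<in> to_nat ` X \<longleftrightarrow> v \<in> X" for v :: 'a and X by (simp add: inj_image_mem_iff)
  have defect: "defect nb' (to_nat ` X) (to_nat v) = defect nb X v" for X v
    unfolding defect_def nb' mem ..
  have aut: "map_aut (to_nat ` V) nb' \<sigma> (\<lambda>n. to_nat (h (from_nat n)))" if h: "map_aut V nb \<sigma> h" for \<sigma> h
    unfolding map_aut_def
  proof (intro conjI ballI)
    have hV: "bij_betw h V V" using h by (simp add: map_aut_def)
    have "(\<lambda>n. to_nat (h (from_nat n))) ` to_nat ` V = to_nat ` h ` V" by (simp add: image_image)
    moreover have "inj_on (\<lambda>n. to_nat (h (from_nat n))) (to_nat ` V)"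
      using hV by (auto simp: bij_betw_def inj_on_def)
    ultimately show "bij_betw (\<lambda>n. to_nat (h (from_nat n))) (to_nat ` V) (to_nat ` V)"
      using hV by (simp add: bij_betw_def)
    fix n assume "n \<in> to_nat ` V"
    then obtain v where v: "v \<in> V" "n = to_nat v" by blast
    obtain c where c: "c < 3" "\<And>k. k < 3 \<Longrightarrow> h (nb v k) = nb (h v) (turn c \<sigma> k)"
      using map_aut_turn[OF h v(1)] by blast
    then show "\<exists>c<3. \<forall>k<3. to_nat (h (from_nat (nb' n k))) = nb' (to_nat (h (from_nat n))) (turn c \<sigma> k)"
      by (intro exI[of _ c]) (simp add: v(2))
  qed
  have eig: "eigenspace (to_nat ` V) nb' = image to_nat ` eigenspace V nb"
  proof (intro equalityI subsetI)
    fix X assume "X \<in> eigenspace (to_nat ` V) nb'"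
    then have X: "X \<subseteq> to_nat ` V" "\<And>v. v \<in> V \<Longrightarrow> \<not> defect nb' X (to_nat v)" by (auto simp: eigenspace_def)
    then obtain Y where Y: "Y \<subseteq> V" "X = to_nat ` Y" by (auto simp: subset_image_iff)
    then have "Y \<in> eigenspace V nb" using X(2) defect by (simp add: eigenspace_def)
    then show "X \<in> image to_nat ` eigenspace V nb" using Y(2) by blast
  next
    fix X assume "X \<in> image to_nat ` eigenspace V nb"
    then show "X \<in> eigenspace (to_nat ` V) nb'" using defect by (auto simp: eigenspace_def)
  qed
  show card: "card (eigenspace (to_nat ` V) nb') = card (eigenspace V nb)"
    unfolding eig by (rule card_image) (simp add: inj_on_def inj_image_eq_iff)
  show "cubic_map (to_nat ` V) nb' (to_nat v0)"
  proof
    show "finite (to_nat ` V)" using finite_V by simp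
    show "to_nat v0 \<in> to_nat ` V" using base by simp
  next
    fix n k assume "n \<in> to_nat ` V" and k: "k < (3::nat)"
    then obtain v where v: "v \<in> V" "n = to_nat v" by blast
    show "nb' n k \<in> to_nat ` V" using nb_in[OF v(1) k] v(2) by simp
    show "nb' n k \<noteq> n" using nb_irrefl[OF v(1) k] v(2) by simp
    show "\<exists>l<3. nb' (nb' n k) l = n" using nb_sym[OF v(1) k] v(2) by simp
    show "k = l" if "l < 3" "nb' n k = nb' n l" for l
      using nb_inj[OF v(1) k that(1)] that(2) v(2) by simp
  next
    fix n assume "n \<in> to_nat ` V"
    then obtain v where v: "v \<in> V" "n = to_nat v" by blast
    from connected[OF v(1)]
    have "(\<lambda>u w. \<exists>k<3. w = nb' u k)\<^sup>*\<^sup>* (to_nat v0) (to_nat v)"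
    proof (induction rule: rtranclp_induct)
      case (step u w)
      then have "\<exists>k<3. to_nat w = nb' (to_nat u) k" by auto
      with step.IH show ?case by (rule rtranclp.rtrancl_into_rtrancl)
    qed simp
    then show "(\<lambda>u w. \<exists>k<3. w = nb' u k)\<^sup>*\<^sup>* (to_nat v0) n" by (simp only: v(2))
  next
    obtain a where a: "map_aut V nb False a" "a v0 = v0" "a (nb v0 0) = nb v0 1" using rotation by blast
    show "\<exists>a. map_aut (to_nat ` V) nb' False a \<and> a (to_nat v0) = to_nat v0
        \<and> a (nb' (to_nat v0) 0) = nb' (to_nat v0) 1"
      using a(2,3) by (intro exI[of _ "\<lambda>n. to_nat (a (from_nat n))"] conjI aut[OF a(1)]) simp_all
    obtain b where b: "map_aut V nb False b" "b v0 = nb v0 0" using inversion by blast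
    show "\<exists>b. map_aut (to_nat ` V) nb' False b \<and> b (to_nat v0) = nb' (to_nat v0) 0"
      using b(2) by (intro exI[of _ "\<lambda>n. to_nat (b (from_nat n))"] conjI aut[OF b(1)]) simp_all
    obtain r where r: "map_aut V nb True r" "r v0 = v0" using reflection by blast
    show "\<exists>r. map_aut (to_nat ` V) nb' True r \<and> r (to_nat v0) = to_nat v0"
      using r(2) by (intro exI[of _ "\<lambda>n. to_nat (r (from_nat n))"] conjI aut[OF r(1)]) simp_all
  next
    obtain C where C: "C \<subseteq> V" "\<And>v. v \<in> V \<Longrightarrow> defect nb C v" using coloring by blast
    have "\<forall>n\<in>to_nat ` V. defect nb' (to_nat ` C) n" using C(2) defect by simp
    then show "\<exists>C\<subseteq>to_nat ` V. \<forall>n\<in>to_nat ` V. defect nb' C n"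
      using C(1) by (intro exI[of _ "to_nat ` C"]) auto
  next
    show "2 < card (eigenspace (to_nat ` V) nb')" using eigenspace_large card by simp
  qed
qed

text \<open>The index is shifted by 2 so that every natural number gives a modulus for which the
  eigenspace is large enough.\<close>

definition base_verts :: "nat \<Rightarrow> nat set" where
  "base_verts n = to_nat ` cover_verts (2 * int (n + 2))"

definition base_nb :: "nat \<Rightarrow> nat \<Rightarrow> nat \<Rightarrow> nat" where
  "base_nb n = (\<lambda>v k. to_nat (cover_nb (2 * int (n + 2)) (from_nat v) k))"

lemma base_cubic_map: "nat_cubic_map (base_verts n) (base_nb n) (to_nat (0 :: nat, 0 :: vec))"
  unfolding nat_cubic_map_def base_verts_def base_nb_def
  by (intro cubic_map_to_nat(1) cover_cubic_map) simp

lemma card_base_eigenspace: "2 ^ ((n + 2) ^ 4) \<le> card (eigenspace (base_verts n) (base_nb n))"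
proof -
  have "card (eigenspace (base_verts n) (base_nb n))
      = card (eigenspace (cover_verts (2 * int (n + 2))) (cover_nb (2 * int (n + 2))))"
    unfolding base_verts_def base_nb_def by (rule cubic_map_to_nat(2)[OF cover_cubic_map]) simp
  then show ?thesis using card_eigenspace_cover[of "n + 2"] by simp
qed

lemma card_base_verts: "card (base_verts n) = 256 * (n + 2) ^ 4"
proof -
  have "card (base_verts n) = card (cover_verts (2 * int (n + 2)))"
    unfolding base_verts_def by (intro card_image) (simp add: inj_on_def)
  also have "\<dots> = 16 * nat (2 * int (n + 2)) ^ 4"
    unfolding cover_verts_def card_cartesian_product card_lessThan by (subst card_box) simp_all
  also have "nat (2 * int (n + 2)) = 2 * (n + 2)" by (simp add: nat_eq_iff)
  finally show ?thesis by (simp only: power_mult_distrib) simp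
qed

lemma exponential_type_local_group:
  assumes "transitive_perm_group L" and L: "perm_isomorphic L ({..<3} \<times> UNIV, local_group rv tw)"
  shows "exponential_type L"
proof -
  let ?\<Gamma> = "\<lambda>n. doubled_graph (base_verts n) (base_nb n)"
  let ?G = "\<lambda>n. lift_group (base_verts n) (base_nb n) rv tw"
  \<comment> \<open>The doubled graph has \<open>512 * (n + 2) ^ 4\<close> vertices, with 512 the
    product of 2, 16 and \<open>2 ^ 4\<close>, and the eigenspace has at least
    \<open>2 ^ ((n + 2) ^ 4)\<close> elements.\<close>
  define \<beta> :: real where "\<beta> = root 512 2"
  have \<beta>: "\<beta> > 1" "\<beta> ^ 512 = 2" by (simp_all add: \<beta>_def)
  have fin: "finite (base_verts n)" for n
    using cubic_map.finite_V[OF base_cubic_map[unfolded nat_cubic_map_def]] .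
  have card: "card (pverts (?\<Gamma> n)) = 512 * (n + 2) ^ 4" for n
    using card_halves[OF fin] by (simp add: card_base_verts)
  have pair: "locally_pair L (?\<Gamma> n) (?G n)" for n
    using base_cubic_map L by (rule nat_cubic_map.doubled_locally_pair)
  have large: "\<exists>n. card (pverts (?\<Gamma> n)) > N" for N
  proof -
    have "N < N + 2" by simp
    also have "\<dots> \<le> (N + 2) ^ 4" by (rule self_le_power) simp_all
    also have "\<dots> \<le> 512 * (N + 2) ^ 4" by simp
    finally have "N < card (pverts (?\<Gamma> N))" by (simp only: card)
    then show ?thesis by blast
  qed
  \<comment> \<open>The constant 1/4 accounts for the index of the eigenvectors vanishing at both
    ends of the arc.\<close>
  have bound: "1 / 4 * \<beta> ^ card (pverts (?\<Gamma> n)) \<le> real (card (arc_stabiliser (?G n) x y))"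
    if "(x, y) \<in> parcs (?\<Gamma> n)" for n x y
  proof -
    have "\<beta> ^ card (pverts (?\<Gamma> n)) = real (2 ^ ((n + 2) ^ 4))"
      unfolding card power_mult \<beta>(2) by simp
    also have "\<dots> \<le> real (card (eigenspace (base_verts n) (base_nb n)))"
      using card_base_eigenspace by (intro of_nat_mono)
    also have "\<dots> \<le> real (4 * card (arc_stabiliser (?G n) x y))"
      using nat_cubic_map.card_eigenspace_le[OF base_cubic_map that] by (intro of_nat_mono)
    finally show ?thesis by simp
  qed
  show ?thesis
    unfolding exponential_type_def
    using assms(1) \<beta>(1) pair large bound
    by (intro conjI exI[of _ "1 / 4"] exI[of _ \<beta>] exI[of _ ?\<Gamma>] exI[of _ ?G]) auto
qed

theorem theorem1p1:
  shows "\<forall>L \<in> {A4_6, S4_6d, S4_6c}. exponential_type L"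
  using exponential_type_local_group[OF A4_6_local_group(2,1)]
    exponential_type_local_group[OF S4_6d_local_group(2,1)]
    exponential_type_local_group[OF S4_6c_local_group(2,1)] by simp

end
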